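(* There is an algorithm which, given linear functions $f_1,\dots,f_n:\mathbb{R}\to\mathbb{R}$ among which exactly $k>0$ are monotone decreasing, computes a minimum permutation (and likewise a maximum permutation) for $f_1,\dots,f_n$ in $O(k\,2^k n^6)$ time.
   Context: A linear function is $f(x)=ax+b$ with $a,b\in\mathbb{R}$; it is monotone decreasing if $a<0$. For a permutation $\sigma$ of $[n]$, $f^\sigma=f_{\sigma(n)}\circ\cdots\circ f_{\sigma(1)}$; $\sigma$ is minimum if $f^\sigma(x)\le f^\rho(x)$ for all $x$ and all permutations $\rho$, and maximum if $f^\sigma(x)\ge f^\rho(x)$ for all $x$ and all $\rho$. Running time is measured in a model where arithmetic operations and comparisons on reals cost unit time. *)

theory Defs
  imports Complex_Main "HOL-Combinatorics.Permutations"
begin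

text \<open>Functions f_0,...,f_(n-1) (0-indexed) with f_i x = a i * x + b i.
  For sigma a permutation of {..<n}, lin_comp applies f_(sigma 0) first and
  f_(sigma (n-1)) last, i.e. f^sigma = f_(sigma(n-1)) o ... o f_(sigma 0).\<close>

definition lin_comp :: "(nat \<Rightarrow> real) \<Rightarrow> (nat \<Rightarrow> real) \<Rightarrow> nat \<Rightarrow> (nat \<Rightarrow> nat) \<Rightarrow> real \<Rightarrow> real" where
  "lin_comp a b n \<sigma> x = fold (\<lambda>j y. a (\<sigma> j) * y + b (\<sigma> j)) [0..<n] x"

definition is_min_perm :: "(nat \<Rightarrow> real) \<Rightarrow> (nat \<Rightarrow> real) \<Rightarrow> nat \<Rightarrow> (nat \<Rightarrow> nat) \<Rightarrow> bool" where
  "is_min_perm a b n \<sigma> \<longleftrightarrow> \<sigma> permutes {..<n} \<and>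
     (\<forall>\<rho>. \<rho> permutes {..<n} \<longrightarrow> (\<forall>x. lin_comp a b n \<sigma> x \<le> lin_comp a b n \<rho> x))"

definition is_max_perm :: "(nat \<Rightarrow> real) \<Rightarrow> (nat \<Rightarrow> real) \<Rightarrow> nat \<Rightarrow> (nat \<Rightarrow> nat) \<Rightarrow> bool" where
  "is_max_perm a b n \<sigma> \<longleftrightarrow> \<sigma> permutes {..<n} \<and>
     (\<forall>\<rho>. \<rho> permutes {..<n} \<longrightarrow> (\<forall>x. lin_comp a b n \<sigma> x \<ge> lin_comp a b n \<rho> x))"

text \<open>Memory: real registers R and natural-number registers N (index registers),
  both unbounded, with indirect addressing. A program is a fixed finite
  instruction list (uniform in the input size).\<close>

datatype instr =
    RConst nat real
  | RAdd nat nat nat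
  | RSub nat nat nat
  | RMul nat nat nat
  | RDiv nat nat nat
  | RLoad nat nat
  | RStore nat nat
  | NConst nat nat
  | NAdd nat nat nat
  | NSub nat nat nat         (* N[i] := N[j] - N[k] (truncated) *)
  | NLoad nat nat
  | NStore nat nat
  | JmpRLess nat nat nat
  | JmpNLess nat nat nat
  | Jmp nat
  | Halt

type_synonym state = "nat \<times> (nat \<Rightarrow> nat) \<times> (nat \<Rightarrow> real)"

definition halted :: "instr list \<Rightarrow> state \<Rightarrow> bool" where
  "halted p s \<longleftrightarrow> (case s of (pc, N, R) \<Rightarrow> pc \<ge> length p \<or> p ! pc = Halt)"

fun exec_instr :: "instr \<Rightarrow> state \<Rightarrow> state" where
  "exec_instr (RConst i c) (pc, N, R) = (Suc pc, N, R(i := c))"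
| "exec_instr (RAdd i j k) (pc, N, R) = (Suc pc, N, R(i := R j + R k))"
| "exec_instr (RSub i j k) (pc, N, R) = (Suc pc, N, R(i := R j - R k))"
| "exec_instr (RMul i j k) (pc, N, R) = (Suc pc, N, R(i := R j * R k))"
| "exec_instr (RDiv i j k) (pc, N, R) = (Suc pc, N, R(i := R j / R k))"
| "exec_instr (RLoad i j) (pc, N, R) = (Suc pc, N, R(i := R (N j)))"
| "exec_instr (RStore i j) (pc, N, R) = (Suc pc, N, R(N i := R j))"
| "exec_instr (NConst i c) (pc, N, R) = (Suc pc, N(i := c), R)"
| "exec_instr (NAdd i j k) (pc, N, R) = (Suc pc, N(i := N j + N k), R)"
| "exec_instr (NSub i j k) (pc, N, R) = (Suc pc, N(i := N j - N k), R)"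
| "exec_instr (NLoad i j) (pc, N, R) = (Suc pc, N(i := N (N j)), R)"
| "exec_instr (NStore i j) (pc, N, R) = (Suc pc, N(N i := N j), R)"
| "exec_instr (JmpRLess i j l) (pc, N, R) = ((if R i < R j then l else Suc pc), N, R)"
| "exec_instr (JmpNLess i j l) (pc, N, R) = ((if N i < N j then l else Suc pc), N, R)"
| "exec_instr (Jmp l) (pc, N, R) = (l, N, R)"
| "exec_instr Halt s = s"

definition step :: "instr list \<Rightarrow> state \<Rightarrow> state" where
  "step p s = (if halted p s then s else exec_instr (p ! fst s) s)"

definition run :: "instr list \<Rightarrow> nat \<Rightarrow> state \<Rightarrow> state" where
  "run p t s = (step p ^^ t) s"

definition init_state :: "nat \<Rightarrow> (nat \<Rightarrow> real) \<Rightarrow> (nat \<Rightarrow> real) \<Rightarrow> state" where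
  "init_state n a b = (0, (\<lambda>i. if i = 0 then n else 0),
     (\<lambda>r. if r < 2 * n then (if even r then a (r div 2) else b (r div 2)) else 0))"

definition output_perm :: "nat \<Rightarrow> state \<Rightarrow> nat \<Rightarrow> nat" where
  "output_perm n s = (\<lambda>j. if j < n then fst (snd s) j else j)"

definition computes_within ::
  "instr list \<Rightarrow> ((nat \<Rightarrow> real) \<Rightarrow> (nat \<Rightarrow> real) \<Rightarrow> nat \<Rightarrow> (nat \<Rightarrow> nat) \<Rightarrow> bool)
     \<Rightarrow> (nat \<Rightarrow> nat \<Rightarrow> real) \<Rightarrow> bool" where
  "computes_within p P T \<longleftrightarrow>
     (\<forall>n k a b. k > 0 \<and> card {i. i < n \<and> a i < 0} = k \<longrightarrow>
        (\<exists>t. real t \<le> T n k \<and> halted p (run p t (init_state n a b)) \<and>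
             P a b n (output_perm n (run p t (init_state n a b)))))"

end

theory Submission
  imports Defs "HOL-Library.Nat_Bijection"
begin

text \<open>All orders have the same slope, so only the constant term matters. To a composition
  \<open>x \<mapsto> \<alpha> x + \<beta>\<close> we attach the vector \<open>(\<beta>, 1 - \<alpha>)\<close>; the sign of the cross product of two such
  vectors tells which order of the two compositions is smaller. Exchanging adjacent blocks of an
  optimal order shows that the steps of the nondecreasing functions lie on the boundary of the
  convex hull of a path in the plane. Hence right after a nondecreasing function has been applied,
  the nondecreasing functions applied so far form an arc of their cyclic order by direction, and
  the new one extends the arc by one element; a perturbation handles parallel and zero
  vectors and constant functions. There are only \<open>2 ^ k\<close> sets of decreasing functions and
  at most \<open>n (n + 1) + 1\<close> arcs, so a breadth-first search through these sets, with a table of the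
  minimal and maximal constant terms addressed by the bit mask of the set, finds an optimal order.\<close>

section \<open>Compositions of linear functions\<close>

text \<open>The geometric argument needs distinct directions, nonzero vectors and positive slopes.
  With ties an optimal order can violate the arc property: for equal translations every order is
  optimal, in particular one that jumps around the cycle. Hence only the existence of one optimal
  order with the arc property is proved, and it is obtained from perturbed data by a limit. The
  search needs no more than that. Each table entry of a visited set is the value of an actual order
  of that set, so the final entry cannot beat the optimum; following the one well-behaved optimal
  order through the search shows that it is no worse either. Minimum and maximum have to be
  tabulated together, since a decreasing function applied last turns the extremal value of one kind
  into that of the other. With O(n) work for each of the O(\<open>2 ^ k * n ^ 2\<close>) sets, the
  time is O(\<open>2 ^ k * n ^ 3\<close>). Addressing tables by bit masks is affordable because only
  registers that are touched cost time.\<close>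

definition slp :: "(nat \<Rightarrow> real) \<Rightarrow> nat list \<Rightarrow> real" where
  "slp a xs = prod_list (map a xs)"

definition cst :: "(nat \<Rightarrow> real) \<Rightarrow> (nat \<Rightarrow> real) \<Rightarrow> nat list \<Rightarrow> real" where
  "cst a b xs = fold (\<lambda>i y. a i * y + b i) xs 0"

lemma fold_affine: "fold (\<lambda>i y. a i * y + b i) xs x = slp a xs * x + cst a b xs"
proof (induction xs arbitrary: x)
  case Nil
  show ?case by (simp add: slp_def cst_def)
next
  case (Cons i xs)
  have "cst a b (i # xs) = slp a xs * b i + cst a b xs"
    using Cons[of "b i"] by (simp add: cst_def)
  with Cons[of "a i * x + b i"] show ?case
    by (simp add: slp_def algebra_simps)
qed

lemma slp_simps [simp]: "slp a [] = 1" "slp a (i # xs) = a i * slp a xs"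
  "slp a (xs @ ys) = slp a xs * slp a ys"
  by (simp_all add: slp_def)

lemma cst_append [simp]: "cst a b (xs @ ys) = slp a ys * cst a b xs + cst a b ys"
  using fold_affine[of a b ys "cst a b xs"] by (simp add: cst_def)

lemma cst_Nil [simp]: "cst a b [] = 0"
  by (simp add: cst_def)

lemma cst_single [simp]: "cst a b [i] = b i"
  by (simp add: cst_def)

lemma slp_perm: "distinct xs \<Longrightarrow> slp a xs = (\<Prod>i\<in>set xs. a i)"
  by (simp add: slp_def prod.distinct_set_conv_list)

section \<open>Orders of the functions and their optimality\<close>

definition ords :: "nat \<Rightarrow> nat list set" where
  "ords n = {xs. distinct xs \<and> set xs = {..<n}}"

lemma finite_ords: "finite (ords n)"
proof -
  have "ords n \<subseteq> {xs. set xs \<subseteq> {..<n} \<and> length xs = n}"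
    using distinct_card by (fastforce simp: ords_def)
  then show ?thesis
    using finite_lists_length_eq[of "{..<n}" n] finite_subset by blast
qed

text \<open>One notion serves both problems: a positive \<open>\<epsilon>\<close> asks for the least
  constant term, a negative one for the greatest.\<close>

definition optl :: "real \<Rightarrow> (nat \<Rightarrow> real) \<Rightarrow> (nat \<Rightarrow> real) \<Rightarrow> nat \<Rightarrow> nat list \<Rightarrow> bool" where
  "optl \<epsilon> a b n xs \<longleftrightarrow> xs \<in> ords n \<and> (\<forall>ys\<in>ords n. \<epsilon> * cst a b xs \<le> \<epsilon> * cst a b ys)"

lemma optl_exists: "\<exists>xs. optl \<epsilon> a b n xs"
proof -
  have "[0..<n] \<in> ords n" by (auto simp: ords_def)
  then have ne: "ords n \<noteq> {}" by auto
  let ?f = "\<lambda>xs. \<epsilon> * cst a b xs"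
  have "optl \<epsilon> a b n (arg_min_on ?f (ords n))"
    using arg_min_if_finite(1)[OF finite_ords ne, of ?f] arg_min_least[OF finite_ords ne, of _ ?f]
    by (auto simp: optl_def)
  then show ?thesis by blast
qed

section \<open>Cross products and the exchange of blocks\<close>

definition cross :: "complex \<Rightarrow> complex \<Rightarrow> real" where
  "cross u v = Re u * Im v - Im u * Re v"

text \<open>Two compositions commute exactly if these vectors are parallel.\<close>

definition vec :: "(nat \<Rightarrow> real) \<Rightarrow> (nat \<Rightarrow> real) \<Rightarrow> nat list \<Rightarrow> complex" where
  "vec a b xs = Complex (cst a b xs) (1 - slp a xs)"

lemma vec_append: "vec a b (xs @ ys) = vec a b ys + slp a ys *\<^sub>R vec a b xs"
  by (simp add: vec_def complex_eq_iff algebra_simps)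

lemma cross_linear [simp]:
  "cross (u + v) w = cross u w + cross v w" "cross w (u + v) = cross w u + cross w v"
  "cross (r *\<^sub>R u) w = r * cross u w" "cross w (r *\<^sub>R u) = r * cross w u"
  "cross (u - v) w = cross u w - cross v w" "cross w (u - v) = cross w u - cross w v"
  "cross (- u) w = - cross u w" "cross w (- u) = - cross w u"
  "cross u u = 0"
  by (simp_all add: cross_def algebra_simps)

lemma cross_commute: "cross u v = - cross v u"
  by (simp add: cross_def)

text \<open>The Pluecker relation for four plane vectors. It turns bounds on the functionals
  \<open>cross g\<close> and \<open>cross s\<close> at two points into the sign of the cross product
  of these points.\<close>

lemma cross_exchange: "cross g s * cross x y = cross g x * cross s y - cross g y * cross s x"
  by (simp add: cross_def algebra_simps)

text \<open>Cramer's rule: \<open>cross g t\<close> times \<open>s\<close> is the combination of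
  \<open>g\<close> and \<open>t\<close> with coefficients \<open>cross s t\<close> and
  \<open>cross g s\<close>; apply it to \<open>x\<close>.\<close>

lemma cross_cone: "cross g t * cross s x = cross s t * cross g x + cross g s * cross t x"
  by (simp add: cross_def algebra_simps)

text \<open>The contribution of \<open>L\<close> to the constant term is the same for both orders
  and \<open>Z\<close> only scales the difference by its slope. What remains is the commutator of
  the maps of \<open>X\<close> and \<open>Y\<close>, a translation by the cross product of their
  vectors up to sign.\<close>

lemma block_swap:
  assumes "optl \<epsilon> a b n (L @ X @ Y @ Z)"
  shows "\<epsilon> * slp a Z * cross (vec a b X) (vec a b Y) \<ge> 0"
proof -
  have "L @ X @ Y @ Z \<in> ords n" using assms by (simp add: optl_def)
  then have "L @ Y @ X @ Z \<in> ords n" by (auto simp: ords_def)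
  then have "\<epsilon> * cst a b (L @ X @ Y @ Z) \<le> \<epsilon> * cst a b (L @ Y @ X @ Z)"
    using assms by (auto simp: optl_def)
  then show ?thesis
    by (simp add: cross_def vec_def algebra_simps)
qed

text \<open>In the next lemma the cyclic order of the directions is \<open>g\<close>, \<open>s\<close>, \<open>t\<close>, and the origin
  lies on a supporting line with normal \<open>g\<close> of a convex set supported at \<open>x\<close> by \<open>s\<close> and at
  \<open>y\<close> by \<open>t\<close>. A supporting functional \<open>u\<close> is written as \<open>cross u\<close>.\<close>

lemma support_order:
  assumes ord: "0 < \<psi>" "\<psi> < \<phi>" "\<phi> < 2 * pi"
    and sgn: "cross g s = A * sin \<psi>" "cross g t = B * sin \<phi>" "cross s t = C * sin (\<phi> - \<psi>)"
    and pos: "A > 0" "B > 0" "C > 0"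
    and "cross g x \<ge> 0" "cross g y \<ge> 0"
    and "cross s x \<le> 0" "cross s x \<le> cross s y"
    and "cross t y \<le> 0" "cross t y \<le> cross t x"
  shows "cross x y \<ge> 0"
proof -
  \<comment> \<open>Each of \<open>first\<close> and \<open>second\<close> settles the claim from a
    comparison of \<open>cross g x\<close> with \<open>cross g y\<close>; the cases below show that
    one of them applies.\<close>
  have first: "cross x y \<ge> 0" if G: "cross g s > 0" and le: "cross g x \<le> cross g y"
  proof -
    have "cross g x * cross s y \<ge> cross g x * cross s x"
      using assms by (intro mult_left_mono) auto
    moreover have "cross g y * cross s x \<le> cross g x * cross s x"
      using assms le by (intro mult_right_mono_neg) auto
    ultimately have "cross g s * cross x y \<ge> 0"
      using cross_exchange[of g s x y] by linarith
    then show ?thesis using G by (simp add: zero_le_mult_iff)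
  qed
  have second: "cross x y \<ge> 0" if T: "cross g t < 0" and le: "cross g y \<le> cross g x"
  proof -
    have "cross g y * cross t x \<ge> cross g y * cross t y"
      using assms by (intro mult_left_mono) auto
    moreover have "cross g x * cross t y \<le> cross g y * cross t y"
      using assms le by (intro mult_right_mono_neg) auto
    ultimately have "cross g t * cross x y \<le> 0"
      using cross_exchange[of g t x y] by linarith
    then show ?thesis using T by (simp add: mult_le_0_iff)
  qed
  have neg: "sin z < 0" if "pi < z" "z < 2 * pi" for z
    using sin_lt_zero that by blast
  \<comment> \<open>If \<open>s\<close> and \<open>t\<close> lie on different sides of the line of
    \<open>g\<close>, either comparison will do. If \<open>\<phi> < pi\<close>, then
    \<open>s\<close> lies in the cone of \<open>g\<close> and \<open>t\<close>; if
    \<open>\<psi> > pi\<close>, then \<open>t\<close> lies in the cone of \<open>s\<close> and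
    \<open>g\<close>. \<open>cross_cone\<close> then forces the comparison that is needed; the
    boundary cases are covered by the weak inequalities.\<close>
  consider "\<psi> < pi" "pi < \<phi>" | "\<phi> \<le> pi" | "pi \<le> \<psi>" by linarith
  then show ?thesis
  proof cases
    case 1
    have "cross g s > 0" "cross g t < 0"
      using sgn pos ord 1 sin_gt_zero[of \<psi>] neg[of \<phi>] by (auto simp: mult_pos_neg)
    then show ?thesis using first second by linarith
  next
    case 2
    have G: "cross g s > 0" and K: "cross s t > 0" and T: "cross g t \<ge> 0"
      using sgn pos ord 2 sin_gt_zero[of \<psi>] sin_gt_zero[of "\<phi> - \<psi>"] sin_ge_zero[of \<phi>] by auto
    have "cross g t * (cross s y - cross s x)
        = cross s t * (cross g y - cross g x) + cross g s * (cross t y - cross t x)"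
      using cross_cone[of g t s x] cross_cone[of g t s y] by (simp add: algebra_simps)
    moreover have "cross g t * (cross s y - cross s x) \<ge> 0" using T assms by simp
    moreover have "cross g s * (cross t y - cross t x) \<le> 0"
      using G assms by (simp add: mult_nonneg_nonpos)
    ultimately have "cross s t * (cross g y - cross g x) \<ge> 0" by linarith
    then have "cross g x \<le> cross g y" using K by (simp add: zero_le_mult_iff)
    then show ?thesis using first G by simp
  next
    case 3
    have T: "cross g t < 0" and K: "cross s t > 0"
      using sgn pos ord 3 neg[of \<phi>] sin_gt_zero[of "\<phi> - \<psi>"] by (auto simp: mult_pos_neg)
    have G: "cross g s \<le> 0"
      using sgn pos ord 3 neg[of \<psi>] by (cases "\<psi> = pi") (auto simp: mult_le_0_iff)
    have "cross g t * (cross s y - cross s x)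
        = cross s t * (cross g y - cross g x) + cross g s * (cross t y - cross t x)"
      using cross_cone[of g t s x] cross_cone[of g t s y] by (simp add: algebra_simps)
    moreover have "cross g t * (cross s y - cross s x) \<le> 0"
      using T assms by (simp add: mult_nonpos_nonneg)
    moreover have "cross g s * (cross t y - cross t x) \<ge> 0"
      using G assms by (simp add: mult_nonpos_nonpos)
    ultimately have "cross s t * (cross g y - cross g x) \<le> 0" by linarith
    then have "cross g y \<le> cross g x" using K by (simp add: mult_le_0_iff)
    then show ?thesis using second T by simp
  qed
qed

lemma cross_rcis: "cross (rcis r \<alpha>) (rcis s \<beta>) = r * s * sin (\<beta> - \<alpha>)"
  by (simp add: cross_def sin_diff algebra_simps)

lemma vec_single: "vec a b [i] = Complex (b i) (1 - a i)"
  by (simp add: vec_def)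

text \<open>The increasing edges of the path of partial compositions lie on the boundary of its convex
  hull, and the path turns with the sign of the slope of the remaining composition. The points
  \<open>x\<close>, \<open>y\<close> below are end points of the edges of \<open>s\<close> and \<open>t\<close> relative to the end point of the edge
  of \<open>g\<close>.\<close>

lemma no_crossing:
  fixes a b :: "nat \<Rightarrow> real" and g s t :: nat
  assumes opt: "optl \<epsilon> a b n (U @ g # W)"
    and s: "s \<in> set U" and t: "t \<in> set W"
    and pos: "a g > 0" "a s > 0" "a t > 0"
    and nz: "\<And>i. i < n \<Longrightarrow> a i \<noteq> 0"
    and v: "vec a b [g] = rcis rg \<theta>" "vec a b [s] = rcis rs (\<theta> + \<psi>)" "vec a b [t] = rcis rt (\<theta> + \<phi>)"
    and r: "rg > 0" "rs > 0" "rt > 0"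
    and ang: "0 < \<psi>" "\<psi> < 2 * pi" "0 < \<phi>" "\<phi> < 2 * pi"
    and dir: "\<epsilon> * slp a W > 0 \<and> \<psi> < \<phi> \<or> \<epsilon> * slp a W < 0 \<and> \<phi> < \<psi>"
  shows False
proof -
  obtain U1 U3 where U: "U = U1 @ s # U3" using s split_list by fastforce
  obtain W1 W3 where W: "W = W1 @ t # W3" using t split_list by fastforce
  define P where "P = \<epsilon> * slp a W"
  define Q where "Q = \<epsilon> * slp a W3"
  have P: "P = Q * a t * slp a W1" by (simp add: P_def Q_def W)
  have Pnz: "P \<noteq> 0" using dir by (auto simp: P_def)
  have Q: "Q \<noteq> 0" using Pnz P by auto
  have A3: "slp a U3 \<noteq> 0"
  proof -
    have "set U3 \<subseteq> {..<n}" using opt by (auto simp: optl_def ords_def U)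
    then have "\<forall>i\<in>set U3. a i \<noteq> 0" using nz by auto
    then show ?thesis by (auto simp: slp_def prod_list_zero_iff)
  qed
  let ?v = "vec a b"
  have swap: "\<epsilon> * slp a Z * cross (?v X) (?v Y) \<ge> 0" if "U1 @ s # U3 @ g # W1 @ t # W3 = L @ X @ Y @ Z"
    for L X Y Z using block_swap[of \<epsilon> a b n L X Y Z] opt that by (simp add: U W)
  \<comment> \<open>The edge of a function in the path is its vector times \<open>\<epsilon>\<close>
    times the slope of everything applied after it. Seen from the end of the edge of
    \<open>g\<close>, that edge starts at \<open>z\<close>, the edge of \<open>s\<close> runs from
    \<open>x'\<close> to \<open>x\<close>, and the edge of \<open>t\<close> from \<open>y\<close> to
    \<open>y'\<close>.\<close>
  define x x' z where "x = (- P) *\<^sub>R ?v (U3 @ [g])" and "x' = (- P) *\<^sub>R ?v ([s] @ U3 @ [g])"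
    and "z = (- P) *\<^sub>R ?v [g]"
  define y y' where "y = (Q * a t) *\<^sub>R ?v W1" and "y' = Q *\<^sub>R ?v (W1 @ [t])"
  have x': "x' = x + (- P * slp a U3 * a g) *\<^sub>R ?v [s]"
    unfolding x'_def x_def by (subst vec_append) (simp add: algebra_simps)
  have y': "y' = y + Q *\<^sub>R ?v [t]"
    unfolding y'_def y_def by (subst vec_append) (simp add: algebra_simps)

  \<comment> \<open>Exchange the block that ends with \<open>g\<close> and the block that follows
    it; including or omitting \<open>s\<close> and \<open>t\<close> gives the four pairs of end
    points.\<close>
  have xy: "P * cross u w \<le> 0" if "u \<in> {x, x'}" "w \<in> {y, y'}" for u w
  proof -
    have 1: "Q * a t * cross (?v (U3 @ [g])) (?v W1) \<ge> 0"
      using swap[of "U1 @ [s]" "U3 @ [g]" W1 "t # W3"] by (simp add: Q_def mult_ac)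
    have 2: "Q * a t * cross (?v ([s] @ U3 @ [g])) (?v W1) \<ge> 0"
      using swap[of "U1" "[s] @ U3 @ [g]" W1 "t # W3"] by (simp add: Q_def mult_ac)
    have 3: "Q * cross (?v (U3 @ [g])) (?v (W1 @ [t])) \<ge> 0"
      using swap[of "U1 @ [s]" "U3 @ [g]" "W1 @ [t]" "W3"] by (simp add: Q_def mult_ac)
    have 4: "Q * cross (?v ([s] @ U3 @ [g])) (?v (W1 @ [t])) \<ge> 0"
      using swap[of "U1" "[s] @ U3 @ [g]" "W1 @ [t]" "W3"] by (simp add: Q_def mult_ac)
    have *: "P * (- P * c) \<le> 0" if "c \<ge> 0" for c :: real
      using that mult_nonneg_nonneg[of "P * P" c] by (simp add: mult.assoc)
    show ?thesis
      using that *[OF 1] *[OF 2] *[OF 3] *[OF 4]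
      by (auto simp: x_def x'_def y_def y'_def mult_ac)
  qed
  have gx: "cross (?v [g]) u \<ge> 0" if "u \<in> {x, x'}" for u
  proof -
    have 1: "P * cross (?v U3) (?v [g]) \<ge> 0"
      using swap[of "U1 @ [s]" U3 "[g]" "W"] by (simp add: P_def W)
    have 2: "P * cross (?v ([s] @ U3)) (?v [g]) \<ge> 0"
      using swap[of "U1" "[s] @ U3" "[g]" "W"] by (simp add: P_def W)
    have "cross (?v [g]) x = a g * (P * cross (?v U3) (?v [g]))"
      using cross_commute[of "?v [g]" "?v U3"] by (simp add: x_def vec_append)
    moreover have "cross (?v [g]) x' = a g * (P * cross (?v ([s] @ U3)) (?v [g]))"
      using cross_commute[of "?v [g]" "?v ([s] @ U3)"] vec_append[of a b "[s] @ U3" "[g]"]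
      by (simp add: x'_def)
    ultimately show ?thesis using that 1 2 pos by auto
  qed
  have gy: "cross (?v [g]) w \<ge> 0" if "w \<in> {y, y'}" for w
  proof -
    have "Q * a t * cross (?v [g]) (?v W1) \<ge> 0"
      using swap[of "U1 @ s # U3" "[g]" W1 "t # W3"] by (simp add: Q_def mult_ac)
    moreover have "Q * cross (?v [g]) (?v (W1 @ [t])) \<ge> 0"
      using swap[of "U1 @ s # U3" "[g]" "W1 @ [t]" "W3"] by (simp add: Q_def mult_ac)
    ultimately show ?thesis using that by (auto simp: y_def y'_def mult_ac)
  qed
  have sx: "cross (?v [s]) u = cross (?v [s]) x" if "u \<in> {x, x'}" for u
    using that by (auto simp: x')
  have sx0: "cross (?v [s]) x \<le> 0"
    using swap[of U1 "[s]" "U3 @ [g]" W] by (simp add: x_def P_def W)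
  have sxy: "cross (?v [s]) x \<le> cross (?v [s]) w" if "w \<in> {y, y'}" for w
  proof -
    have "Q * a t * cross (?v [s]) (?v ((U3 @ [g]) @ W1)) \<ge> 0"
      using swap[of U1 "[s]" "(U3 @ [g]) @ W1" "t # W3"] by (simp add: Q_def mult_ac)
    then have "Q * a t * cross (?v [s]) (?v W1) + P * cross (?v [s]) (?v (U3 @ [g])) \<ge> 0"
      unfolding vec_append[of a b "U3 @ [g]" W1] by (simp add: P algebra_simps)
    moreover have "Q * cross (?v [s]) (?v ((U3 @ [g]) @ (W1 @ [t]))) \<ge> 0"
      using swap[of U1 "[s]" "(U3 @ [g]) @ W1 @ [t]" "W3"] by (simp add: Q_def mult_ac)
    then have "Q * cross (?v [s]) (?v (W1 @ [t])) + P * cross (?v [s]) (?v (U3 @ [g])) \<ge> 0"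
      unfolding vec_append[of a b "U3 @ [g]" "W1 @ [t]"] by (simp add: P algebra_simps)
    ultimately show ?thesis using that by (auto simp: x_def y_def y'_def algebra_simps)
  qed
  have ty: "cross (?v [t]) w = cross (?v [t]) y" if "w \<in> {y, y'}" for w
    using that by (auto simp: y')
  have ty0: "cross (?v [t]) y \<le> 0"
  proof -
    have "a t * (Q * cross (?v W1) (?v [t])) \<ge> 0"
      using swap[of "U1 @ s # U3 @ [g]" W1 "[t]" "W3"] pos by (simp add: Q_def)
    then show ?thesis using cross_commute[of "?v [t]" "?v W1"] by (simp add: y_def mult_ac)
  qed
  have tyX: "cross (?v [t]) y \<le> cross (?v [t]) ((- P) *\<^sub>R ?v X)"
    if "U1 @ s # U3 @ g # W1 @ t # W3 = L @ X @ W1 @ t # W3" for L X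
  proof -
    have "a t * (Q * cross (?v (X @ W1)) (?v [t])) \<ge> 0"
      using swap[of L "X @ W1" "[t]" "W3"] that pos by (simp add: Q_def)
    then show ?thesis
      using cross_commute[of "?v [t]" "?v W1"] cross_commute[of "?v [t]" "?v X"]
      unfolding vec_append[of a b X W1] by (simp add: y_def P algebra_simps)
  qed
  have tyx: "cross (?v [t]) y \<le> cross (?v [t]) u" if "u \<in> {x, x'}" for u
    using that tyX[of "U1 @ [s]" "U3 @ [g]"] tyX[of "U1" "s # U3 @ [g]"] by (auto simp: x_def x'_def)
  have tyz: "cross (?v [t]) y \<le> cross (?v [t]) z"
    using tyX[of "U1 @ s # U3" "[g]"] by (simp add: z_def)
  have sxz: "cross (?v [s]) x \<le> cross (?v [s]) z"
  proof -
    have "P * (a g * cross (?v [s]) (?v U3)) \<ge> 0"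
      using swap[of U1 "[s]" U3 "g # W"] by (simp add: P_def W mult_ac)
    then show ?thesis by (simp add: x_def z_def vec_append algebra_simps)
  qed

  have gs: "cross (?v [g]) (?v [s]) = rg * rs * sin \<psi>" by (simp only: v cross_rcis) simp
  have gt: "cross (?v [g]) (?v [t]) = rg * rt * sin \<phi>" by (simp only: v cross_rcis) simp
  have st: "cross (?v [s]) (?v [t]) = rs * rt * sin (\<phi> - \<psi>)" by (simp only: v cross_rcis) simp
  have ts: "cross (?v [t]) (?v [s]) = rt * rs * sin (\<psi> - \<phi>)" by (simp only: v cross_rcis) simp
  \<comment> \<open>\<open>support_order\<close>, with \<open>s\<close> and \<open>t\<close>
    interchanged for negative \<open>P\<close>, gives the sign opposite to \<open>xy\<close>. A
    single vanishing product would be no contradiction; all four together make the edges of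
    \<open>s\<close> and \<open>t\<close> parallel.\<close>
  have zero: "cross u w = 0" if uw: "u \<in> {x, x'}" "w \<in> {y, y'}" for u w
  proof -
    note f = gx[OF uw(1)] gy[OF uw(2)] sx0[folded sx[OF uw(1)]] sxy[OF uw(2), folded sx[OF uw(1)]]
      ty0[folded ty[OF uw(2)]] tyx[OF uw(1), folded ty[OF uw(2)]]
    have r2: "rg * rs > 0" "rg * rt > 0" "rs * rt > 0" "rt * rs > 0" using r by simp_all
    from dir show ?thesis
    proof
      assume *: "\<epsilon> * slp a W > 0 \<and> \<psi> < \<phi>"
      have "cross u w \<ge> 0"
        by (rule support_order[OF ang(1) conjunct2[OF *] ang(4) gs gt st r2(1,2,3) f])
      then show ?thesis using xy[OF uw] * by (fold P_def) (auto simp: mult_le_0_iff)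
    next
      assume *: "\<epsilon> * slp a W < 0 \<and> \<phi> < \<psi>"
      have "cross w u \<ge> 0"
        by (rule support_order[OF ang(3) conjunct2[OF *] ang(2) gt gs ts r2(2,1,4) f(2,1,5,6,3,4)])
      then show ?thesis using xy[OF uw] * cross_commute[of u w]
        by (fold P_def) (auto simp: zero_le_mult_iff)
    qed
  qed
  have "slp a U3 * a g * cross (?v [s]) w = 0" if "w \<in> {y, y'}" for w
    using zero[of x w] zero[of x' w] that Pnz by (auto simp: x')
  then have sy: "cross (?v [s]) w = 0" if "w \<in> {y, y'}" for w
    using A3 pos that by auto
  have "cross (?v [s]) (?v [t]) = 0"
    using sy[of y] sy[of y'] Q by (auto simp: y')
  \<comment> \<open>The angles differ by less than a full turn and are not equal, so parallel edges
    must have opposite directions.\<close>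
  then have "sin (\<phi> - \<psi>) = 0" using st r by simp
  then obtain k :: int where k: "\<phi> - \<psi> = of_int k * pi" using sin_zero_iff_int2 by blast
  have "(-2) * pi < of_int k * pi" "of_int k * pi < 2 * pi" using ang k by linarith+
  then have "-2 < real_of_int k" "real_of_int k < 2"
    using pi_gt_zero mult_less_cancel_right_pos[of pi] by metis+
  moreover have "k \<noteq> 0" using dir k by auto
  ultimately have "k = 1 \<or> k = -1" by linarith
  then have opp: "\<phi> = \<psi> + pi \<or> \<phi> = \<psi> - pi" using k by auto
  \<comment> \<open>The functionals of \<open>s\<close> and \<open>t\<close> are now negative
    multiples of each other and vanish at \<open>x\<close> and \<open>y\<close>. Their support
    inequalities at \<open>z\<close> therefore bound the same quantity from both sides, so
    \<open>g\<close> is parallel to \<open>s\<close>, which leaves no admissible angle for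
    \<open>t\<close>.\<close>
  have tx: "cross (?v [t]) x = 0"
    using zero[of x y] zero[of x y'] Q cross_commute[of x "?v [t]"] by (auto simp: y')
  have "cis (\<theta> + \<phi>) = - cis (\<theta> + \<psi>)"
    using opp by (auto simp: complex_eq_iff sin_add cos_add sin_diff cos_diff)
  then have t_s: "?v [t] = (- rt / rs) *\<^sub>R ?v [s]"
    using r by (simp add: v rcis_def scaleR_conv_of_real)
  have "cross (?v [s]) x = 0" using tx r by (simp add: t_s)
  then have "cross (?v [s]) z \<ge> 0" using sxz by simp
  moreover have "cross (?v [t]) y = 0" using sy[of y] by (simp add: t_s)
  then have "cross (?v [t]) z \<ge> 0" using tyz by simp
  then have "cross (?v [s]) z \<le> 0" using r by (auto simp: t_s mult_le_0_iff divide_le_0_iff)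
  ultimately have "cross (?v [s]) (?v [g]) = 0" using Pnz by (simp add: z_def)
  then have "sin \<psi> = 0" using gs r cross_commute[of "?v [g]" "?v [s]"] by simp
  then have "\<psi> = pi" using ang sin_gt_zero[of \<psi>] sin_lt_zero[of \<psi>] by force
  then show False using opp ang by auto
qed

section \<open>Optimal orders and the cyclic order of directions\<close>

definition inc :: "(nat \<Rightarrow> real) \<Rightarrow> nat \<Rightarrow> nat set" where
  "inc a n = {i. i < n \<and> \<not> a i < 0}"

definition cadj :: "nat \<Rightarrow> nat \<Rightarrow> nat \<Rightarrow> bool" where
  "cadj m p q \<longleftrightarrow> q = Suc p \<or> p = m \<and> q = 1"

text \<open>If \<open>S \<inter> I\<close> is an arc of the cyclic order of \<open>I\<close> given by \<open>pos\<close>, then it remains one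
  when \<open>i\<close> is added.\<close>

definition ok :: "nat set \<Rightarrow> (nat \<Rightarrow> nat) \<Rightarrow> nat set \<Rightarrow> nat \<Rightarrow> bool" where
  "ok I pos S i \<longleftrightarrow> i \<notin> I \<or> S \<inter> I = {} \<or>
     (\<exists>j\<in>S \<inter> I. cadj (card I) (pos i) (pos j) \<or> cadj (card I) (pos j) (pos i))"

definition good :: "nat set \<Rightarrow> (nat \<Rightarrow> nat) \<Rightarrow> nat list \<Rightarrow> bool" where
  "good I pos xs \<longleftrightarrow> (\<forall>U g W. xs = U @ g # W \<longrightarrow> ok I pos (set U) g)"

lemma finite_inc [simp]: "finite (inc a n)"
  by (simp add: inc_def)

text \<open>If \<open>ok\<close> fails at \<open>g\<close>, some nondecreasing \<open>s\<close>
  precedes \<open>g\<close> while both cyclic neighbours of \<open>g\<close> come later. Measured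
  from \<open>g\<close>, the neighbours have the smallest and the largest angle, so the one selected
  by the sign of \<open>\<epsilon> * slp a W\<close> is the \<open>t\<close> that
  \<open>no_crossing\<close> excludes.\<close>

lemma good_if_strict:
  assumes opt: "optl \<epsilon> a b n xs" and \<epsilon>: "\<epsilon> \<noteq> 0"
    and bij: "bij_betw pos (inc a n) {1..card (inc a n)}"
    and apos: "\<And>i. i \<in> inc a n \<Longrightarrow> a i > 0"
    and v: "\<And>i. i \<in> inc a n \<Longrightarrow> Complex (b i) (1 - a i) = rcis (r i) (\<theta> i)"
    and r: "\<And>i. i \<in> inc a n \<Longrightarrow> r i > 0"
    and \<theta>: "\<And>i j. i \<in> inc a n \<Longrightarrow> j \<in> inc a n \<Longrightarrow> pos i < pos j \<Longrightarrow> \<theta> i < \<theta> j \<and> \<theta> j < \<theta> i + 2 * pi"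
  shows "good (inc a n) pos xs"
  unfolding good_def
proof (intro allI impI, rule ccontr)
  fix U g W
  assume xs: "xs = U @ g # W" and nok: "\<not> ok (inc a n) pos (set U) g"
  let ?I = "inc a n" and ?m = "card (inc a n)"
  have g: "g \<in> ?I" using nok by (simp add: ok_def)
  from nok obtain s where s: "s \<in> set U" "s \<in> ?I" by (auto simp: ok_def)
  have d: "distinct xs" "set xs = {..<n}" using opt by (auto simp: optl_def ords_def)
  then have sg: "s \<noteq> g" using s xs by auto
  have nz: "a i \<noteq> 0" if "i < n" for i
    using apos[of i] that by (force simp: inc_def)
  have inj: "pos i = pos j \<Longrightarrow> i = j" if "i \<in> ?I" "j \<in> ?I" for i j
    using bij that by (auto simp: bij_betw_def inj_on_def)
  have rng: "1 \<le> pos i \<and> pos i \<le> ?m" if "i \<in> ?I" for i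
    using bij that by (auto simp: bij_betw_def)
  have surj: "\<exists>i\<in>?I. pos i = p" if "1 \<le> p" "p \<le> ?m" for p
    using bij that by (metis atLeastAtMost_iff bij_betw_iff_bijections)
  \<comment> \<open>The counterclockwise angle from \<open>g\<close>, normalized to lie strictly
    between 0 and a full turn.\<close>
  define ang where "ang i = \<theta> i - \<theta> g + (if pos i < pos g then 2 * pi else 0)" for i
  have ang: "0 < ang i \<and> ang i < 2 * pi" if "i \<in> ?I" "i \<noteq> g" for i
  proof -
    have "pos i \<noteq> pos g" using inj g that by blast
    then show ?thesis using \<theta>[OF that(1) g] \<theta>[OF g that(1)] by (cases "pos i < pos g") (auto simp: ang_def)
  qed
  have ang_less: "ang i < ang j" if "i \<in> ?I" "j \<in> ?I" "i \<noteq> g" "j \<noteq> g"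
    "pos j < pos g \<and> pos g < pos i \<or> (pos g < pos i \<longleftrightarrow> pos g < pos j) \<and> pos i < pos j" for i j
  proof -
    have "pos i \<noteq> pos g" "pos j \<noteq> pos g" using inj g that by blast+
    then show ?thesis using that(5) \<theta>[OF that(1,2)] \<theta>[OF that(2,1)]
      by (auto simp: ang_def not_less)
  qed
  have vec: "vec a b [i] = rcis (r i) (\<theta> g + ang i)" if "i \<in> ?I" for i
  proof -
    have "rcis (r i) (\<theta> g + ang i) = rcis (r i) (\<theta> i)"
      by (simp add: ang_def rcis_def cis_mult[symmetric])
    then show ?thesis using v[OF that] by (simp add: vec_single)
  qed
  have vg: "vec a b [g] = rcis (r g) (\<theta> g)" using v[OF g] by (simp add: vec_single)
  have in_W: "t \<in> set W" if "t \<in> ?I" "t \<noteq> g"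
    "cadj ?m (pos g) (pos t) \<or> cadj ?m (pos t) (pos g)" for t
  proof -
    have "t \<notin> set U" using nok that by (auto simp: ok_def)
    moreover have "t \<in> set xs" using that d by (auto simp: inc_def)
    ultimately show ?thesis using that xs by auto
  qed
  have no: False if t: "t \<in> ?I" "t \<noteq> g" "cadj ?m (pos g) (pos t) \<or> cadj ?m (pos t) (pos g)"
    and dir: "\<epsilon> * slp a W > 0 \<and> ang s < ang t \<or> \<epsilon> * slp a W < 0 \<and> ang t < ang s" for t
    by (rule no_crossing[OF _ s(1) in_W[OF t] apos[OF g] apos[OF s(2)] apos[OF t(1)] nz vg
          vec[OF s(2)] vec[OF t(1)]])
      (use opt xs r g s t ang[OF s(2) sg] ang[OF t(1,2)] dir in auto)
  have "pos s \<noteq> pos g" using inj s g sg by blast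
  have "set W \<subseteq> {..<n}" using d xs by auto
  then have "\<epsilon> * slp a W \<noteq> 0"
    using \<epsilon> nz by (auto simp: slp_def prod_list_zero_iff)
  then consider "\<epsilon> * slp a W > 0" | "\<epsilon> * slp a W < 0" by linarith
  then show False
  proof cases
    case 1
    \<comment> \<open>The cyclic predecessor of \<open>g\<close> comes last when turning
      counterclockwise from \<open>g\<close>, so its angle exceeds that of \<open>s\<close>. In the
      other case the successor comes first.\<close>
    define p where "p = (if pos g = 1 then ?m else pos g - 1)"
    have p: "1 \<le> p" "p \<le> ?m" using rng[OF g] by (auto simp: p_def)
    then obtain t where t: "t \<in> ?I" "pos t = p" using surj by blast
    have ps: "pos s \<noteq> pos t" if "s \<noteq> t" using inj s t that by blast
    have tg: "t \<noteq> g" using rng[OF g] rng[OF s(2)] t \<open>pos s \<noteq> pos g\<close> by (auto simp: p_def split: if_splits)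
    have c: "cadj ?m (pos t) (pos g)" using rng[OF g] t by (auto simp: p_def cadj_def)
    have "t \<in> set W" using in_W t tg c by blast
    then have "s \<noteq> t" using s xs d by auto
    then have "ang s < ang t"
      using ps t rng[OF g] rng[OF s(2)] \<open>pos s \<noteq> pos g\<close>
      by (intro ang_less s t sg tg) (auto simp: p_def split: if_splits)
    then show False using no t tg c 1 by blast
  next
    case 2
    define p where "p = (if pos g = ?m then 1 else Suc (pos g))"
    have p: "1 \<le> p" "p \<le> ?m" using rng[OF g] by (auto simp: p_def)
    then obtain t where t: "t \<in> ?I" "pos t = p" using surj by blast
    have ps: "pos s \<noteq> pos t" if "s \<noteq> t" using inj s t that by blast
    have tg: "t \<noteq> g" using rng[OF g] rng[OF s(2)] t \<open>pos s \<noteq> pos g\<close> by (auto simp: p_def split: if_splits)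
    have c: "cadj ?m (pos g) (pos t)" using rng[OF g] t by (auto simp: p_def cadj_def)
    have "t \<in> set W" using in_W t tg c by blast
    then have "s \<noteq> t" using s xs d by auto
    then have "ang t < ang s"
      using ps t rng[OF g] rng[OF s(2)] \<open>pos s \<noteq> pos g\<close>
      by (intro ang_less s t sg tg) (auto simp: p_def split: if_splits)
    then show False using no t tg c 2 by blast
  qed
qed

section \<open>Perturbation and limits\<close>

lemma tendsto_cst:
  assumes "\<And>i. i \<in> set xs \<Longrightarrow> ((\<lambda>e. A e i) \<longlongrightarrow> a i) F" "\<And>i. i \<in> set xs \<Longrightarrow> ((\<lambda>e. B e i) \<longlongrightarrow> b i) F"
  shows "((\<lambda>e. cst (A e) (B e) xs) \<longlongrightarrow> cst a b xs) F"
  using assms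
proof (induction xs rule: rev_induct)
  case Nil
  show ?case by simp
next
  case (snoc i xs)
  then have "((\<lambda>e. cst (A e) (B e) xs) \<longlongrightarrow> cst a b xs) F" by simp
  then show ?case using snoc.prems by (auto intro!: tendsto_intros)
qed

lemma order_tendsto_strict:
  fixes f g :: "'a \<Rightarrow> real"
  assumes "(f \<longlongrightarrow> x) F" "(g \<longlongrightarrow> y) F" "x < y"
  shows "eventually (\<lambda>e. f e < g e) F"
proof -
  have "eventually (\<lambda>e. 0 < g e - f e) F"
    using assms by (intro order_tendstoD(1)[OF tendsto_diff]) auto
  then show ?thesis by eventually_elim simp
qed

text \<open>An order that is not optimal in the limit is beaten strictly by another one, and by
  continuity it is still beaten near the limit. As there are finitely many orders, failure of all
  orders satisfying \<open>G\<close> in the limit would mean failure of all of them at once near it.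
  \<open>G\<close> must not depend on the perturbation.\<close>

lemma optl_limit:
  assumes F: "F \<noteq> bot"
    and lim: "\<And>i. i < n \<Longrightarrow> ((\<lambda>e. A e i) \<longlongrightarrow> a i) F" "\<And>i. i < n \<Longrightarrow> ((\<lambda>e. B e i) \<longlongrightarrow> b i) F"
    and ev: "eventually (\<lambda>e. \<exists>xs. G xs \<and> optl \<epsilon> (A e) (B e) n xs) F"
  shows "\<exists>xs. G xs \<and> optl \<epsilon> a b n xs"
proof (rule ccontr)
  assume no: "\<not> ?thesis"
  have "eventually (\<lambda>e. \<not> optl \<epsilon> (A e) (B e) n xs) F" if xs: "xs \<in> ords n" "G xs" for xs
  proof -
    obtain ys where ys: "ys \<in> ords n" "\<epsilon> * cst a b ys < \<epsilon> * cst a b xs"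
      using no xs by (auto simp: optl_def not_le)
    have "((\<lambda>e. \<epsilon> * cst (A e) (B e) zs) \<longlongrightarrow> \<epsilon> * cst a b zs) F" if "zs \<in> ords n" for zs
      using that lim by (intro tendsto_intros tendsto_cst) (auto simp: ords_def)
    then have "eventually (\<lambda>e. \<epsilon> * cst (A e) (B e) ys < \<epsilon> * cst (A e) (B e) xs) F"
      using ys xs by (intro order_tendsto_strict) auto
    then show ?thesis
      by (rule eventually_mono) (use ys in \<open>auto simp: optl_def not_le\<close>)
  qed
  then have "eventually (\<lambda>e. \<forall>xs\<in>ords n \<inter> {xs. G xs}. \<not> optl \<epsilon> (A e) (B e) n xs) F"
    by (intro eventually_ball_finite) (auto simp: finite_ords)
  with ev have "eventually (\<lambda>e. False) F"
    by eventually_elim (auto simp: optl_def)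
  then show False using F by (simp add: eventually_False)
qed

text \<open>Turning the vector of \<open>i\<close> by the angle \<open>e * real (pos i)\<close>
  separates equal directions in the order prescribed by \<open>pos\<close>; for small positive
  \<open>e\<close> the slopes remain positive and the total spread remains below a full
  turn.\<close>

lemma ex_good_optl_pos:
  assumes \<epsilon>: "\<epsilon> \<noteq> 0"
    and bij: "bij_betw pos (inc a n) {1..card (inc a n)}"
    and apos: "\<And>i. i \<in> inc a n \<Longrightarrow> a i > 0"
    and v: "\<And>i. i \<in> inc a n \<Longrightarrow> Complex (b i) (1 - a i) = rcis (r i) (\<theta> i)"
    and r: "\<And>i. i \<in> inc a n \<Longrightarrow> r i > 0"
    and \<theta>: "\<And>i j. i \<in> inc a n \<Longrightarrow> j \<in> inc a n \<Longrightarrow> pos i < pos j \<Longrightarrow> \<theta> i \<le> \<theta> j \<and> \<theta> j < \<theta> i + 2 * pi"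
  shows "\<exists>xs. good (inc a n) pos xs \<and> optl \<epsilon> a b n xs"
proof -
  let ?I = "inc a n"
  define v' where "v' e i = rcis (r i) (\<theta> i + e * real (pos i))" for e i
  define A where "A e i = (if i \<in> ?I then 1 - Im (v' e i) else a i)" for e i
  define B where "B e i = (if i \<in> ?I then Re (v' e i) else b i)" for e i
  have v0: "Re (v' 0 i) = b i \<and> Im (v' 0 i) = 1 - a i" if "i \<in> ?I" for i
    using v[OF that] by (simp add: v'_def complex_eq_iff)
  have limA: "((\<lambda>e. A e i) \<longlongrightarrow> a i) (at_right 0)" for i
  proof -
    have "((\<lambda>e. 1 - r i * sin (\<theta> i + e * real (pos i))) \<longlongrightarrow> 1 - r i * sin (\<theta> i + 0 * real (pos i))) (at_right 0)"
      by (intro tendsto_intros)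
    then show ?thesis using v0[of i] by (cases "i \<in> ?I") (simp_all add: A_def v'_def)
  qed
  have limB: "((\<lambda>e. B e i) \<longlongrightarrow> b i) (at_right 0)" for i
  proof -
    have "((\<lambda>e. r i * cos (\<theta> i + e * real (pos i))) \<longlongrightarrow> r i * cos (\<theta> i + 0 * real (pos i))) (at_right 0)"
      by (intro tendsto_intros)
    then show ?thesis using v0[of i] by (cases "i \<in> ?I") (simp_all add: B_def v'_def)
  qed
  have 1: "eventually (\<lambda>e. \<forall>i\<in>?I. A e i > 0) (at_right 0)"
    using limA apos by (intro eventually_ball_finite ballI order_tendstoD(1)) auto
  have 2: "eventually (\<lambda>e. \<forall>i\<in>?I. \<forall>j\<in>?I. pos i < pos j \<longrightarrow>
      \<theta> j + e * real (pos j) < \<theta> i + e * real (pos i) + 2 * pi) (at_right 0)"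
  proof (intro eventually_ball_finite ballI)
    fix i j assume ij: "i \<in> ?I" "j \<in> ?I"
    show "eventually (\<lambda>e. pos i < pos j \<longrightarrow> \<theta> j + e * real (pos j) < \<theta> i + e * real (pos i) + 2 * pi) (at_right 0)"
    proof (cases "pos i < pos j")
      case True
      have "((\<lambda>e. \<theta> i + e * real (pos i) + 2 * pi - (\<theta> j + e * real (pos j))) \<longlongrightarrow>
         \<theta> i + 0 * real (pos i) + 2 * pi - (\<theta> j + 0 * real (pos j))) (at_right 0)"
        by (intro tendsto_intros)
      then have "eventually (\<lambda>e. 0 < \<theta> i + e * real (pos i) + 2 * pi - (\<theta> j + e * real (pos j))) (at_right 0)"
        using \<theta>[OF ij True] by (intro order_tendstoD(1)) auto
      then show ?thesis by eventually_elim simp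
    qed simp
  qed simp_all
  have 3: "eventually (\<lambda>e::real. e > 0) (at_right 0)"
    by (simp add: eventually_at_right_less)
  show ?thesis
  proof (rule optl_limit[where F = "at_right (0::real)" and A = A and B = B])
    from 1 2 3 show "eventually (\<lambda>e. \<exists>xs. good ?I pos xs \<and> optl \<epsilon> (A e) (B e) n xs) (at_right 0)"
    proof eventually_elim
      case (elim e)
      have I: "inc (A e) n = ?I"
        using elim(1) by (auto simp: inc_def A_def)
      obtain xs where xs: "optl \<epsilon> (A e) (B e) n xs" using optl_exists by blast
      have "good (inc (A e) n) pos xs"
      proof (rule good_if_strict[OF xs \<epsilon>, where r = r and \<theta> = "\<lambda>i. \<theta> i + e * real (pos i)"], unfold I)
        show "bij_betw pos ?I {1..card ?I}" by fact
      next
        fix i assume "i \<in> ?I"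
        then show "A e i > 0" "r i > 0" using elim(1) r by auto
        show "Complex (B e i) (1 - A e i) = rcis (r i) (\<theta> i + e * real (pos i))"
          using \<open>i \<in> ?I\<close> by (simp add: A_def B_def v'_def complex_eq_iff)
      next
        fix i j assume ij: "i \<in> ?I" "j \<in> ?I" "pos i < pos j"
        then show "\<theta> i + e * real (pos i) < \<theta> j + e * real (pos j) \<and>
            \<theta> j + e * real (pos j) < \<theta> i + e * real (pos i) + 2 * pi"
          using elim(2,3) \<theta>[OF ij] by (auto intro!: add_le_less_mono)
      qed
      then show ?case using xs I by auto
    qed
  qed (use limA limB in auto)
qed

text \<open>Each nondecreasing vector is mixed with the vector of length 1/2 in its assigned
  direction. This makes all lengths positive, also for the identity, and keeps the
  directions.\<close>

lemma ex_good_optl: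
  assumes \<epsilon>: "\<epsilon> \<noteq> 0"
    and bij: "bij_betw pos (inc a n) {1..card (inc a n)}"
    and v: "\<And>i. i \<in> inc a n \<Longrightarrow> Complex (b i) (1 - a i) = rcis (r i) (\<theta> i)"
    and r: "\<And>i. i \<in> inc a n \<Longrightarrow> r i \<ge> 0"
    and \<theta>: "\<And>i j. i \<in> inc a n \<Longrightarrow> j \<in> inc a n \<Longrightarrow> pos i < pos j \<Longrightarrow> \<theta> i \<le> \<theta> j \<and> \<theta> j < \<theta> i + 2 * pi"
  shows "\<exists>xs. good (inc a n) pos xs \<and> optl \<epsilon> a b n xs"
proof -
  let ?I = "inc a n"
  define r' where "r' e i = (1 - e) * r i + e / 2" for e i
  define A where "A e i = (if i \<in> ?I then 1 - r' e i * sin (\<theta> i) else a i)" for e i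
  define B where "B e i = (if i \<in> ?I then r' e i * cos (\<theta> i) else b i)" for e i
  have v0: "b i = r i * cos (\<theta> i) \<and> 1 - a i = r i * sin (\<theta> i)" if "i \<in> ?I" for i
    using v[OF that] by (simp add: complex_eq_iff)
  have limr: "((\<lambda>e. r' e i) \<longlongrightarrow> r i) (at_right 0)" for i
  proof -
    have "((\<lambda>e. (1 - e) * r i + e / 2) \<longlongrightarrow> (1 - 0) * r i + 0 / 2) (at_right 0)"
      by (intro tendsto_intros) auto
    then show ?thesis by (simp add: r'_def)
  qed
  have limA: "((\<lambda>e. A e i) \<longlongrightarrow> a i) (at_right 0)" for i
  proof (cases "i \<in> ?I")
    case True
    have "((\<lambda>e. 1 - r' e i * sin (\<theta> i)) \<longlongrightarrow> 1 - r i * sin (\<theta> i)) (at_right 0)"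
      by (intro tendsto_intros limr)
    moreover have "1 - r i * sin (\<theta> i) = a i" using v0[OF True] by simp
    ultimately show ?thesis using True by (simp add: A_def)
  qed (simp add: A_def)
  have limB: "((\<lambda>e. B e i) \<longlongrightarrow> b i) (at_right 0)" for i
  proof (cases "i \<in> ?I")
    case True
    have "((\<lambda>e. r' e i * cos (\<theta> i)) \<longlongrightarrow> r i * cos (\<theta> i)) (at_right 0)"
      by (intro tendsto_intros limr)
    then show ?thesis using True v0[OF True] by (simp add: B_def)
  qed (simp add: B_def)
  show ?thesis
  proof (rule optl_limit[where F = "at_right (0::real)" and A = A and B = B])
    have "eventually (\<lambda>e::real. e \<in> {0<..<1}) (at_right 0)"
      by (rule eventually_at_right_real) simp
    then show "eventually (\<lambda>e. \<exists>xs. good ?I pos xs \<and> optl \<epsilon> (A e) (B e) n xs) (at_right 0)"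
    proof eventually_elim
      case (elim e)
      have Ap: "A e i > 0" if i: "i \<in> ?I" for i
      proof -
        \<comment> \<open>A vector of length below 1 belongs to a positive slope, here
          \<open>1 - sin (\<theta> i) / 2\<close>; this is the reason for the length 1/2. Mixing it
          in also makes a slope 0 positive.\<close>
        have "A e i = (1 - e) * a i + e * (1 - sin (\<theta> i) / 2)"
        proof -
          have "A e i = 1 - (1 - e) * (r i * sin (\<theta> i)) - e * sin (\<theta> i) / 2"
            using i by (simp add: A_def r'_def algebra_simps)
          also have "r i * sin (\<theta> i) = 1 - a i" using v0[OF i] by simp
          finally show ?thesis by (simp add: algebra_simps)
        qed
        moreover have "(1 - e) * a i \<ge> 0" using i elim by (auto simp: inc_def)
        moreover have "1 - sin (\<theta> i) / 2 > 0" using sin_le_one[of "\<theta> i"] by linarith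
        then have "e * (1 - sin (\<theta> i) / 2) > 0" using elim by simp
        ultimately show ?thesis by linarith
      qed
      have I: "inc (A e) n = ?I"
        using Ap by (auto simp: inc_def A_def) force
      have "\<exists>xs. good (inc (A e) n) pos xs \<and> optl \<epsilon> (A e) (B e) n xs"
      proof (rule ex_good_optl_pos[OF \<epsilon>, where r = "r' e" and \<theta> = \<theta>], unfold I)
        show "bij_betw pos ?I {1..card ?I}" by fact
      next
        fix i assume i: "i \<in> ?I"
        then show "A e i > 0" using Ap by auto
        show "r' e i > 0" using elim r[OF i] by (auto simp: r'_def intro!: add_nonneg_pos)
        show "Complex (B e i) (1 - A e i) = rcis (r' e i) (\<theta> i)"
          using i by (simp add: A_def B_def complex_eq_iff)
      qed (use \<theta> in auto)
      then show ?case using I by auto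
    qed
  qed (use limA limB in auto)
qed

section \<open>Keys, positions and reachable sets\<close>

text \<open>An increasing map into the interval from -1 to 1, standing in for \<open>arctan\<close>:
  it takes only field operations and a comparison.\<close>

definition squash :: "real \<Rightarrow> real" where
  "squash x = x / (1 + \<bar>x\<bar>)"

lemma squash_bounds: "-1 < squash x" "squash x < 1"
proof -
  have "1 + \<bar>x\<bar> > 0" by linarith
  then show "-1 < squash x" "squash x < 1"
    by (simp_all add: squash_def field_simps)
qed

lemma squash_le: "squash x \<le> squash y \<Longrightarrow> x \<le> y"
proof (rule ccontr)
  assume le: "squash x \<le> squash y" and "\<not> x \<le> y"
  then have xy: "y < x" by simp
  have p: "1 + \<bar>x\<bar> > 0" "1 + \<bar>y\<bar> > 0" by linarith+
  have "y * \<bar>x\<bar> \<le> x * \<bar>y\<bar>"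
    using xy mult_nonneg_nonpos[of x y] by (cases "x \<ge> 0"; cases "y \<ge> 0") (auto simp: mult.commute)
  then have "y * (1 + \<bar>x\<bar>) < x * (1 + \<bar>y\<bar>)" using xy by (simp add: algebra_simps)
  then have "squash y < squash x" using p by (simp add: squash_def field_simps)
  then show False using le by simp
qed

text \<open>A number that increases with the argument (in \<open>[0, 2\<pi>)\<close>) of the vector
  \<open>(\<beta>, 1 - \<alpha>)\<close> and is computed without trigonometric functions. For \<open>\<alpha> = 1\<close> the quotient
  is \<open>0\<close>, and the zero vector gets the key \<open>0\<close>.\<close>

definition key :: "real \<Rightarrow> real \<Rightarrow> real" where
  "key \<alpha> \<beta> = (if \<alpha> < 1 then 1 + squash (- \<beta> / (1 - \<alpha>))
    else if 1 < \<alpha> then 3 + squash (- \<beta> / (1 - \<alpha>)) else if \<beta> < 0 then 2 else 0)"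

definition angle :: "real \<Rightarrow> real \<Rightarrow> real" where
  "angle \<alpha> \<beta> = (if \<alpha> < 1 then pi / 2 + arctan (- \<beta> / (1 - \<alpha>))
    else if 1 < \<alpha> then 3 * pi / 2 + arctan (- \<beta> / (1 - \<alpha>)) else if \<beta> < 0 then pi else 0)"

lemma angle_bounds: "0 \<le> angle \<alpha> \<beta>" "angle \<alpha> \<beta> < 2 * pi"
  using arctan_bounded[of "- \<beta> / (1 - \<alpha>)"] pi_gt_zero by (auto simp: angle_def simp del: pi_gt_zero)

lemma key_le_imp_angle_le: "key \<alpha> \<beta> \<le> key \<alpha>' \<beta>' \<Longrightarrow> angle \<alpha> \<beta> \<le> angle \<alpha>' \<beta>'"
  using squash_bounds[of "- \<beta> / (1 - \<alpha>)"] squash_bounds[of "- \<beta>' / (1 - \<alpha>')"]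
    arctan_bounded[of "- \<beta> / (1 - \<alpha>)"] arctan_bounded[of "- \<beta>' / (1 - \<alpha>')"] pi_gt_zero
    squash_le[of "- \<beta> / (1 - \<alpha>)" "- \<beta>' / (1 - \<alpha>')"]
  by (auto simp: key_def angle_def arctan_le_iff simp del: pi_gt_zero split: if_splits)

lemma ex_polar: "\<exists>r\<ge>0. Complex \<beta> (1 - \<alpha>) = rcis r (angle \<alpha> \<beta>)"
proof -
  define \<kappa> where "\<kappa> = - \<beta> / (1 - \<alpha>)"
  have s: "sqrt (1 + \<kappa>\<^sup>2) > 0" by (simp add: add_pos_nonneg)
  consider "\<alpha> < 1" | "1 < \<alpha>" | "\<alpha> = 1" by linarith
  then show ?thesis
  proof cases
    case 1
    then have "angle \<alpha> \<beta> = arctan \<kappa> + pi / 2" by (simp add: angle_def \<kappa>_def)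
    moreover have "cos (arctan \<kappa> + pi / 2) = - sin (arctan \<kappa>)" "sin (arctan \<kappa> + pi / 2) = cos (arctan \<kappa>)"
      by (simp_all add: cos_add sin_add)
    moreover have "\<beta> = (1 - \<alpha>) * - \<kappa>" using 1 by (simp add: \<kappa>_def)
    ultimately have "Complex \<beta> (1 - \<alpha>) = rcis ((1 - \<alpha>) * sqrt (1 + \<kappa>\<^sup>2)) (angle \<alpha> \<beta>)"
      using s by (simp add: complex_eq_iff cos_arctan sin_arctan)
    then show ?thesis using 1 s by (intro exI[of _ "(1 - \<alpha>) * sqrt (1 + \<kappa>\<^sup>2)"]) auto
  next
    case 2
    then have a: "angle \<alpha> \<beta> = (arctan \<kappa> + pi / 2) + pi" by (simp add: angle_def \<kappa>_def)
    have "cos (angle \<alpha> \<beta>) = sin (arctan \<kappa>)" "sin (angle \<alpha> \<beta>) = - cos (arctan \<kappa>)"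
      unfolding a cos_periodic_pi sin_periodic_pi by (simp_all add: cos_add sin_add)
    moreover have "\<beta> = (\<alpha> - 1) * \<kappa>" using 2 by (simp add: \<kappa>_def field_simps)
    ultimately have "Complex \<beta> (1 - \<alpha>) = rcis ((\<alpha> - 1) * sqrt (1 + \<kappa>\<^sup>2)) (angle \<alpha> \<beta>)"
      using s by (simp add: complex_eq_iff cos_arctan sin_arctan)
    then show ?thesis using 2 s by (intro exI[of _ "(\<alpha> - 1) * sqrt (1 + \<kappa>\<^sup>2)"]) auto
  next
    case 3
    then show ?thesis
      by (intro exI[of _ "\<bar>\<beta>\<bar>"]) (auto simp: angle_def complex_eq_iff)
  qed
qed

definition before :: "(nat \<Rightarrow> real) \<Rightarrow> (nat \<Rightarrow> real) \<Rightarrow> nat \<Rightarrow> nat \<Rightarrow> bool" where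
  "before a b i j \<longleftrightarrow> key (a i) (b i) < key (a j) (b j) \<or> key (a i) (b i) = key (a j) (b j) \<and> i < j"

text \<open>Ranks start at 1, which leaves the indices 0 and \<open>card (inc a n) + 1\<close> free
  for wrapping around in the inverse table.\<close>

definition posn :: "(nat \<Rightarrow> real) \<Rightarrow> (nat \<Rightarrow> real) \<Rightarrow> nat \<Rightarrow> nat \<Rightarrow> nat" where
  "posn a b n i = Suc (card {j \<in> inc a n. before a b j i})"

lemma posn_less: "before a b i j \<Longrightarrow> i \<in> inc a n \<Longrightarrow> posn a b n i < posn a b n j"
  unfolding posn_def by (intro Suc_mono psubset_card_mono) (auto simp: before_def)

lemma before_total: "i \<noteq> j \<Longrightarrow> before a b i j \<or> before a b j i"
  by (auto simp: before_def)

lemma posn_le: "i \<in> inc a n \<Longrightarrow> posn a b n i \<le> card (inc a n)"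
  unfolding posn_def by (intro Suc_leI psubset_card_mono) (auto simp: before_def)

lemma bij_posn: "bij_betw (posn a b n) (inc a n) {1..card (inc a n)}"
proof -
  have inj: "inj_on (posn a b n) (inc a n)"
    by (rule inj_onI, rule ccontr) (metis before_total less_irrefl posn_less)
  have "posn a b n ` inc a n \<subseteq> {1..card (inc a n)}"
    using posn_le[of _ a n b] by (auto simp: posn_def)
  then have "posn a b n ` inc a n = {1..card (inc a n)}"
    by (intro card_subset_eq) (simp_all add: card_image[OF inj])
  then show ?thesis using inj by (simp add: bij_betw_def)
qed

theorem ex_good_optl_posn:
  assumes "\<epsilon> \<noteq> 0"
  shows "\<exists>xs. good (inc a n) (posn a b n) xs \<and> optl \<epsilon> a b n xs"
proof -
  define r where "r i = (SOME r. r \<ge> 0 \<and> Complex (b i) (1 - a i) = rcis r (angle (a i) (b i)))" for i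
  have r: "r i \<ge> 0 \<and> Complex (b i) (1 - a i) = rcis (r i) (angle (a i) (b i))" for i
    unfolding r_def by (rule someI_ex) (use ex_polar in blast)
  show ?thesis
  proof (rule ex_good_optl[OF assms bij_posn, where r = r and \<theta> = "\<lambda>i. angle (a i) (b i)"])
    fix i j assume ij: "i \<in> inc a n" "j \<in> inc a n" "posn a b n i < posn a b n j"
    then have "\<not> before a b j i" "i \<noteq> j" using posn_less[of a b j i n] by auto
    then have "before a b i j" using before_total by blast
    then have "key (a i) (b i) \<le> key (a j) (b j)" by (auto simp: before_def)
    then show "angle (a i) (b i) \<le> angle (a j) (b j) \<and> angle (a j) (b j) < angle (a i) (b i) + 2 * pi"
      using key_le_imp_angle_le angle_bounds[of "a i" "b i"] angle_bounds[of "a j" "b j"] by force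
  qed (use r in auto)
qed

section \<open>Reachable sets and their number\<close>

inductive reach :: "nat set \<Rightarrow> (nat \<Rightarrow> nat) \<Rightarrow> nat \<Rightarrow> nat set \<Rightarrow> bool" for I pos n where
  empty: "reach I pos n {}"
| step: "reach I pos n S \<Longrightarrow> i < n \<Longrightarrow> i \<notin> S \<Longrightarrow> ok I pos S i \<Longrightarrow> reach I pos n (insert i S)"

lemma reach_subset: "reach I pos n S \<Longrightarrow> S \<subseteq> {..<n}"
  by (induction rule: reach.induct) auto

text \<open>An arc is written as a segment of the orbit of the cyclic successor \<open>nx\<close>. A
  new element adjacent to the arc can only be attached at one of its two ends.\<close>

lemma reach_arc:
  assumes I: "finite I" and inj: "inj_on pos I" and rng: "pos ` I \<subseteq> {1..card I}"
    and nx: "\<And>i. i \<in> I \<Longrightarrow> nx i \<in> I \<and> cadj (card I) (pos i) (pos (nx i))"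
    and S: "reach I pos n S"
  shows "S \<inter> I = {} \<or> (\<exists>s\<in>I. S \<inter> I = (\<lambda>j. (nx ^^ j) s) ` {..<card (S \<inter> I)})"
  using S
proof induction
  case (step S i)
  have fin: "finite (S \<inter> I)" using I by simp
  have nx_I: "(nx ^^ j) s \<in> I" if "s \<in> I" for j s
    using that nx by (induction j) auto
  have nx_inj: "i = j" if "i \<in> I" "j \<in> I" "nx i = nx j" for i j
  proof -
    have "pos i = pos j" using nx[OF that(1)] nx[OF that(2)] that rng
      by (force simp: cadj_def)
    then show ?thesis using inj that by (auto simp: inj_on_def)
  qed
  have uniq: "j = nx i" if "i \<in> I" "j \<in> I" "cadj (card I) (pos i) (pos j)" for i j
  proof -
    have "pos j = pos (nx i)" using nx[OF that(1)] that rng by (force simp: cadj_def)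
    then show ?thesis using inj that nx by (auto simp: inj_on_def)
  qed
  consider "i \<notin> I" | "i \<in> I" "S \<inter> I = {}" | "i \<in> I" "S \<inter> I \<noteq> {}" by blast
  then show ?case
  proof cases
    case 1
    then show ?thesis using step.IH by simp
  next
    case 2
    then have "insert i S \<inter> I = {i}" by auto
    then show ?thesis using 2 by auto
  next
    case 3
    define l where "l = card (S \<inter> I)"
    obtain s where s: "s \<in> I" "S \<inter> I = (\<lambda>j. (nx ^^ j) s) ` {..<l}"
      using step.IH 3 by (auto simp: l_def)
    have ins: "insert i S \<inter> I = insert i (S \<inter> I)" using 3 by auto
    then have cl: "card (insert i S \<inter> I) = Suc l" using step.hyps fin by (simp add: l_def)
    have l: "l > 0" using 3 fin by (auto simp: l_def card_gt_0_iff)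
    obtain j where j: "j \<in> S \<inter> I" "cadj (card I) (pos i) (pos j) \<or> cadj (card I) (pos j) (pos i)"
      using step.hyps 3 by (auto simp: ok_def)
    then obtain q where q: "q < l" "j = (nx ^^ q) s" using s by auto
    from j(2) show ?thesis
    proof
      assume "cadj (card I) (pos i) (pos j)"
      then have ji: "j = nx i" using uniq 3 j by auto
      \<comment> \<open>If \<open>j\<close> were not the first element of the arc, the element
        before it would be \<open>i\<close>, which is not yet in \<open>S\<close>.\<close>
      have "q = 0"
      proof (cases q)
        case (Suc q')
        then have "nx ((nx ^^ q') s) = nx i" using q ji by simp
        then have "(nx ^^ q') s = i" using nx_inj nx_I s 3 by blast
        moreover have "(nx ^^ q') s \<in> S \<inter> I" using s Suc q by auto
        ultimately show ?thesis using step.hyps by auto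
      qed
      then have "s = nx i" using q ji by simp
      then have "(nx ^^ j) s = (nx ^^ Suc j) i" for j by (simp only: funpow_Suc_right o_apply)
      then have "insert i (S \<inter> I) = (\<lambda>j. (nx ^^ j) i) ` {..<Suc l}"
        by (simp only: lessThan_Suc_eq_insert_0 image_insert image_image s) simp
      then show ?thesis using 3 cl ins by auto
    next
      assume "cadj (card I) (pos j) (pos i)"
      then have "i = nx j" using uniq 3 j by auto
      then have i: "i = (nx ^^ Suc q) s" using q by simp
      have "Suc q = l"
      proof (rule ccontr)
        assume "Suc q \<noteq> l"
        then have "i \<in> S \<inter> I" unfolding i s using q by (intro imageI) auto
        then show False using step.hyps by auto
      qed
      then have "insert i (S \<inter> I) = (\<lambda>j. (nx ^^ j) s) ` {..<Suc l}"
        by (simp only: lessThan_Suc image_insert s i)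
      then show ?thesis using s cl ins by auto
    qed
  qed
qed simp

text \<open>A reachable set is determined by its decreasing functions, for which there are
  \<open>2 ^ k\<close> choices, and by its arc, which is empty or given by one of at most
  \<open>n\<close> starting points and one of the \<open>n + 1\<close> lengths from 0 to
  \<open>n\<close>.\<close>

lemma card_reach:
  assumes In: "I \<subseteq> {..<n}" and bij: "bij_betw pos I {1..card I}" and k: "card ({..<n} - I) = k"
  shows "finite {S. reach I pos n S}" "card {S. reach I pos n S} \<le> 2 ^ k * (n * (n + 1) + 1)"
proof -
  have I: "finite I" using In finite_subset by blast
  have "\<exists>j\<in>I. cadj (card I) (pos i) (pos j)" if "i \<in> I" for i
  proof -
    have "pos i \<in> {1..card I}" using bij that by (auto simp: bij_betw_def)
    then have "(if pos i = card I then 1 else Suc (pos i)) \<in> {1..card I}" by auto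
    then have "(if pos i = card I then 1 else Suc (pos i)) \<in> pos ` I" using bij by (simp add: bij_betw_def)
    then show ?thesis by (auto simp: cadj_def split: if_splits)
  qed
  then obtain nx where nx: "\<And>i. i \<in> I \<Longrightarrow> nx i \<in> I \<and> cadj (card I) (pos i) (pos (nx i))" by metis
  define arcs where "arcs = insert {} ((\<lambda>(s, l). (\<lambda>j. (nx ^^ j) s) ` {..<l}) ` (I \<times> {..n}))"
  have fin_arcs: "finite arcs" using I by (simp add: arcs_def)
  have "card arcs \<le> Suc (card ((\<lambda>(s, l). (\<lambda>j. (nx ^^ j) s) ` {..<l}) ` (I \<times> {..n})))"
    unfolding arcs_def by (rule card_insert_le_m1[of "Suc _", simplified]) simp_all
  also have "\<dots> \<le> Suc (card (I \<times> {..n}))"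
    using I by (intro Suc_le_mono[THEN iffD2] card_image_le) simp
  also have "\<dots> \<le> n * (n + 1) + 1"
    using card_mono[OF _ In] by (simp add: card_cartesian_product add_mono)
  finally have ca: "card arcs \<le> n * (n + 1) + 1" .
  let ?f = "\<lambda>S. (S - I, S \<inter> I)"
  have inj: "inj_on ?f X" for X by (rule inj_onI) (auto)
  have sub: "?f ` {S. reach I pos n S} \<subseteq> Pow ({..<n} - I) \<times> arcs"
  proof
    fix z assume "z \<in> ?f ` {S. reach I pos n S}"
    then obtain S where S: "reach I pos n S" "z = (S - I, S \<inter> I)" by auto
    have "card (S \<inter> I) \<le> n" using card_mono[of "{..<n}" "S \<inter> I"] In by auto
    moreover have "S \<inter> I = {} \<or> (\<exists>s\<in>I. S \<inter> I = (\<lambda>j. (nx ^^ j) s) ` {..<card (S \<inter> I)})"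
      using reach_arc[OF I _ _ nx S(1)] bij by (simp add: bij_betw_def)
    ultimately have "S \<inter> I \<in> arcs"
      unfolding arcs_def by (elim disjE bexE) (simp, intro insertI2 rev_image_eqI, auto)
    then show "z \<in> Pow ({..<n} - I) \<times> arcs" using reach_subset[OF S(1)] S by auto
  qed
  have finP: "finite (Pow ({..<n} - I) \<times> arcs)" using fin_arcs by simp
  show fin: "finite {S. reach I pos n S}"
    using finite_subset[OF sub finP] inj finite_imageD by blast
  have "card {S. reach I pos n S} = card (?f ` {S. reach I pos n S})"
    by (rule card_image[OF inj, symmetric])
  also have "\<dots> \<le> card (Pow ({..<n} - I) \<times> arcs)" by (rule card_mono[OF finP sub])
  also have "\<dots> = 2 ^ k * card arcs" using k by (simp add: card_cartesian_product card_Pow)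
  also have "\<dots> \<le> 2 ^ k * (n * (n + 1) + 1)" by (rule mult_le_mono2[OF ca])
  finally show "card {S. reach I pos n S} \<le> 2 ^ k * (n * (n + 1) + 1)" .
qed

section \<open>Dynamic programming\<close>

text \<open>Mode \<open>e = 0\<close> stands for minimization and \<open>e = 1\<close> for maximization, which is the minimization
  of the negated value; a decreasing function exchanges the two modes.\<close>

definition sg :: "nat \<Rightarrow> real" where
  "sg e = (if e = 0 then 1 else -1)"

definition flip :: "(nat \<Rightarrow> real) \<Rightarrow> nat \<Rightarrow> nat \<Rightarrow> nat" where
  "flip a i e = (if a i < 0 then 1 - e else e)"

text \<open>With values stored under the sign of their mode, both modes minimize. The absolute slope
  together with \<open>flip\<close> makes the recurrence monotone in \<open>f\<close>, which dynamic
  programming requires.\<close>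

definition cand :: "(nat \<Rightarrow> real) \<Rightarrow> (nat \<Rightarrow> real) \<Rightarrow> (nat \<Rightarrow> real) \<Rightarrow> nat \<Rightarrow> nat \<Rightarrow> real" where
  "cand a b f i e = \<bar>a i\<bar> * f (flip a i e) + sg e * b i"

lemma flip_less: "e < 2 \<Longrightarrow> flip a i e < 2"
  by (auto simp: flip_def)

lemma cand_mono: "(\<And>e. e < 2 \<Longrightarrow> f e \<le> g e) \<Longrightarrow> e < 2 \<Longrightarrow> cand a b f i e \<le> cand a b g i e"
  by (simp add: cand_def mult_left_mono flip_less)

lemma cand_cong: "(\<And>e. e < 2 \<Longrightarrow> f e = g e) \<Longrightarrow> e < 2 \<Longrightarrow> cand a b f i e = cand a b g i e"
  by (simp add: cand_def flip_less)

lemma cst_snoc: "e < 2 \<Longrightarrow> sg e * cst a b (xs @ [i]) = cand a b (\<lambda>e. sg e * cst a b xs) i e"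
  by (cases "e = 0") (auto simp: cand_def sg_def flip_def algebra_simps)

lemma set_decode_add: "i \<notin> set_decode x \<Longrightarrow> set_decode (x + 2 ^ i) = insert i (set_decode x)"
  using set_encode_insert[of "set_decode x" i] set_encode_inverse[of "insert i (set_decode x)"]
  by (simp add: add.commute)

lemma set_decode_eq_iff: "set_decode x = set_decode y \<longleftrightarrow> x = y"
  by (metis set_decode_inverse)

text \<open>Breadth-first search through the sets built from the empty set by admissible steps. A set is
  represented by its code \<open>x\<close>; \<open>q\<close> is the queue with \<open>t\<close> entries, the first \<open>h\<close> of which have been
  processed, and the element at \<open>h\<close> has been combined with all \<open>i < i0\<close>. The best signed value found
  for a set is \<open>val e x\<close>, and \<open>ch e x\<close> is the last function
  of a list attaining it.\<close>

locale bfs =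
  fixes a b :: "nat \<Rightarrow> real" and n h i0 t :: nat and q vis :: "nat \<Rightarrow> nat"
    and val :: "nat \<Rightarrow> nat \<Rightarrow> real" and ch :: "nat \<Rightarrow> nat \<Rightarrow> nat"
  assumes reach: "p < t \<Longrightarrow> reach (inc a n) (posn a b n) n (set_decode (q p))"
    and inj: "inj_on q {..<t}"
    and vis: "vis x \<noteq> 0 \<longleftrightarrow> x \<in> q ` {..<t}"
    and q0: "q 0 = 0" and t0: "0 < t" and h_le: "h \<le> t"
    and card_mono: "p \<le> p' \<Longrightarrow> p' < t \<Longrightarrow> card (set_decode (q p)) \<le> card (set_decode (q p'))"
    and card_le: "p < t \<Longrightarrow> h < t \<Longrightarrow> card (set_decode (q p)) \<le> Suc (card (set_decode (q h)))"
    and val0: "e < 2 \<Longrightarrow> val e 0 = 0"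
    and choice: "p < t \<Longrightarrow> p \<noteq> 0 \<Longrightarrow> e < 2 \<Longrightarrow>
       \<exists>p'<t. (p' < h \<or> p' = h \<and> ch e (q p) < i0) \<and> ch e (q p) < n \<and>
         ch e (q p) \<notin> set_decode (q p') \<and> q p = q p' + 2 ^ ch e (q p) \<and>
         val e (q p) = cand a b (\<lambda>e. val e (q p')) (ch e (q p)) e"
    and relaxed: "p < t \<Longrightarrow> j < n \<Longrightarrow> p < h \<or> p = h \<and> j < i0 \<Longrightarrow> j \<notin> set_decode (q p) \<Longrightarrow>
       ok (inc a n) (posn a b n) (set_decode (q p)) j \<Longrightarrow>
       vis (q p + 2 ^ j) \<noteq> 0 \<and> (\<forall>e<2. val e (q p + 2 ^ j) \<le> cand a b (\<lambda>e. val e (q p)) j e)"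

lemma bfs_init:
  assumes "q 0 = 0" "\<And>x. vis x \<noteq> 0 \<longleftrightarrow> x = 0" "\<And>e. e < 2 \<Longrightarrow> val e 0 = 0"
  shows "bfs a b n 0 0 1 q vis val ch"
  by (rule bfs.intro) (use assms reach.empty in \<open>auto simp: lessThan_Suc\<close>)

text \<open>Queue and tables stay as they are and only the processed region grows. A pair newly
  counted as processed imposes nothing if its element already belongs to the set or may not be added
  to it.\<close>

lemma bfs_mark:
  assumes B: "bfs a b n h i0 t q vis val ch" and h': "h' \<le> t"
    and le: "\<And>p. p < t \<Longrightarrow> h' < t \<Longrightarrow> card (set_decode (q p)) \<le> Suc (card (set_decode (q h')))"
    and more: "\<And>p j. p < t \<Longrightarrow> j < n \<Longrightarrow> p < h \<or> p = h \<and> j < i0 \<Longrightarrow> p < h' \<or> p = h' \<and> j < i0'"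
    and skip: "\<And>p j. p < t \<Longrightarrow> j < n \<Longrightarrow> p < h' \<or> p = h' \<and> j < i0' \<Longrightarrow>
      p < h \<or> p = h \<and> j < i0 \<or> j \<in> set_decode (q p) \<or> \<not> ok (inc a n) (posn a b n) (set_decode (q p)) j"
  shows "bfs a b n h' i0' t q vis val ch"
proof -
  interpret bfs a b n h i0 t q vis val ch by (rule B)
  show ?thesis
  proof
    fix p e assume p: "p < t" "p \<noteq> 0" and e: "(e::nat) < 2"
    obtain p' where p': "p' < t" "p' < h \<or> p' = h \<and> ch e (q p) < i0" "ch e (q p) < n"
      "ch e (q p) \<notin> set_decode (q p')" "q p = q p' + 2 ^ ch e (q p)"
      "val e (q p) = cand a b (\<lambda>e. val e (q p')) (ch e (q p)) e"
      using choice[OF p e] by blast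
    then show "\<exists>p'<t. (p' < h' \<or> p' = h' \<and> ch e (q p) < i0') \<and> ch e (q p) < n \<and>
       ch e (q p) \<notin> set_decode (q p') \<and> q p = q p' + 2 ^ ch e (q p) \<and>
       val e (q p) = cand a b (\<lambda>e. val e (q p')) (ch e (q p)) e"
      using more[OF p'(1,3,2)] by blast
  next
    fix p j assume "p < t" "j < n" "p < h' \<or> p = h' \<and> j < i0'" "j \<notin> set_decode (q p)"
      "ok (inc a n) (posn a b n) (set_decode (q p)) j"
    then show "vis (q p + 2 ^ j) \<noteq> 0 \<and> (\<forall>e<2. val e (q p + 2 ^ j) \<le> cand a b (\<lambda>e. val e (q p)) j e)"
      using skip[of p j] relaxed[of p j] by blast
  qed (fact reach inj vis q0 t0 h' card_mono le val0)+
qed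

lemma bfs_next:
  assumes B: "bfs a b n h n t q vis val ch" and h: "h < t"
  shows "bfs a b n (Suc h) 0 t q vis val ch"
proof (rule bfs_mark[OF B])
  fix p assume p: "p < t" "Suc h < t"
  have "card (set_decode (q p)) \<le> Suc (card (set_decode (q h)))"
    "card (set_decode (q h)) \<le> card (set_decode (q (Suc h)))"
    using bfs.card_le[OF B] bfs.card_mono[OF B, of h "Suc h"] p h by simp_all
  then show "card (set_decode (q p)) \<le> Suc (card (set_decode (q (Suc h))))" by linarith
qed (use h in auto)

lemma bfs_skip:
  assumes B: "bfs a b n h i0 t q vis val ch" and h: "h < t"
    and "i0 \<in> set_decode (q h) \<or> \<not> ok (inc a n) (posn a b n) (set_decode (q h)) i0"
  shows "bfs a b n h (Suc i0) t q vis val ch"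
  using B by (rule bfs_mark) (use assms bfs.card_le[OF B] in \<open>auto simp: less_Suc_eq\<close>)

text \<open>The queue is sorted by cardinality, and \<open>y\<close> is larger than every set at a
  position up to \<open>h\<close>. So writing the entry of \<open>y\<close> never alters a value
  from which another entry was computed, and earlier choices and relaxations stay valid.\<close>

lemma bfs_step:
  assumes B: "bfs a b n h i0 t q vis val ch" and h: "h < t" and i0: "i0 < n"
    and new: "i0 \<notin> set_decode (q h)" "ok (inc a n) (posn a b n) (set_decode (q h)) i0"
    and y: "y = q h + 2 ^ i0"
    and val': "\<And>e x. e < 2 \<Longrightarrow> x \<noteq> y \<Longrightarrow> val' e x = val e x"
      "\<And>e x. e < 2 \<Longrightarrow> x \<noteq> y \<Longrightarrow> ch' e x = ch e x"
      "\<And>e. e < 2 \<Longrightarrow> val' e y \<le> cand a b (\<lambda>e. val e (q h)) i0 e"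
      "\<And>e. e < 2 \<Longrightarrow> vis y \<noteq> 0 \<Longrightarrow> val' e y \<le> val e y"
      "\<And>e. e < 2 \<Longrightarrow> val' e y = cand a b (\<lambda>e. val e (q h)) i0 e \<and> ch' e y = i0 \<or>
         vis y \<noteq> 0 \<and> val' e y = val e y \<and> ch' e y = ch e y"
    and q': "t' = (if vis y = 0 then Suc t else t)" "q' = (if vis y = 0 then q(t := y) else q)"
      "vis' = (if vis y = 0 then vis(y := 1) else vis)"
  shows "bfs a b n h (Suc i0) t' q' vis' val' ch'"
proof -
  let ?R = "reach (inc a n) (posn a b n) n"
  interpret bfs a b n h i0 t q vis val ch by (rule B)
  have Dy: "set_decode y = insert i0 (set_decode (q h))" unfolding y by (rule set_decode_add[OF new(1)])
  then have cy: "card (set_decode y) = Suc (card (set_decode (q h)))" using new by simp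
  \<comment> \<open>This is where the sorting by cardinality enters.\<close>
  have yq: "q p \<noteq> y" if "p \<le> h" for p
    using card_mono[OF that h] cy by auto
  have y0: "y \<noteq> 0" using y by simp
  have q'q: "q' p = q p" if "p < t" for p using that q' by simp
  have tt: "t \<le> t'" using q' by simp
  have q'y: "p < t' \<Longrightarrow> p < t \<or> p = t \<and> vis y = 0 \<and> q' p = y" for p
    using q' by (auto split: if_splits)
  have ynew: "vis y = 0 \<Longrightarrow> p < t \<Longrightarrow> q p \<noteq> y" for p using vis[of y] by auto
  have vis': "vis' x \<noteq> 0 \<longleftrightarrow> vis x \<noteq> 0 \<or> x = y" for x using q' by auto
  have valq: "val' e (q p) = val e (q p)" if "p \<le> h" "e < 2" for e p
    using val'(1)[OF that(2) yq[OF that(1)]] .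
  have le': "val' e x \<le> val e x" if "e < 2" "vis x \<noteq> 0" for e x
    using val'(1)[of e x] val'(4)[of e] that by (cases "x = y") auto
  have "?R (set_decode (q' p))" if "p < t'" for p
    using q'y[OF that] reach q'q Dy reach.step[OF reach[OF h] i0 new] by metis
  moreover have "inj_on q' {..<t'}"
  proof (cases "vis y = 0")
    case True
    then have "y \<notin> q ` {..<t}" using vis[of y] by simp
    then show ?thesis using True inj q' by (auto simp: lessThan_Suc intro: inj_on_fun_updI)
  next
    case False
    then show ?thesis using inj q' by simp
  qed
  moreover have "vis' x \<noteq> 0 \<longleftrightarrow> x \<in> q' ` {..<t'}" for x
  proof (cases "vis y = 0")
    case True
    then have "q' ` {..<t'} = insert y (q ` {..<t})" using q' by (auto simp: lessThan_Suc)
    then show ?thesis using vis' vis by auto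
  next
    case False
    then show ?thesis using q' vis by auto
  qed
  moreover have "q' 0 = 0" "0 < t'" "h \<le> t'" using q'q q0 t0 tt h by auto
  moreover have "card (set_decode (q' p)) \<le> card (set_decode (q' p'))" if "p \<le> p'" "p' < t'" for p p'
    using q'y[OF that(2)] q'y[of p] that card_mono[of p p'] card_le[OF _ h, of p] cy q'q[of p] q'q[of p'] by auto
  moreover have "card (set_decode (q' p)) \<le> Suc (card (set_decode (q' h)))" if "p < t'" for p
    using q'y[OF that] card_le[OF _ h, of p] cy q'q[of p] q'q[OF h] by auto
  moreover have "val' e 0 = 0" if "e < 2" for e
    using val'(1)[of e 0] val0 that y0 by auto
  moreover have "\<exists>p'<t'. (p' < h \<or> p' = h \<and> ch' e (q' p) < Suc i0) \<and> ch' e (q' p) < n \<and>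
       ch' e (q' p) \<notin> set_decode (q' p') \<and> q' p = q' p' + 2 ^ ch' e (q' p) \<and>
       val' e (q' p) = cand a b (\<lambda>e. val' e (q' p')) (ch' e (q' p)) e"
    if p: "p < t'" "p \<noteq> 0" and e: "e < 2" for p e
  proof (cases "q' p = y \<and> val' e y = cand a b (\<lambda>e. val e (q h)) i0 e \<and> ch' e y = i0")
    case True
    have "cand a b (\<lambda>e. val e (q h)) i0 e = cand a b (\<lambda>e. val' e (q' h)) i0 e"
      using e q'q[OF h] valq by (intro cand_cong) auto
    then have "val' e (q' p) = cand a b (\<lambda>e. val' e (q' h)) (ch' e (q' p)) e"
      using True by simp
    then show ?thesis using True h tt i0 new y q'q[OF h] by (intro exI[of _ h]) auto
  next
    case False
    have pt: "p < t" "q' p = q p"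
      using False q'y[OF p(1)] val'(5)[OF e] q'q[of p] by auto
    have same: "val' e (q p) = val e (q p) \<and> ch' e (q p) = ch e (q p)"
      using False pt val'(1,2)[OF e, of "q p"] val'(5)[OF e] by auto
    obtain p' where p': "p' < t" "p' < h \<or> p' = h \<and> ch e (q p) < i0" "ch e (q p) < n"
      "ch e (q p) \<notin> set_decode (q p')" "q p = q p' + 2 ^ ch e (q p)"
      "val e (q p) = cand a b (\<lambda>e. val e (q p')) (ch e (q p)) e"
      using choice[OF pt(1) p(2) e] by blast
    then have "p' \<le> h" by auto
    then have "val e (q p) = cand a b (\<lambda>e. val' e (q p')) (ch e (q p)) e"
      using p'(6) e by (simp add: valq cong: cand_cong)
    then show ?thesis
      using p' same pt tt q'q[OF p'(1)] by (intro exI[of _ p']) auto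
  qed
  moreover have "vis' (q' p + 2 ^ j) \<noteq> 0 \<and> (\<forall>e<2. val' e (q' p + 2 ^ j) \<le> cand a b (\<lambda>e. val' e (q' p)) j e)"
    if p: "p < t'" "j < n" "p < h \<or> p = h \<and> j < Suc i0" and j: "j \<notin> set_decode (q' p)"
      "ok (inc a n) (posn a b n) (set_decode (q' p)) j" for p j
  proof -
    have pt: "p < t" "p \<le> h" using p h by auto
    note qp = q'q[OF pt(1)]
    have c: "cand a b (\<lambda>e. val' e (q p)) j e = cand a b (\<lambda>e. val e (q p)) j e" if "e < 2" for e
      using that pt by (intro cand_cong) (auto simp: valq)
    show ?thesis
    proof (cases "p = h \<and> j = i0")
      case True
      then show ?thesis using vis' val'(3) y qp c by auto
    next
      case False
      then have *: "p < h \<or> p = h \<and> j < i0" using p by auto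
      have w: "vis (q p + 2 ^ j) \<noteq> 0" and v: "\<forall>e<2. val e (q p + 2 ^ j) \<le> cand a b (\<lambda>e. val e (q p)) j e"
        using relaxed[OF pt(1) p(2) *] j qp by auto
      have "val' e (q p + 2 ^ j) \<le> cand a b (\<lambda>e. val' e (q p)) j e" if "e < 2" for e
        using le'[OF that w] v c that by force
      then show ?thesis using vis' w qp by simp
    qed
  qed
  ultimately show ?thesis by (intro bfs.intro) blast+
qed

lemma bfs_length:
  assumes "bfs a b n h i0 t q vis val ch" and k: "card {i. i < n \<and> a i < 0} = k"
  shows "t \<le> 2 ^ k * (n * (n + 1) + 1)"
proof -
  let ?R = "{S. reach (inc a n) (posn a b n) n S}"
  have "{..<n} - inc a n = {i. i < n \<and> a i < 0}" by (auto simp: inc_def)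
  then have R: "finite ?R" "card ?R \<le> 2 ^ k * (n * (n + 1) + 1)"
    using card_reach[of "inc a n" n "posn a b n" k] bij_posn k by (auto simp: inc_def)
  have "inj_on (\<lambda>p. set_decode (q p)) {..<t}"
    using bfs.inj[OF assms(1)] by (auto simp: inj_on_def set_decode_eq_iff)
  moreover have "(\<lambda>p. set_decode (q p)) ` {..<t} \<subseteq> ?R"
    using bfs.reach[OF assms(1)] by auto
  ultimately show ?thesis using R card_inj_on_le[of "\<lambda>p. set_decode (q p)" "{..<t}" ?R] by auto
qed

text \<open>Follow the prefixes of \<open>xs\<close>: goodness makes each step admissible, hence
  relaxed by the search. Both modes are carried through the induction, since a decreasing function
  needs the bound for the opposite mode.\<close>

lemma bfs_optimal:
  assumes B: "bfs a b n t 0 t q vis val ch" and g: "good (inc a n) (posn a b n) xs" and xs: "xs \<in> ords n"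
    and e: "e < 2"
  shows "vis (set_encode {..<n}) \<noteq> 0 \<and> val e (set_encode {..<n}) \<le> sg e * cst a b xs"
proof -
  interpret bfs a b n t 0 t q vis val ch by (rule B)
  have "vis (set_encode (set U)) \<noteq> 0 \<and> (\<forall>e<2. val e (set_encode (set U)) \<le> sg e * cst a b U)"
    if "xs = U @ W" for U W
    using that
  proof (induction U arbitrary: W rule: rev_induct)
    case Nil
    show ?case using vis[of 0] q0 t0 val0 by (auto intro!: rev_image_eqI[of 0])
  next
    case (snoc i U)
    let ?x = "set_encode (set U)"
    have i: "i < n" "i \<notin> set U" using xs snoc.prems by (auto simp: ords_def)
    have IH: "vis ?x \<noteq> 0" "\<forall>e<2. val e ?x \<le> sg e * cst a b U" using snoc.IH[of "i # W"] snoc.prems by auto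
    obtain p where p: "p < t" "?x = q p" using vis IH by auto
    have D: "set_decode (q p) = set U" using p(2) by (metis List.finite_set set_encode_inverse)
    have "ok (inc a n) (posn a b n) (set U) i" using g snoc.prems by (auto simp: good_def)
    then have v: "vis (q p + 2 ^ i) \<noteq> 0" "\<forall>e<2. val e (q p + 2 ^ i) \<le> cand a b (\<lambda>e. val e (q p)) i e"
      using relaxed[of p i] p(1) i D by auto
    have enc: "set_encode (set (U @ [i])) = q p + 2 ^ i" using i p by (simp add: set_encode_insert)
    have "val e (q p + 2 ^ i) \<le> sg e * cst a b (U @ [i])" if "e < 2" for e
    proof -
      have "cand a b (\<lambda>e. val e (q p)) i e \<le> cand a b (\<lambda>e. sg e * cst a b U) i e"
        using IH(2) p that by (intro cand_mono) auto
      then show ?thesis using v that cst_snoc[OF that] by force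
    qed
    then show ?case using v(1) enc by simp
  qed
  from this[of xs "[]"] show ?thesis using xs e by (simp add: ords_def)
qed

text \<open>Following the choices \<open>ch\<close> backwards from the full set, \<open>ys\<close> is the part of the list found so
  far, and \<open>x\<close>, \<open>e\<close> are the remaining set and the mode for it.\<close>

definition trace :: "(nat \<Rightarrow> real) \<Rightarrow> (nat \<Rightarrow> real) \<Rightarrow> nat \<Rightarrow> (nat \<Rightarrow> nat) \<Rightarrow> (nat \<Rightarrow> nat \<Rightarrow> real) \<Rightarrow> nat \<Rightarrow>
    nat \<Rightarrow> nat \<Rightarrow> nat list \<Rightarrow> bool" where
  "trace a b n vis val m e x ys \<longleftrightarrow> e < 2 \<and> vis x \<noteq> 0 \<and> distinct ys \<and> set ys \<inter> set_decode x = {} \<and>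
    set ys \<union> set_decode x = {..<n} \<and>
    (\<forall>zs. sg e * cst a b zs = val e x \<longrightarrow> distinct zs \<longrightarrow> set zs = set_decode x \<longrightarrow>
      sg m * cst a b (zs @ ys) = val m (set_encode {..<n}))"

lemma trace_init: "m < 2 \<Longrightarrow> vis (set_encode {..<n}) \<noteq> 0 \<Longrightarrow> trace a b n vis val m m (set_encode {..<n}) []"
  by (simp add: trace_def)

text \<open>The entry of \<open>x\<close> in mode \<open>e\<close> was computed from the
  predecessor's entry in mode \<open>flip a (ch e x) e\<close>. So an order attaining the latter,
  followed by \<open>ch e x\<close>, attains the former.\<close>

lemma trace_step:
  assumes B: "bfs a b n h i0 t q vis val ch" and T: "trace a b n vis val m e x ys" and "x \<noteq> 0"
  shows "ch e x < n \<and> 2 ^ ch e x \<le> x \<and> trace a b n vis val m (flip a (ch e x) e) (x - 2 ^ ch e x) (ch e x # ys)"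
proof -
  let ?i = "ch e x"
  have e: "e < 2" and d: "distinct ys" "set ys \<inter> set_decode x = {}" "set ys \<union> set_decode x = {..<n}"
    using T by (auto simp: trace_def)
  interpret bfs a b n h i0 t q vis val ch by (rule B)
  obtain p where p: "p < t" "x = q p" using vis[of x] T by (auto simp: trace_def)
  have "p \<noteq> 0" using p q0 assms(3) by metis
  then obtain p' where p': "p' < t" "?i < n" "?i \<notin> set_decode (q p')" "x = q p' + 2 ^ ?i"
    "val e x = cand a b (\<lambda>e. val e (q p')) ?i e"
    using choice[of p e] p e by blast
  have D: "set_decode x = insert ?i (set_decode (q p'))" using set_decode_add[OF p'(3)] p'(4) by simp
  have "sg m * cst a b (zs @ ?i # ys) = val m (set_encode {..<n})"
    if zs: "sg (flip a ?i e) * cst a b zs = val (flip a ?i e) (q p')" "distinct zs" "set zs = set_decode (q p')" for zs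
  proof -
    have "sg e * cst a b (zs @ [?i]) = val e x"
      unfolding cst_snoc[OF e] p'(5) using zs(1) by (simp add: cand_def)
    moreover have "distinct (zs @ [?i])" "set (zs @ [?i]) = set_decode x" using zs p' D by auto
    ultimately have "sg m * cst a b ((zs @ [?i]) @ ys) = val m (set_encode {..<n})"
      using T unfolding trace_def by blast
    then show ?thesis by simp
  qed
  moreover have "vis (q p') \<noteq> 0" using vis p' by blast
  moreover have "x - 2 ^ ?i = q p'" using p'(4) by simp
  ultimately show ?thesis
    using p' D d flip_less[OF e] unfolding trace_def by auto
qed

text \<open>The traced order attains the final entry, and by \<open>bfs_optimal\<close> this entry
  does not exceed the value of a good optimal order.\<close>

lemma trace_final:
  assumes T: "trace a b n vis val m e 0 ys" and B: "bfs a b n t 0 t q vis val ch" and m: "m < 2"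
  shows "optl (sg m) a b n ys"
proof -
  have "val e 0 = 0" using bfs.val0[OF B] T by (simp add: trace_def)
  then have "sg m * cst a b ([] @ ys) = val m (set_encode {..<n})"
    using T unfolding trace_def by (elim conjE allE[of _ "[]"]) simp
  then have v: "sg m * cst a b ys = val m (set_encode {..<n})" and ys: "ys \<in> ords n"
    using T by (simp_all add: trace_def ords_def)
  have "sg m \<noteq> 0" by (simp add: sg_def)
  then obtain xs where xs: "good (inc a n) (posn a b n) xs" "optl (sg m) a b n xs"
    using ex_good_optl_posn by blast
  have "val m (set_encode {..<n}) \<le> sg m * cst a b xs"
    using bfs_optimal[OF B xs(1) _ m] xs(2) by (simp add: optl_def)
  then show ?thesis using v ys xs(2) by (force simp: optl_def)
qed

section \<open>Structured programs\<close>

datatype ('i, 'c) com =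
    Atom 'i
  | Seq "('i, 'c) com" "('i, 'c) com" (infixr ";;" 60)
  | If 'c "('i, 'c) com" "('i, 'c) com"
  | While 'c "('i, 'c) com"

text \<open>The surcharge of 2 covers the conditional jump and at most one unconditional jump.
  Instructions and tests are parameters because the language is used twice, for array programs and
  for machine instructions.\<close>

inductive big :: "('i \<Rightarrow> 's \<Rightarrow> 's) \<Rightarrow> ('c \<Rightarrow> 's \<Rightarrow> bool) \<Rightarrow> ('i, 'c) com \<Rightarrow> 's \<Rightarrow> nat \<Rightarrow> 's \<Rightarrow> bool"
  for ex ev where
  Atom: "big ex ev (Atom i) s 1 (ex i s)"
| Seq: "big ex ev c1 s t1 s1 \<Longrightarrow> big ex ev c2 s1 t2 s2 \<Longrightarrow> big ex ev (c1 ;; c2) s (t1 + t2) s2"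
| IfT: "ev b s \<Longrightarrow> big ex ev c1 s t s1 \<Longrightarrow> big ex ev (If b c1 c2) s (t + 2) s1"
| IfF: "\<not> ev b s \<Longrightarrow> big ex ev c2 s t s1 \<Longrightarrow> big ex ev (If b c1 c2) s (t + 2) s1"
| WhileT: "ev b s \<Longrightarrow> big ex ev c s t1 s1 \<Longrightarrow> big ex ev (While b c) s1 t2 s2 \<Longrightarrow>
    big ex ev (While b c) s (t1 + t2 + 2) s2"
| WhileF: "\<not> ev b s \<Longrightarrow> big ex ev (While b c) s 2 s"

definition runs where
  "runs ex ev c s T Q \<longleftrightarrow> (\<exists>t s'. big ex ev c s t s' \<and> t \<le> T \<and> Q s')"

lemma runs_mono: "runs ex ev c s T Q \<Longrightarrow> T \<le> T' \<Longrightarrow> (\<And>s'. Q s' \<Longrightarrow> Q' s') \<Longrightarrow> runs ex ev c s T' Q'"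
  unfolding runs_def by (meson order_trans)

lemma runs_seq: "runs ex ev c1 s T1 P \<Longrightarrow> (\<And>s'. P s' \<Longrightarrow> runs ex ev c2 s' T2 Q) \<Longrightarrow> T1 + T2 \<le> T \<Longrightarrow>
    runs ex ev (c1 ;; c2) s T Q"
  unfolding runs_def by (meson add_mono big.Seq order_trans)

lemma runs_while:
  assumes "Inv i s" "i \<le> M"
    and step: "\<And>i s. Inv i s \<Longrightarrow> ev b s \<Longrightarrow> i < M \<and> runs ex ev c s T (Inv (Suc i))"
  shows "runs ex ev (While b c) s ((M - i) * (T + 2) + 2) (\<lambda>s'. \<exists>i. Inv i s' \<and> \<not> ev b s')"
  using assms(1,2)
proof (induction "M - i" arbitrary: i s)
  case 0
  then have "\<not> ev b s" using step[of i s] by auto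
  then show ?case using 0 unfolding runs_def by (intro exI[of _ 2] exI[of _ s]) (auto intro: big.WhileF)
next
  case (Suc d)
  show ?case
  proof (cases "ev b s")
    case True
    with step Suc.prems obtain t1 s1 where 1: "big ex ev c s t1 s1" "t1 \<le> T" "Inv (Suc i) s1"
      unfolding runs_def by blast
    have "d = M - Suc i" "Suc i \<le> M" using Suc.hyps(2) by linarith+
    then have "runs ex ev (While b c) s1 ((M - Suc i) * (T + 2) + 2) (\<lambda>s'. \<exists>i. Inv i s' \<and> \<not> ev b s')"
      using Suc.hyps(1) 1(3) by blast
    then obtain t2 s2 where 2: "big ex ev (While b c) s1 t2 s2" "t2 \<le> (M - Suc i) * (T + 2) + 2"
      "\<exists>i. Inv i s2 \<and> \<not> ev b s2"
      unfolding runs_def by blast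
    have "M - i = Suc (M - Suc i)" using Suc.hyps(2) by simp
    then have "t1 + t2 + 2 \<le> (M - i) * (T + 2) + 2" using 1 2 by simp
    then show ?thesis unfolding runs_def using big.WhileT[OF True 1(1) 2(1)] 2(3) by blast
  next
    case False
    then show ?thesis using Suc.prems unfolding runs_def
      by (intro exI[of _ 2] exI[of _ s]) (auto intro: big.WhileF)
  qed
qed

lemma runs_for:
  assumes "Inv 0 s" "\<And>i s. Inv i s \<Longrightarrow> i \<le> M \<and> (ev b s \<longleftrightarrow> i < M)"
    and "\<And>i s. Inv i s \<Longrightarrow> i < M \<Longrightarrow> runs ex ev c s T (Inv (Suc i))"
    and "M * (T + 2) + 2 \<le> T'"
  shows "runs ex ev (While b c) s T' (Inv M)"
proof -
  have "runs ex ev (While b c) s ((M - 0) * (T + 2) + 2) (\<lambda>s'. \<exists>i. Inv i s' \<and> \<not> ev b s')"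
    by (rule runs_while) (use assms in auto)
  then show ?thesis
  proof (rule runs_mono)
    fix s' assume "\<exists>i. Inv i s' \<and> \<not> ev b s'"
    then obtain i where "Inv i s'" "\<not> ev b s'" by blast
    moreover from this have "i = M" using assms(2) by fastforce
    ultimately show "Inv M s'" by simp
  qed (use assms(4) in simp)
qed

text \<open>Evaluation as a function lets the simplifier execute loop-free code symbolically. The
  equation for \<open>While\<close> is a dummy value, excluded by \<open>loop_free\<close>.\<close>

fun sem :: "('i \<Rightarrow> 's \<Rightarrow> 's) \<Rightarrow> ('c \<Rightarrow> 's \<Rightarrow> bool) \<Rightarrow> ('i, 'c) com \<Rightarrow> 's \<Rightarrow> 's" where
  "sem ex ev (Atom i) s = ex i s"
| "sem ex ev (c1 ;; c2) s = sem ex ev c2 (sem ex ev c1 s)"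
| "sem ex ev (If b c1 c2) s = (if ev b s then sem ex ev c1 s else sem ex ev c2 s)"
| "sem ex ev (While b c) s = s"

fun loop_free :: "('i, 'c) com \<Rightarrow> bool" where
  "loop_free (Atom i) \<longleftrightarrow> True"
| "loop_free (c1 ;; c2) \<longleftrightarrow> loop_free c1 \<and> loop_free c2"
| "loop_free (If b c1 c2) \<longleftrightarrow> loop_free c1 \<and> loop_free c2"
| "loop_free (While b c) \<longleftrightarrow> False"

fun cost :: "('i, 'c) com \<Rightarrow> nat" where
  "cost (Atom i) = 1"
| "cost (c1 ;; c2) = cost c1 + cost c2"
| "cost (If b c1 c2) = cost c1 + cost c2 + 2"
| "cost (While b c) = 0"

lemma runs_loop_free: "loop_free c \<Longrightarrow> Q (sem ex ev c s) \<Longrightarrow> cost c \<le> T \<Longrightarrow> runs ex ev c s T Q"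
proof -
  assume "loop_free c"
  then have *: "\<exists>t \<le> cost c. big ex ev c s t (sem ex ev c s)"
  proof (induction c arbitrary: s)
    case (Atom i)
    show ?case using big.Atom[of ex ev i s] by auto
  next
    case (Seq c1 c2)
    then obtain t1 t2 where t: "t1 \<le> cost c1" "big ex ev c1 s t1 (sem ex ev c1 s)" "t2 \<le> cost c2"
      "big ex ev c2 (sem ex ev c1 s) t2 (sem ex ev c2 (sem ex ev c1 s))"
      by fastforce
    then show ?case by (intro exI[of _ "t1 + t2"]) (auto intro: big.Seq)
  next
    case (If b c1 c2)
    then obtain t1 t2 where "t1 \<le> cost c1" "big ex ev c1 s t1 (sem ex ev c1 s)" "t2 \<le> cost c2"
      "big ex ev c2 s t2 (sem ex ev c2 s)"
      by fastforce
    then show ?case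
      using big.IfT[of ev b s ex c1 t1] big.IfF[of ev b s ex c2 t2]
      by (intro exI[of _ "(if ev b s then t1 else t2) + 2"]) auto
  qed simp
  then show "Q (sem ex ev c s) \<Longrightarrow> cost c \<le> T \<Longrightarrow> ?thesis"
    unfolding runs_def using * order_trans by blast
qed

lemma runs_pre: "loop_free c1 \<Longrightarrow> runs ex ev c2 (sem ex ev c1 s) T2 Q \<Longrightarrow> cost c1 + T2 \<le> T \<Longrightarrow>
    runs ex ev (c1 ;; c2) s T Q"
  by (rule runs_seq[OF runs_loop_free[where Q = "\<lambda>s'. s' = sem ex ev c1 s"]]) auto

section \<open>Compilation to the register machine\<close>

datatype cond = NLess nat nat | RLess nat nat

type_synonym mem = "(nat \<Rightarrow> nat) \<times> (nat \<Rightarrow> real)"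

fun ev_cond :: "cond \<Rightarrow> mem \<Rightarrow> bool" where
  "ev_cond (NLess i j) (N, R) \<longleftrightarrow> N i < N j"
| "ev_cond (RLess i j) (N, R) \<longleftrightarrow> R i < R j"

fun jump_if :: "cond \<Rightarrow> nat \<Rightarrow> instr" where
  "jump_if (NLess i j) l = JmpNLess i j l"
| "jump_if (RLess i j) l = JmpRLess i j l"

definition ex_instr :: "instr \<Rightarrow> mem \<Rightarrow> mem" where
  "ex_instr i m = snd (exec_instr i (0, m))"

fun straight :: "instr \<Rightarrow> bool" where
  "straight (JmpRLess _ _ _) \<longleftrightarrow> False"
| "straight (JmpNLess _ _ _) \<longleftrightarrow> False"
| "straight (Jmp _) \<longleftrightarrow> False"
| "straight Halt \<longleftrightarrow> False"
| "straight _ \<longleftrightarrow> True"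

lemma exec_straight: "straight i \<Longrightarrow> exec_instr i (pc, m) = (Suc pc, ex_instr i m)"
  by (cases m; cases i) (auto simp: ex_instr_def)

fun clen :: "(instr, cond) com \<Rightarrow> nat" where
  "clen (Atom i) = 1"
| "clen (c1 ;; c2) = clen c1 + clen c2"
| "clen (If b c1 c2) = clen c1 + clen c2 + 2"
| "clen (While b c) = clen c + 3"

text \<open>Jump targets are absolute, hence the start address \<open>p\<close>. The conditional
  jump is taken when the test holds, so the code for its failure is placed directly behind
  it.\<close>

fun comp :: "(instr, cond) com \<Rightarrow> nat \<Rightarrow> instr list" where
  "comp (Atom i) p = [i]"
| "comp (c1 ;; c2) p = comp c1 p @ comp c2 (p + clen c1)"
| "comp (If b c1 c2) p = jump_if b (p + clen c2 + 2) # comp c2 (p + 1) @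
     Jmp (p + clen c2 + 2 + clen c1) # comp c1 (p + clen c2 + 2)"
| "comp (While b c) p = jump_if b (p + 2) # Jmp (p + clen c + 3) # comp c (p + 2) @ [Jmp p]"

lemma length_comp [simp]: "length (comp c p) = clen c"
  by (induction c arbitrary: p) auto

fun all_atoms :: "('i \<Rightarrow> bool) \<Rightarrow> ('i, 'c) com \<Rightarrow> bool" where
  "all_atoms P (Atom i) \<longleftrightarrow> P i"
| "all_atoms P (c1 ;; c2) \<longleftrightarrow> all_atoms P c1 \<and> all_atoms P c2"
| "all_atoms P (If b c1 c2) \<longleftrightarrow> all_atoms P c1 \<and> all_atoms P c2"
| "all_atoms P (While b c) \<longleftrightarrow> all_atoms P c"

lemma run_add: "run P (t1 + t2) s = run P t2 (run P t1 s)"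
  by (simp add: run_def add.commute[of t1] funpow_add)

lemma run_1: "run P 1 s = step P s"
  by (simp add: run_def)

lemma step_straight: "P ! p = i \<Longrightarrow> p < length P \<Longrightarrow> straight i \<Longrightarrow> step P (p, m) = (Suc p, ex_instr i m)"
  using exec_straight[of i p m] by (cases m; cases i) (auto simp: step_def halted_def)

lemma step_jump_if: "P ! p = jump_if b l \<Longrightarrow> p < length P \<Longrightarrow>
    step P (p, m) = (if ev_cond b m then l else Suc p, m)"
  by (cases m; cases b) (auto simp: step_def halted_def)

lemma step_Jmp: "P ! p = Jmp l \<Longrightarrow> p < length P \<Longrightarrow> step P (p, m) = (l, m)"
  by (cases m) (auto simp: step_def halted_def)

text \<open>The surrounding code \<open>pre\<close> and \<open>post\<close> is arbitrary so that the
  induction applies to subprograms at their final addresses. Fewer steps than charged may suffice: a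
  true branch saves the closing jump.\<close>

lemma run_comp:
  assumes "big ex_instr ev_cond c m t m'" "all_atoms straight c" "P = pre @ comp c p @ post" "length pre = p"
  shows "\<exists>t' \<le> t. run P t' (p, m) = (p + clen c, m')"
  using assms
proof (induction arbitrary: pre p post rule: big.induct)
  case (Atom i s)
  have "step P (p, s) = (Suc p, ex_instr i s)"
    by (rule step_straight) (use Atom in \<open>auto simp: nth_append\<close>)
  then show ?case by (intro exI[of _ 1]) (simp only: run_1, simp)
next
  case (Seq c1 s t1 s1 c2 t2 s2)
  obtain u1 where u1: "u1 \<le> t1" "run P u1 (p, s) = (p + clen c1, s1)"
    using Seq.IH(1)[of pre p "comp c2 (p + clen c1) @ post"] Seq.prems by auto
  obtain u2 where u2: "u2 \<le> t2" "run P u2 (p + clen c1, s1) = (p + clen c1 + clen c2, s2)"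
    using Seq.IH(2)[of "pre @ comp c1 p" "p + clen c1" post] Seq.prems by auto
  show ?case using u1 u2 by (intro exI[of _ "u1 + u2"]) (auto simp: run_add)
next
  case (IfT b s c1 t s1 c2)
  have 1: "run P 1 (p, s) = (p + clen c2 + 2, s)"
    unfolding run_1 by (subst step_jump_if[of _ _ b "p + clen c2 + 2"]) (use IfT in \<open>auto simp: nth_append\<close>)
  obtain u where u: "u \<le> t" "run P u (p + clen c2 + 2, s) = (p + clen c2 + 2 + clen c1, s1)"
    using IfT.IH[of "pre @ jump_if b (p + clen c2 + 2) # comp c2 (p + 1) @ [Jmp (p + clen c2 + 2 + clen c1)]"
      "p + clen c2 + 2" post] IfT.prems by auto
  show ?case using u 1 by (intro exI[of _ "1 + u"]) (auto simp only: run_add, auto)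
next
  case (IfF b s c2 t s1 c1)
  have 1: "run P 1 (p, s) = (p + 1, s)"
    unfolding run_1 by (subst step_jump_if[of _ _ b "p + clen c2 + 2"]) (use IfF in \<open>auto simp: nth_append\<close>)
  obtain u where u: "u \<le> t" "run P u (p + 1, s) = (p + 1 + clen c2, s1)"
    using IfF.IH[of "pre @ [jump_if b (p + clen c2 + 2)]" "p + 1"
      "Jmp (p + clen c2 + 2 + clen c1) # comp c1 (p + clen c2 + 2) @ post"] IfF.prems by auto
  have 2: "run P 1 (p + 1 + clen c2, s1) = (p + clen c2 + 2 + clen c1, s1)"
    unfolding run_1 by (rule step_Jmp) (use IfF.prems in \<open>auto simp: nth_append\<close>)
  show ?case using u 1 2 by (intro exI[of _ "1 + (u + 1)"]) (auto simp only: run_add, auto)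
next
  case (WhileT b s c t1 s1 t2 s2)
  have 1: "run P 1 (p, s) = (p + 2, s)"
    unfolding run_1 by (subst step_jump_if[of _ _ b "p + 2"]) (use WhileT in \<open>auto simp: nth_append\<close>)
  obtain u1 where u1: "u1 \<le> t1" "run P u1 (p + 2, s) = (p + 2 + clen c, s1)"
    using WhileT.IH(1)[of "pre @ [jump_if b (p + 2), Jmp (p + clen c + 3)]" "p + 2" "[Jmp p] @ post"]
      WhileT.prems by auto
  have 2: "run P 1 (p + 2 + clen c, s1) = (p, s1)"
    unfolding run_1 by (rule step_Jmp) (use WhileT.prems in \<open>auto simp: nth_append\<close>)
  obtain u2 where u2: "u2 \<le> t2" "run P u2 (p, s1) = (p + clen (While b c), s2)"
    using WhileT.IH(2)[of pre p post] WhileT.prems by auto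
  show ?case
  proof (intro exI[of _ "1 + (u1 + (1 + u2))"] conjI)
    show "1 + (u1 + (1 + u2)) \<le> t1 + t2 + 2" using u1(1) u2(1) by simp
    show "run P (1 + (u1 + (1 + u2))) (p, s) = (p + clen (While b c), s2)"
      by (simp only: run_add 1 2 u1(2) u2(2))
  qed
next
  case (WhileF b s c)
  have 1: "run P 1 (p, s) = (p + 1, s)"
    unfolding run_1 by (subst step_jump_if[of _ _ b "p + 2"]) (use WhileF in \<open>auto simp: nth_append\<close>)
  have 2: "run P 1 (p + 1, s) = (p + clen c + 3, s)"
    unfolding run_1 by (rule step_Jmp) (use WhileF.prems in \<open>auto simp: nth_append\<close>)
  show ?case using 1 2 by (intro exI[of _ "1 + 1"]) (auto simp only: run_add, auto)
qed

text \<open>The programs below work on scalar variables and on arrays. Array \<open>f < 16\<close> at index \<open>i\<close> is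
  stored at the address \<open>16 * i + f\<close> above a base address, which is kept in \<open>N 0\<close>; the scalar
  variables are the registers below \<open>32\<close>, of which \<open>N 1\<close> and \<open>N 2\<close> serve for address computations.\<close>

datatype hop =
    Op instr
  | NGet nat nat nat
  | NPut nat nat nat
  | RGet nat nat nat
  | RPut nat nat nat

type_synonym amem = "(nat \<Rightarrow> nat) \<times> (nat \<Rightarrow> real) \<times> (nat \<Rightarrow> nat \<Rightarrow> nat) \<times> (nat \<Rightarrow> nat \<Rightarrow> real)"

fun scalar :: "instr \<Rightarrow> bool" where
  "scalar (RConst i c) \<longleftrightarrow> i < 32"
| "scalar (RAdd i j k) \<longleftrightarrow> i < 32 \<and> j < 32 \<and> k < 32"
| "scalar (RSub i j k) \<longleftrightarrow> i < 32 \<and> j < 32 \<and> k < 32"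
| "scalar (RMul i j k) \<longleftrightarrow> i < 32 \<and> j < 32 \<and> k < 32"
| "scalar (RDiv i j k) \<longleftrightarrow> i < 32 \<and> j < 32 \<and> k < 32"
| "scalar (NConst i c) \<longleftrightarrow> i \<in> {3..<32}"
| "scalar (NAdd i j k) \<longleftrightarrow> i \<in> {3..<32} \<and> j \<in> {3..<32} \<and> k \<in> {3..<32}"
| "scalar (NSub i j k) \<longleftrightarrow> i \<in> {3..<32} \<and> j \<in> {3..<32} \<and> k \<in> {3..<32}"
| "scalar _ \<longleftrightarrow> False"

fun wf_hop :: "hop \<Rightarrow> bool" where
  "wf_hop (Op i) \<longleftrightarrow> scalar i"
| "wf_hop (NGet x f v) \<longleftrightarrow> x \<in> {3..<32} \<and> f < 16 \<and> v \<in> {3..<32}"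
| "wf_hop (NPut f v x) \<longleftrightarrow> x \<in> {3..<32} \<and> f < 16 \<and> v \<in> {3..<32}"
| "wf_hop (RGet x f v) \<longleftrightarrow> x < 32 \<and> f < 16 \<and> v \<in> {3..<32}"
| "wf_hop (RPut f v x) \<longleftrightarrow> x < 32 \<and> f < 16 \<and> v \<in> {3..<32}"

fun wf_cond :: "cond \<Rightarrow> bool" where
  "wf_cond (NLess i j) \<longleftrightarrow> i \<in> {3..<32} \<and> j \<in> {3..<32}"
| "wf_cond (RLess i j) \<longleftrightarrow> i < 32 \<and> j < 32"

fun wf_com :: "(hop, cond) com \<Rightarrow> bool" where
  "wf_com (Atom i) \<longleftrightarrow> wf_hop i"
| "wf_com (c1 ;; c2) \<longleftrightarrow> wf_com c1 \<and> wf_com c2"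
| "wf_com (If b c1 c2) \<longleftrightarrow> wf_cond b \<and> wf_com c1 \<and> wf_com c2"
| "wf_com (While b c) \<longleftrightarrow> wf_cond b \<and> wf_com c"

fun ex_hop :: "hop \<Rightarrow> amem \<Rightarrow> amem" where
  "ex_hop (Op i) (N, R, NA, RA) = (case ex_instr i (N, R) of (N', R') \<Rightarrow> (N', R', NA, RA))"
| "ex_hop (NGet x f v) (N, R, NA, RA) = (N(x := NA f (N v)), R, NA, RA)"
| "ex_hop (NPut f v x) (N, R, NA, RA) = (N, R, NA(f := (NA f)(N v := N x)), RA)"
| "ex_hop (RGet x f v) (N, R, NA, RA) = (N, R(x := RA f (N v)), NA, RA)"
| "ex_hop (RPut f v x) (N, R, NA, RA) = (N, R, NA, RA(f := (RA f)(N v := R x)))"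

fun ev_hop :: "cond \<Rightarrow> amem \<Rightarrow> bool" where
  "ev_hop b (N, R, A) = ev_cond b (N, R)"

text \<open>Index registers cannot be multiplied, so four doublings produce the factor 16. These
  seven instructions and the access itself give the slowdown 8 in \<open>trans_sim\<close>.\<close>

definition addr :: "nat \<Rightarrow> nat \<Rightarrow> (instr, cond) com \<Rightarrow> (instr, cond) com" where
  "addr f v c = Atom (NAdd 1 v v) ;; Atom (NAdd 1 1 1) ;; Atom (NAdd 1 1 1) ;; Atom (NAdd 1 1 1) ;;
     Atom (NConst 2 f) ;; Atom (NAdd 1 1 2) ;; Atom (NAdd 1 1 0) ;; c"

fun impl :: "hop \<Rightarrow> (instr, cond) com" where
  "impl (Op i) = Atom i"
| "impl (NGet x f v) = addr f v (Atom (NLoad x 1))"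
| "impl (NPut f v x) = addr f v (Atom (NStore 1 x))"
| "impl (RGet x f v) = addr f v (Atom (RLoad x 1))"
| "impl (RPut f v x) = addr f v (Atom (RStore 1 x))"

fun trans :: "(hop, cond) com \<Rightarrow> (instr, cond) com" where
  "trans (Atom i) = impl i"
| "trans (c1 ;; c2) = trans c1 ;; trans c2"
| "trans (If b c1 c2) = If b (trans c1) (trans c2)"
| "trans (While b c) = While b (trans c)"

fun rep :: "nat \<Rightarrow> amem \<Rightarrow> mem \<Rightarrow> bool" where
  "rep B (hN, hR, NA, RA) (N, R) \<longleftrightarrow> 32 \<le> B \<and> N 0 = B \<and> (\<forall>v\<in>{3..<32}. N v = hN v) \<and> (\<forall>v<32. R v = hR v) \<and>
    (\<forall>f<16. \<forall>i. N (B + 16 * i + f) = NA f i \<and> R (B + 16 * i + f) = RA f i)"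

lemma sem_addr:
  assumes "v \<noteq> 1" "v \<noteq> 2"
  shows "sem ex_instr ev_cond (addr f v c) (N, R) =
    sem ex_instr ev_cond c (N(1 := 16 * N v + f + N 0, 2 := f), R)"
  using assms by (simp add: addr_def ex_instr_def)
    (rule arg_cong[where f = "sem ex_instr ev_cond c"], auto simp: fun_eq_iff)

text \<open>A write changes no other cell: since \<open>f < 16\<close>, an address determines both
  array and index, and \<open>32 \<le> B\<close> keeps the arrays apart from the scalar
  variables.\<close>

lemma rep_sem_impl:
  assumes "wf_hop i" "rep B s m"
  shows "rep B (ex_hop i s) (sem ex_instr ev_cond (impl i) m)"
proof -
  obtain hN hR NA RA N R where s: "s = (hN, hR, NA, RA)" "m = (N, R)" by (metis prod.exhaust)
  show ?thesis
  proof (cases i)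
    case (Op j)
    show ?thesis using assms unfolding s Op by (cases j) (auto simp: ex_instr_def)
  next
    case (NGet x f v)
    then show ?thesis using assms unfolding s by (auto simp: sem_addr ex_instr_def algebra_simps)
  next
    case (NPut f v x)
    then show ?thesis using assms unfolding s
      by (auto simp: sem_addr ex_instr_def algebra_simps) presburger+
  next
    case (RGet x f v)
    then show ?thesis using assms unfolding s by (auto simp: sem_addr ex_instr_def algebra_simps)
  next
    case (RPut f v x)
    then show ?thesis using assms unfolding s
      by (auto simp: sem_addr ex_instr_def algebra_simps) presburger+
  qed
qed

lemma trans_sim:
  assumes "big ex_hop ev_hop c s t s'" "wf_com c" "rep B s m"
  shows "\<exists>t' m'. big ex_instr ev_cond (trans c) m t' m' \<and> t' \<le> 8 * t \<and> rep B s' m'"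
  using assms
proof (induction arbitrary: m rule: big.induct)
  case (Atom i s)
  have lf: "loop_free (impl i)" "cost (impl i) \<le> 8" by (cases i; simp add: addr_def)+
  then have "runs ex_instr ev_cond (impl i) m 8 (\<lambda>m'. m' = sem ex_instr ev_cond (impl i) m)"
    by (intro runs_loop_free) auto
  then obtain t' where "big ex_instr ev_cond (impl i) m t' (sem ex_instr ev_cond (impl i) m)" "t' \<le> 8"
    by (auto simp only: runs_def)
  moreover have "rep B (ex_hop i s) (sem ex_instr ev_cond (impl i) m)"
    using Atom by (intro rep_sem_impl) auto
  ultimately show ?case by (intro exI[of _ t'] exI[of _ "sem ex_instr ev_cond (impl i) m"]) simp
next
  case (Seq c1 s t1 s1 c2 t2 s2)
  then have wf: "wf_com c1" "wf_com c2" by simp_all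
  obtain u1 m1 where 1: "big ex_instr ev_cond (trans c1) m u1 m1" "u1 \<le> 8 * t1" "rep B s1 m1"
    using Seq.IH(1)[OF wf(1) Seq.prems(2)] by blast
  obtain u2 m2 where 2: "big ex_instr ev_cond (trans c2) m1 u2 m2" "u2 \<le> 8 * t2" "rep B s2 m2"
    using Seq.IH(2)[OF wf(2) 1(3)] by blast
  show ?case using big.Seq[OF 1(1) 2(1)] 1(2) 2 by (intro exI[of _ "u1 + u2"] exI[of _ m2]) simp
next
  case (IfT b s c1 t s1 c2)
  then have wf: "wf_com c1" by simp
  obtain u m1 where 1: "big ex_instr ev_cond (trans c1) m u m1" "u \<le> 8 * t" "rep B s1 m1"
    using IfT.IH[OF wf IfT.prems(2)] by blast
  have "ev_cond b m" using IfT.hyps IfT.prems by (cases m; cases s; cases b) auto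
  from big.IfT[of ev_cond, OF this 1(1)] 1 show ?case by (intro exI[of _ "u + 2"] exI[of _ m1]) simp
next
  case (IfF b s c2 t s1 c1)
  then have wf: "wf_com c2" by simp
  obtain u m1 where 1: "big ex_instr ev_cond (trans c2) m u m1" "u \<le> 8 * t" "rep B s1 m1"
    using IfF.IH[OF wf IfF.prems(2)] by blast
  have "\<not> ev_cond b m" using IfF.hyps IfF.prems by (cases m; cases s; cases b) auto
  from big.IfF[of ev_cond, OF this 1(1)] 1 show ?case by (intro exI[of _ "u + 2"] exI[of _ m1]) simp
next
  case (WhileT b s c t1 s1 t2 s2)
  then have wf: "wf_com c" by simp
  obtain u1 m1 where 1: "big ex_instr ev_cond (trans c) m u1 m1" "u1 \<le> 8 * t1" "rep B s1 m1"
    using WhileT.IH(1)[OF wf WhileT.prems(2)] by blast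
  obtain u2 m2 where 2: "big ex_instr ev_cond (trans (While b c)) m1 u2 m2" "u2 \<le> 8 * t2" "rep B s2 m2"
    using WhileT.IH(2)[OF WhileT.prems(1) 1(3)] by blast
  have "ev_cond b m" using WhileT.hyps WhileT.prems by (cases m; cases s; cases b) auto
  from big.WhileT[of ev_cond, OF this 1(1) 2(1)[unfolded trans.simps]] 1 2
  show ?case by (intro exI[of _ "u1 + u2 + 2"] exI[of _ m2]) simp
next
  case (WhileF b s c)
  have "\<not> ev_cond b m" using WhileF.hyps WhileF.prems by (cases m; cases s; cases b) auto
  from big.WhileF[of ev_cond, OF this] WhileF.prems show ?case by (intro exI[of _ 2] exI[of _ m]) simp
qed

text \<open>The input occupies the scalar real registers, so only \<open>R 0\<close> is used for moving it; the first
  round of the loop reads \<open>R 0\<close> before it is overwritten.\<close>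

definition prologue :: "(instr, cond) com" where
  "prologue = (Atom (NAdd 3 0 5) ;; Atom (NConst 4 1) ;; Atom (NConst 9 15) ;; Atom (NAdd 1 0 0) ;;
     Atom (NConst 2 32) ;; Atom (NAdd 0 1 2) ;; Atom (NAdd 8 0 5)) ;;
     While (NLess 6 3)
      (Atom (RLoad 0 7) ;; Atom (RStore 8 0) ;; Atom (NAdd 7 7 4) ;; Atom (NAdd 8 8 4) ;;
       Atom (RLoad 0 7) ;; Atom (RStore 8 0) ;; Atom (NAdd 7 7 4) ;; Atom (NAdd 8 8 9) ;; Atom (NAdd 6 6 4))"

text \<open>The number arrays are known to be zero from the initial state of the machine. Thus the
  table of visited sets, with its \<open>2 ^ n\<close> addresses, never has to be cleared.\<close>

definition init_amem :: "nat \<Rightarrow> (nat \<Rightarrow> real) \<Rightarrow> (nat \<Rightarrow> real) \<Rightarrow> amem \<Rightarrow> bool" where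
  "init_amem n a b s \<longleftrightarrow> (case s of (N, R, NA, RA) \<Rightarrow>
     N 3 = n \<and> (\<forall>f<16. \<forall>i. NA f i = 0) \<and> (\<forall>i<n. RA 0 i = a i \<and> RA 1 i = b i))"

lemma runs_prologue:
  "runs ex_instr ev_cond prologue (snd (init_state n a b)) (11 * n + 9)
    (\<lambda>m. \<exists>s. init_amem n a b s \<and> rep (2 * n + 32) s m)"
proof -
  define R0 where "R0 r = (if r < 2 * n then if even r then a (r div 2) else b (r div 2) else 0)" for r :: nat
  let ?B = "2 * n + 32"
  define Inv where "Inv i m \<longleftrightarrow> (case m of (N :: nat \<Rightarrow> nat, R) \<Rightarrow> i \<le> n \<and> N 0 = ?B \<and> N 3 = n \<and> N 4 = 1 \<and> N 9 = 15 \<and>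
     N 6 = i \<and> N 7 = 2 * i \<and> N 8 = ?B + 16 * i \<and> (\<forall>r\<ge>32. N r = 0) \<and>
     (\<forall>r<2 * n. 0 < r \<or> i = 0 \<longrightarrow> R r = R0 r) \<and>
     (\<forall>j<i. R (?B + 16 * j) = a j \<and> R (Suc (?B + 16 * j)) = b j))" for i m
  have R0: "R0 (2 * i) = a i" "R0 (Suc (2 * i)) = b i" if "i < n" for i
    using that by (simp_all add: R0_def)
  have "runs ex_instr ev_cond prologue (snd (init_state n a b)) (11 * n + 9) (Inv n)"
    unfolding prologue_def
  proof (rule runs_pre)
    show "runs ex_instr ev_cond (While (NLess 6 3)
      (Atom (RLoad 0 7) ;; Atom (RStore 8 0) ;; Atom (NAdd 7 7 4) ;; Atom (NAdd 8 8 4) ;;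
       Atom (RLoad 0 7) ;; Atom (RStore 8 0) ;; Atom (NAdd 7 7 4) ;; Atom (NAdd 8 8 9) ;; Atom (NAdd 6 6 4)))
      (sem ex_instr ev_cond (Atom (NAdd 3 0 5) ;; Atom (NConst 4 1) ;; Atom (NConst 9 15) ;;
        Atom (NAdd 1 0 0) ;; Atom (NConst 2 32) ;; Atom (NAdd 0 1 2) ;; Atom (NAdd 8 0 5)) (snd (init_state n a b)))
      (11 * n + 2) (Inv n)"
    proof (rule runs_for)
      fix i m assume inv: "Inv i m" and i: "i < n"
      obtain N R where m: "m = (N, R)" by (cases m)
      show "runs ex_instr ev_cond (Atom (RLoad 0 7) ;; Atom (RStore 8 0) ;; Atom (NAdd 7 7 4) ;; Atom (NAdd 8 8 4) ;;
       Atom (RLoad 0 7) ;; Atom (RStore 8 0) ;; Atom (NAdd 7 7 4) ;; Atom (NAdd 8 8 9) ;; Atom (NAdd 6 6 4)) m 9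
       (Inv (Suc i))"
      proof (rule runs_loop_free)
        have 1: "R (2 * i) = a i" "R (Suc (2 * i)) = b i"
          using inv i R0[OF i] by (cases "i = 0"; force simp: Inv_def m)+
        show "Inv (Suc i) (sem ex_instr ev_cond (Atom (RLoad 0 7) ;; Atom (RStore 8 0) ;; Atom (NAdd 7 7 4) ;; Atom (NAdd 8 8 4) ;;
          Atom (RLoad 0 7) ;; Atom (RStore 8 0) ;; Atom (NAdd 7 7 4) ;; Atom (NAdd 8 8 9) ;; Atom (NAdd 6 6 4)) m)"
          using inv i 1 by (auto simp: Inv_def m ex_instr_def less_Suc_eq)
      qed auto
    qed (auto simp: Inv_def init_state_def ex_instr_def R0_def)
  qed auto
  then show ?thesis
  proof (rule runs_mono)
    fix m assume inv: "Inv n m"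
    obtain N R where m: "m = (N, R)" by (cases m)
    show "\<exists>s. init_amem n a b s \<and> rep ?B s m"
      by (intro exI[of _ "(N, R, \<lambda>f i. N (?B + 16 * i + f), \<lambda>f i. R (?B + 16 * i + f))"])
        (use inv in \<open>auto simp: Inv_def init_amem_def m\<close>)
  qed simp
qed

text \<open>The output overwrites the scalar variables, so each of the registers \<open>31\<close>, \<dots>, \<open>0\<close> is
  filled last and serves as its own pointer; the base address in \<open>N 0\<close> goes last of all.\<close>

primrec low :: "nat \<Rightarrow> (instr, cond) com" where
  "low 0 = Atom (NLoad 0 0)"
| "low (Suc j) = Atom (NConst (Suc j) (16 * Suc j)) ;; Atom (NAdd (Suc j) (Suc j) 0) ;;
     Atom (NLoad (Suc j) (Suc j)) ;; low j"

lemma sem_low: "j < N 0 \<Longrightarrow> sem ex_instr ev_cond (low j) (N, R) =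
    (\<lambda>v. if v \<le> j then N (N 0 + 16 * v) else N v, R)"
proof (induction j arbitrary: N)
  case 0
  then show ?case by (auto simp: ex_instr_def fun_eq_iff)
next
  case (Suc j)
  let ?N = "N(Suc j := N (16 * Suc j + N 0))"
  have "sem ex_instr ev_cond (low (Suc j)) (N, R) = sem ex_instr ev_cond (low j) (?N, R)"
    by (simp add: ex_instr_def)
  also have "\<dots> = (\<lambda>v. if v \<le> j then ?N (?N 0 + 16 * v) else ?N v, R)"
    using Suc.prems by (intro Suc.IH) auto
  also have "\<dots> = (\<lambda>v. if v \<le> Suc j then N (N 0 + 16 * v) else N v, R)"
    using Suc.prems by (auto simp: fun_eq_iff le_Suc_eq add.commute)
  finally show ?case .
qed

lemma low_loop_free: "loop_free (low j)" "cost (low j) = 3 * j + 1"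
  by (induction j) auto

lemma low_straight: "all_atoms straight (low j)"
  by (induction j) auto

text \<open>512 is \<open>16 * 32\<close>, the offset of entry 32 of the output array. Entries from
  32 on go to registers between the scalar variables and the arrays, so the loop can still use its
  variables; \<open>low\<close> handles the rest.\<close>

definition epilogue :: "(instr, cond) com" where
  "epilogue = (Atom (NConst 4 1) ;; Atom (NConst 6 32) ;; Atom (NConst 7 512) ;; Atom (NAdd 7 7 0) ;;
     Atom (NConst 9 16)) ;;
     While (NLess 6 3) (Atom (NLoad 8 7) ;; Atom (NStore 6 8) ;; Atom (NAdd 6 6 4) ;; Atom (NAdd 7 7 9)) ;;
     low 31"

lemma runs_epilogue:
  assumes "rep B s m" "n \<le> B" "s = (hN, hR, NA, RA)" "hN 3 = n"
  shows "runs ex_instr ev_cond epilogue m (6 * n + 101) (\<lambda>(N, R). \<forall>j<n. N j = NA 0 j)"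
proof -
  define Inv where "Inv i m \<longleftrightarrow> (case m of (N, R :: nat \<Rightarrow> real) \<Rightarrow> i \<le> n - 32 \<and> N 0 = B \<and> N 3 = n \<and> N 4 = 1 \<and> N 9 = 16 \<and>
     N 6 = 32 + i \<and> N 7 = B + 16 * (32 + i) \<and> (\<forall>i. N (B + 16 * i) = NA 0 i) \<and>
     (\<forall>j<32 + i. 32 \<le> j \<longrightarrow> N j = NA 0 j))" for i m
  obtain N R where m: "m = (N, R)" by (cases m)
  have a0: "N (B + 16 * i) = NA 0 i" for i
    using assms by (auto simp: m dest: spec[of _ "0 :: nat"])
  have B: "32 \<le> B" using assms by (simp add: m)
  show ?thesis unfolding epilogue_def
  proof (rule runs_pre)
    show "runs ex_instr ev_cond (While (NLess 6 3) (Atom (NLoad 8 7) ;; Atom (NStore 6 8) ;; Atom (NAdd 6 6 4) ;; Atom (NAdd 7 7 9)) ;; low 31)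
      (sem ex_instr ev_cond (Atom (NConst 4 1) ;; Atom (NConst 6 32) ;; Atom (NConst 7 512) ;; Atom (NAdd 7 7 0) ;; Atom (NConst 9 16)) m)
      (6 * n + 96) (\<lambda>(N, R). \<forall>j<n. N j = NA 0 j)"
    proof (rule runs_seq)
      show "runs ex_instr ev_cond (While (NLess 6 3) (Atom (NLoad 8 7) ;; Atom (NStore 6 8) ;; Atom (NAdd 6 6 4) ;; Atom (NAdd 7 7 9)))
        (sem ex_instr ev_cond (Atom (NConst 4 1) ;; Atom (NConst 6 32) ;; Atom (NConst 7 512) ;; Atom (NAdd 7 7 0) ;; Atom (NConst 9 16)) m)
        (6 * n + 2) (Inv (n - 32))"
      proof (rule runs_for)
        fix i m assume inv: "Inv i m" and i: "i < n - 32"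
        obtain N R where m: "m = (N, R)" by (cases m)
        have "N (B + 16 * (32 + i)) = NA 0 (32 + i)" using inv by (simp add: Inv_def m del: distrib_left_numeral)
        then show "runs ex_instr ev_cond (Atom (NLoad 8 7) ;; Atom (NStore 6 8) ;; Atom (NAdd 6 6 4) ;; Atom (NAdd 7 7 9)) m 4 (Inv (Suc i))"
          using inv i assms(2) B
          by (intro runs_loop_free) (auto simp: Inv_def m ex_instr_def less_Suc_eq)
      qed (use assms B a0 in \<open>auto simp: Inv_def m ex_instr_def\<close>)
    next
      fix m assume inv: "Inv (n - 32) m"
      obtain N R where m: "m = (N, R)" by (cases m)
      show "runs ex_instr ev_cond (low 31) m 94 (\<lambda>(N, R). \<forall>j<n. N j = NA 0 j)"
        using inv B by (intro runs_loop_free) (auto simp: sem_low m Inv_def low_loop_free)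
    qed simp
  qed (use assms in auto)
qed

lemma straight_trans: "wf_com c \<Longrightarrow> all_atoms straight (trans c)"
proof (induction c)
  case (Atom i)
  then show ?case
  proof (cases i)
    case (Op j)
    then show ?thesis using Atom by (cases j) auto
  qed (auto simp: addr_def)
qed auto

text \<open>The overhead adds \<open>11 * n + 9\<close> for the prologue and
  \<open>6 * n + 101\<close> for the epilogue to the eightfold time of the array program.\<close>

theorem ex_program:
  assumes wf: "wf_com c"
    and c: "\<And>n k a b s. k > 0 \<Longrightarrow> card {i. i < n \<and> a i < 0} = k \<Longrightarrow> init_amem n a b s \<Longrightarrow>
      runs ex_hop ev_hop c s (T n k) (\<lambda>(N, R, NA, RA). N 3 = n \<and> (\<forall>\<sigma>. (\<forall>j<n. \<sigma> j = NA 0 j) \<longrightarrow> (\<forall>j\<ge>n. \<sigma> j = j) \<longrightarrow> P a b n \<sigma>))"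
    and T: "\<And>n k. 0 < k \<Longrightarrow> k \<le> n \<Longrightarrow> real (8 * T n k + 17 * n + 110) \<le> F n k"
  shows "\<exists>p. computes_within p P F"
proof -
  let ?c = "prologue ;; trans c ;; epilogue"
  have st: "all_atoms straight ?c"
    using straight_trans[OF wf] low_straight by (simp add: prologue_def epilogue_def)
  have "\<exists>t. real t \<le> F n k \<and> halted (comp ?c 0) (run (comp ?c 0) t (init_state n a b)) \<and>
      P a b n (output_perm n (run (comp ?c 0) t (init_state n a b)))"
    if k: "0 < k" "card {i. i < n \<and> a i < 0} = k" for n k a b
  proof -
    have "k \<le> card {..<n}" unfolding k(2)[symmetric] by (rule card_mono) auto
    then have kn: "k \<le> n" by simp
    obtain t1 m1 s where 1: "big ex_instr ev_cond prologue (snd (init_state n a b)) t1 m1" "t1 \<le> 11 * n + 9"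
      "init_amem n a b s" "rep (2 * n + 32) s m1"
      using runs_prologue[of n a b] unfolding runs_def by blast
    obtain t2 hN hR NA RA where 2: "big ex_hop ev_hop c s t2 (hN, hR, NA, RA)" "t2 \<le> T n k" "hN 3 = n"
      "\<And>\<sigma>. (\<forall>j<n. \<sigma> j = NA 0 j) \<Longrightarrow> (\<forall>j\<ge>n. \<sigma> j = j) \<Longrightarrow> P a b n \<sigma>"
      using c[OF k 1(3)] unfolding runs_def by auto
    obtain t3 m3 where 3: "big ex_instr ev_cond (trans c) m1 t3 m3" "t3 \<le> 8 * t2" "rep (2 * n + 32) (hN, hR, NA, RA) m3"
      using trans_sim[OF 2(1) wf 1(4)] by blast
    obtain t4 N R where 4: "big ex_instr ev_cond epilogue m3 t4 (N, R)" "t4 \<le> 6 * n + 101" "\<forall>j<n. N j = NA 0 j"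
      using runs_epilogue[OF 3(3) _ refl 2(3)] unfolding runs_def by auto
    have "big ex_instr ev_cond ?c (snd (init_state n a b)) (t1 + (t3 + t4)) (N, R)"
      using 1(1) 3(1) 4(1) by (intro big.Seq)
    from run_comp[OF this st, of "comp ?c 0" "[]" 0 "[]"] obtain t where t: "t \<le> t1 + (t3 + t4)"
      "run (comp ?c 0) t (init_state n a b) = (clen ?c, N, R)"
      by (auto simp: init_state_def)
    have "real t \<le> real (8 * T n k + 17 * n + 110)"
      using t(1) 1(2) 2(2) 3(2) 4(2) by linarith
    then have "real t \<le> F n k" using T[OF k(1) kn] by linarith
    moreover have "P a b n (output_perm n (clen ?c, N, R))"
      using 4(3) by (intro 2(4)) (auto simp: output_perm_def)
    moreover have "halted (comp ?c 0) (clen ?c, N, R)"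
      unfolding halted_def by (simp only: prod.case length_comp le_refl simp_thms)
    ultimately show ?thesis unfolding t(2)[symmetric] by blast
  qed
  then show ?thesis unfolding computes_within_def by blast
qed

section \<open>The program\<close>

text \<open>Scalar variables: \<open>3\<close> is \<open>n\<close>, \<open>4\<close> and \<open>5\<close> hold the constants \<open>1\<close> and \<open>0\<close>, \<open>6\<close> and \<open>7\<close> are
  loop counters, \<open>8\<close> and \<open>9\<close> codes of sets, \<open>10\<close> and \<open>11\<close> head and tail of the queue, \<open>16\<close> the
  number of increasing functions, and \<open>17\<close> is \<open>2 ^ n\<close>; the real variables \<open>0\<close>, \<open>1\<close>, \<open>7\<close>, \<open>8\<close> hold
  the constants \<open>0\<close>, \<open>1\<close>, \<open>3\<close>, \<open>2\<close>. Arrays of numbers: \<open>0\<close> output, \<open>1\<close> powers of two, \<open>2\<close> flags of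
  the decreasing functions, \<open>3\<close> positions in the cyclic order, \<open>4\<close> its inverse, \<open>5\<close> queue,
  \<open>6\<close> visited sets, \<open>7\<close> characteristic function of the current set, \<open>8\<close> and \<open>9\<close> choices. Real arrays:
  \<open>0\<close> and \<open>1\<close> input, \<open>2\<close> absolute slopes, \<open>3\<close> keys, \<open>4\<close> and \<open>5\<close> values. Adding variable \<open>5\<close>
  has no effect, which gives the instruction \<open>skip\<close>.\<close>

abbreviation skip :: "(hop, cond) com" where
  "skip \<equiv> Atom (Op (NAdd 6 6 5))"

definition tab :: "nat \<Rightarrow> (nat \<Rightarrow> real) \<Rightarrow> (nat \<Rightarrow> real) \<Rightarrow> (nat \<Rightarrow> nat \<Rightarrow> nat) \<Rightarrow> (nat \<Rightarrow> nat \<Rightarrow> real) \<Rightarrow> bool" where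
  "tab n a b NA RA \<longleftrightarrow> (\<forall>i<n. NA 1 i = 2 ^ i \<and> NA 2 i = (if a i < 0 then 1 else 0) \<and>
     RA 0 i = a i \<and> RA 1 i = b i \<and> RA 2 i = \<bar>a i\<bar> \<and> RA 3 i = key (a i) (b i))"

section \<open>Computing the powers of two and the keys\<close>

definition init_code :: "(hop, cond) com" where
  "init_code = Atom (Op (NConst 4 1)) ;; Atom (Op (NConst 5 0)) ;; Atom (Op (NConst 16 0)) ;;
     Atom (Op (RConst 0 0)) ;; Atom (Op (RConst 1 1)) ;; Atom (Op (RConst 7 3)) ;; Atom (Op (RConst 8 2)) ;;
     Atom (Op (NConst 6 0)) ;; Atom (Op (NConst 17 1))"

definition key_body :: "(hop, cond) com" where
  "key_body = Atom (NPut 1 6 17) ;; Atom (Op (NAdd 17 17 17)) ;; Atom (RGet 2 0 6) ;; Atom (RGet 3 1 6) ;;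
     If (RLess 2 0) (Atom (NPut 2 6 4) ;; Atom (Op (RSub 4 0 2)) ;; Atom (RPut 2 6 4))
       (Atom (NPut 2 6 5) ;; Atom (RPut 2 6 2)) ;;
     Atom (Op (RSub 4 1 2)) ;; Atom (Op (RSub 5 0 3)) ;; Atom (Op (RDiv 5 5 4)) ;;
     If (RLess 5 0) (Atom (Op (RSub 6 0 5))) (Atom (Op (RAdd 6 5 0))) ;;
     Atom (Op (RAdd 6 1 6)) ;; Atom (Op (RDiv 6 5 6)) ;;
     If (RLess 2 1) (Atom (Op (RAdd 6 1 6))) (If (RLess 1 2) (Atom (Op (RAdd 6 7 6)))
       (If (RLess 3 0) (Atom (Op (RAdd 6 8 0))) (Atom (Op (RAdd 6 0 0))))) ;;
     Atom (RPut 3 6 6) ;; Atom (Op (NAdd 6 6 4))"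

definition key_code :: "(hop, cond) com" where
  "key_code = init_code ;; While (NLess 6 3) key_body"

definition base :: "nat \<Rightarrow> (nat \<Rightarrow> nat) \<Rightarrow> (nat \<Rightarrow> real) \<Rightarrow> bool" where
  "base n N R \<longleftrightarrow> N 3 = n \<and> N 4 = 1 \<and> N 5 = 0 \<and> R 0 = 0"

definition post1 :: "nat \<Rightarrow> (nat \<Rightarrow> real) \<Rightarrow> (nat \<Rightarrow> real) \<Rightarrow> amem \<Rightarrow> bool" where
  "post1 n a b s \<longleftrightarrow> (case s of (N, R, NA, RA) \<Rightarrow> base n N R \<and> N 16 = 0 \<and> N 17 = 2 ^ n \<and> tab n a b NA RA \<and>
     NA 5 = (\<lambda>_. 0) \<and> NA 6 = (\<lambda>_. 0))"

lemma runs_key: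
  assumes "init_amem n a b s"
  shows "runs ex_hop ev_hop key_code s (42 * n + 11) (post1 n a b)"
proof -
  define Inv where "Inv i s \<longleftrightarrow> (case s of (N, R, NA, RA) \<Rightarrow> base n N R \<and> N 16 = 0 \<and> N 17 = 2 ^ i \<and> N 6 = i \<and> i \<le> n \<and>
     R 1 = 1 \<and> R 7 = 3 \<and> R 8 = 2 \<and> tab i a b NA RA \<and> (\<forall>j<n. RA 0 j = a j \<and> RA 1 j = b j) \<and>
     NA 5 = (\<lambda>_. 0) \<and> NA 6 = (\<lambda>_. 0))" for i s
  obtain N R NA RA where s: "s = (N, R, NA, RA)" by (metis prod.exhaust)
  have "runs ex_hop ev_hop key_code s (42 * n + 11) (Inv n)"
    unfolding key_code_def
  proof (rule runs_pre)
    show "runs ex_hop ev_hop (While (NLess 6 3) key_body) (sem ex_hop ev_hop init_code s) (42 * n + 2) (Inv n)"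
    proof (rule runs_for)
      show "Inv 0 (sem ex_hop ev_hop init_code s)"
        using assms by (auto simp: s Inv_def base_def tab_def init_code_def init_amem_def ex_instr_def)
    next
      fix i s assume inv: "Inv i s" and i: "i < n"
      obtain N R NA RA where s: "s = (N, R, NA, RA)" by (metis prod.exhaust)
      have sq: "squash x = x / (if x < 0 then 1 - x else 1 + x)" for x
        by (simp add: squash_def)
      show "runs ex_hop ev_hop key_body s 40 (Inv (Suc i))"
      proof (rule runs_loop_free)
        show "Inv (Suc i) (sem ex_hop ev_hop key_body s)"
          using inv i unfolding s Inv_def
          by (simp add: key_body_def ex_instr_def base_def)
             (auto simp: tab_def key_def sq less_Suc_eq)
      qed (simp_all add: key_body_def)
    qed (auto simp: Inv_def base_def)
  qed (simp_all add: init_code_def)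
  then show ?thesis
    by (rule runs_mono) (auto simp: Inv_def post1_def)
qed

section \<open>Ranking by counting, and the table of cyclic neighbours\<close>

definition pos_body :: "(hop, cond) com" where
  "pos_body = Atom (NGet 14 2 7) ;;
     If (NLess 14 4)
       (Atom (RGet 4 3 7) ;; Atom (RGet 5 3 6) ;;
        If (RLess 4 5) (Atom (Op (NAdd 15 15 4)))
          (If (RLess 5 4) skip (If (NLess 7 6) (Atom (Op (NAdd 15 15 4))) skip))) skip ;;
     Atom (Op (NAdd 7 7 4))"

definition pos_init :: "(hop, cond) com" where
  "pos_init = Atom (Op (NConst 15 1)) ;; Atom (Op (NConst 7 0))"

definition pos_store :: "(hop, cond) com" where
  "pos_store = Atom (NPut 3 6 15) ;; Atom (NGet 14 2 6) ;;
     If (NLess 14 4) (Atom (NPut 4 15 6) ;; Atom (Op (NAdd 16 16 4))) skip ;; Atom (Op (NAdd 6 6 4))"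

text \<open>The entries 0 and \<open>card (inc a n) + 1\<close> of the inverse table become copies
  of the last and the first element. Both neighbours can then be read at the position minus and plus
  1, without a case distinction at the ends.\<close>

definition pos_wrap :: "(hop, cond) com" where
  "pos_wrap = Atom (NGet 14 4 16) ;; Atom (NPut 4 5 14) ;; Atom (NGet 14 4 4) ;;
     Atom (Op (NAdd 15 16 4)) ;; Atom (NPut 4 15 14)"

definition pos_code :: "(hop, cond) com" where
  "pos_code = Atom (Op (NConst 6 0)) ;;
     While (NLess 6 3) (pos_init ;; While (NLess 7 3) pos_body ;; pos_store) ;; pos_wrap"

definition ordtab :: "nat \<Rightarrow> (nat \<Rightarrow> real) \<Rightarrow> (nat \<Rightarrow> real) \<Rightarrow> (nat \<Rightarrow> nat \<Rightarrow> nat) \<Rightarrow> bool" where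
  "ordtab n a b NA \<longleftrightarrow> (\<forall>i\<in>inc a n. NA 3 i = posn a b n i \<and>
     (\<forall>j\<in>inc a n. (cadj (card (inc a n)) (posn a b n j) (posn a b n i) \<longleftrightarrow> j = NA 4 (posn a b n i - 1)) \<and>
        (cadj (card (inc a n)) (posn a b n i) (posn a b n j) \<longleftrightarrow> j = NA 4 (posn a b n i + 1))) \<and>
     NA 4 (posn a b n i - 1) \<in> inc a n \<and> NA 4 (posn a b n i + 1) \<in> inc a n)"

definition post2 :: "nat \<Rightarrow> (nat \<Rightarrow> real) \<Rightarrow> (nat \<Rightarrow> real) \<Rightarrow> amem \<Rightarrow> bool" where
  "post2 n a b s \<longleftrightarrow> (case s of (N, R, NA, RA) \<Rightarrow> base n N R \<and> N 17 = 2 ^ n \<and> tab n a b NA RA \<and>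
     ordtab n a b NA \<and> NA 5 = (\<lambda>_. 0) \<and> NA 6 = (\<lambda>_. 0))"

lemma ordtabI:
  assumes p: "\<And>i. i \<in> inc a n \<Longrightarrow> NA 3 i = posn a b n i"
    and o: "\<And>i. i \<in> inc a n \<Longrightarrow> NA 4 (posn a b n i) = i"
    and wrap: "NA 4 0 = NA 4 (card (inc a n))" "NA 4 (Suc (card (inc a n))) = NA 4 1"
  shows "ordtab n a b NA"
  unfolding ordtab_def
proof (intro ballI conjI)
  let ?I = "inc a n" and ?m = "card (inc a n)" and ?p = "posn a b n"
  have rng: "1 \<le> ?p i \<and> ?p i \<le> ?m" if "i \<in> ?I" for i
    using bij_posn[of a b n] that by (auto simp: bij_betw_def)
  have surj: "\<exists>i\<in>?I. ?p i = q" if "1 \<le> q" "q \<le> ?m" for q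
    using bij_posn[of a b n] that by (metis atLeastAtMost_iff bij_betw_iff_bijections)
  fix i assume i: "i \<in> ?I"
  show "NA 3 i = ?p i" using p i .
  have qu: "1 \<le> (if ?p i = 1 then ?m else ?p i - 1)" "(if ?p i = 1 then ?m else ?p i - 1) \<le> ?m"
    and qw: "1 \<le> (if ?p i = ?m then 1 else ?p i + 1)" "(if ?p i = ?m then 1 else ?p i + 1) \<le> ?m"
    using rng[OF i] by auto
  obtain u where u: "u \<in> ?I" "?p u = (if ?p i = 1 then ?m else ?p i - 1)"
    by (metis surj[of "if ?p i = 1 then ?m else ?p i - 1"] qu)
  obtain w where w: "w \<in> ?I" "?p w = (if ?p i = ?m then 1 else ?p i + 1)"
    by (metis surj[of "if ?p i = ?m then 1 else ?p i + 1"] qw)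
  have pu: "NA 4 (?p i - 1) = u" using o[OF u(1)] u(2) wrap(1) by (auto split: if_splits)
  have pw: "NA 4 (?p i + 1) = w" using o[OF w(1)] w(2) wrap(2) by (auto split: if_splits)
  show "NA 4 (?p i - 1) \<in> ?I" "NA 4 (?p i + 1) \<in> ?I" using pu pw u w by auto
  fix j assume j: "j \<in> ?I"
  have inj: "j = l \<longleftrightarrow> ?p j = ?p l" if "l \<in> ?I" for l using o j that by metis
  show "cadj ?m (?p j) (?p i) \<longleftrightarrow> j = NA 4 (?p i - 1)"
    unfolding pu inj[OF u(1)] u(2) using rng[OF i] rng[OF j] by (auto simp: cadj_def)
  show "cadj ?m (?p i) (?p j) \<longleftrightarrow> j = NA 4 (?p i + 1)"
    unfolding pw inj[OF w(1)] w(2) using rng[OF i] rng[OF j] by (auto simp: cadj_def)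
qed

lemma runs_pos:
  assumes "post1 n a b s"
  shows "runs ex_hop ev_hop pos_code s (n * (20 * n + 20) + 10) (post2 n a b)"
proof -
  let ?m = "\<lambda>i. card {j \<in> inc a n. j < i}"
  define Inv where "Inv i s \<longleftrightarrow> (case s of (N, R, NA, RA) \<Rightarrow> base n N R \<and> N 16 = ?m i \<and> N 17 = 2 ^ n \<and>
     N 6 = i \<and> i \<le> n \<and> tab n a b NA RA \<and> (\<forall>j<i. NA 3 j = posn a b n j) \<and>
     (\<forall>j\<in>inc a n. j < i \<longrightarrow> NA 4 (posn a b n j) = j) \<and> NA 5 = (\<lambda>_. 0) \<and> NA 6 = (\<lambda>_. 0))" for i s
  let ?c = "\<lambda>i j. card {l \<in> inc a n. l < j \<and> before a b l i}"
  define J where "J i j s \<longleftrightarrow> (case s of (N, R, NA, RA) \<Rightarrow> Inv i s \<and> i < n \<and> N 7 = j \<and> j \<le> n \<and> N 15 = Suc (?c i j))" for i j s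
  have c_Suc: "?c i (Suc j) = (if j \<in> inc a n \<and> before a b j i then Suc (?c i j) else ?c i j)" for i j
  proof -
    have "{l \<in> inc a n. l < Suc j \<and> before a b l i} = (if j \<in> inc a n \<and> before a b j i
      then insert j {l \<in> inc a n. l < j \<and> before a b l i} else {l \<in> inc a n. l < j \<and> before a b l i})"
      by (auto simp: less_Suc_eq)
    then show ?thesis by simp
  qed
  have m_Suc: "?m (Suc i) = (if i \<in> inc a n then Suc (?m i) else ?m i)" for i
  proof -
    have "{l \<in> inc a n. l < Suc i} = (if i \<in> inc a n
      then insert i {l \<in> inc a n. l < i} else {l \<in> inc a n. l < i})"
      by (auto simp: less_Suc_eq)
    then show ?thesis by simp
  qed
  have c_n: "Suc (?c i n) = posn a b n i" for i
    unfolding posn_def by (rule arg_cong[of _ _ "\<lambda>X. Suc (card X)"]) (auto simp: inc_def)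
  have inj: "posn a b n i = posn a b n j \<longleftrightarrow> i = j" if "i \<in> inc a n" "j \<in> inc a n" for i j
    using bij_posn[of a b n] that by (auto simp: bij_betw_def inj_on_def)
  show ?thesis unfolding pos_code_def
  proof (rule runs_pre)
    show "runs ex_hop ev_hop (While (NLess 6 3) (pos_init ;; While (NLess 7 3) pos_body ;; pos_store) ;; pos_wrap)
      (sem ex_hop ev_hop (Atom (Op (NConst 6 0))) s) (n * (20 * n + 20) + 9) (post2 n a b)"
    proof (rule runs_seq)
      show "runs ex_hop ev_hop (While (NLess 6 3) (pos_init ;; While (NLess 7 3) pos_body ;; pos_store))
        (sem ex_hop ev_hop (Atom (Op (NConst 6 0))) s) (n * (20 * n + 20) + 2) (Inv n)"
      proof (rule runs_for)
        show "Inv 0 (sem ex_hop ev_hop (Atom (Op (NConst 6 0))) s)"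
          using assms by (cases s) (auto simp: Inv_def post1_def base_def ex_instr_def)
      next
        fix i s assume inv: "Inv i s" and i: "i < n"
        show "runs ex_hop ev_hop (pos_init ;; While (NLess 7 3) pos_body ;; pos_store) s (20 * n + 18) (Inv (Suc i))"
        proof (rule runs_pre)
          show "runs ex_hop ev_hop (While (NLess 7 3) pos_body ;; pos_store) (sem ex_hop ev_hop pos_init s) (20 * n + 16) (Inv (Suc i))"
          proof (rule runs_seq)
            show "runs ex_hop ev_hop (While (NLess 7 3) pos_body) (sem ex_hop ev_hop pos_init s) (20 * n + 2) (J i n)"
            proof (rule runs_for)
              show "J i 0 (sem ex_hop ev_hop pos_init s)"
                using inv i by (cases s) (auto simp: J_def Inv_def base_def pos_init_def ex_instr_def)
            next
              fix j s assume inv: "J i j s" and j: "j < n"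
              obtain N R NA RA where s: "s = (N, R, NA, RA)" by (metis prod.exhaust)
              show "runs ex_hop ev_hop pos_body s 18 (J i (Suc j))"
              proof (rule runs_loop_free)
                have "NA 2 j = (if a j < 0 then 1 else 0)" "RA 3 j = key (a j) (b j)" "RA 3 i = key (a i) (b i)"
                  using inv j by (auto simp: J_def Inv_def tab_def s)
                then show "J i (Suc j) (sem ex_hop ev_hop pos_body s)"
                  using inv j unfolding s J_def Inv_def
                  by (simp add: pos_body_def ex_instr_def base_def c_Suc)
                    (auto simp: inc_def before_def)
              qed (simp_all add: pos_body_def)
            qed (auto simp: J_def Inv_def base_def)
          next
            fix s assume inv: "J i n s"
            obtain N R NA RA where s: "s = (N, R, NA, RA)" by (metis prod.exhaust)
            show "runs ex_hop ev_hop pos_store s 14 (Inv (Suc i))"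
            proof (rule runs_loop_free)
              have "NA 2 i = (if a i < 0 then 1 else 0)"
                using inv i by (auto simp: J_def Inv_def tab_def s)
              then show "Inv (Suc i) (sem ex_hop ev_hop pos_store s)"
                using inv i unfolding s J_def Inv_def
                by (simp add: pos_store_def ex_instr_def base_def m_Suc c_n)
                  (auto simp: inc_def tab_def less_Suc_eq inj)
            qed (simp_all add: pos_store_def)
          qed simp
        qed (simp_all add: pos_init_def)
      qed (auto simp: Inv_def base_def)
    next
      fix s assume inv: "Inv n s"
      obtain N R NA RA where s: "s = (N, R, NA, RA)" by (metis prod.exhaust)
      let ?NA = "case sem ex_hop ev_hop pos_wrap s of (N, R, NA, RA) \<Rightarrow> NA"
      have m: "?m n = card (inc a n)" by (rule arg_cong[of _ _ card]) (auto simp: inc_def)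
      have r: "1 \<le> posn a b n i \<and> posn a b n i \<le> card (inc a n)" if "i \<in> inc a n" for i
        using bij_posn[of a b n] that by (auto simp: bij_betw_def)
      show "runs ex_hop ev_hop pos_wrap s 7 (post2 n a b)"
      proof (rule runs_loop_free)
        have o: "ordtab n a b ?NA"
        proof (rule ordtabI)
          fix i assume i: "i \<in> inc a n"
          then have "i < n" by (simp add: inc_def)
          then show "?NA 3 i = posn a b n i" "?NA 4 (posn a b n i) = i"
            using inv i r[OF i] m by (auto simp: s Inv_def base_def pos_wrap_def ex_instr_def)
        qed (use inv m in \<open>auto simp: s Inv_def base_def pos_wrap_def ex_instr_def\<close>)
        show "post2 n a b (sem ex_hop ev_hop pos_wrap s)"
          using inv o by (auto simp: s Inv_def post2_def base_def pos_wrap_def ex_instr_def tab_def)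
      qed (simp_all add: pos_wrap_def)
    qed simp
  qed simp_all
qed

section \<open>Breadth-first search on bit masks\<close>

lemma set_encode_lessThan: "set_encode {..<n} = 2 ^ n - 1"
proof (induction n)
  case (Suc n)
  have "(2 :: nat) ^ n \<ge> 1" by simp
  then show ?case using Suc by (simp add: lessThan_Suc set_encode_insert)
qed simp

text \<open>Needed for decoding without division: the bits below \<open>i\<close> sum to less than
  \<open>2 ^ i\<close>, so a comparison with \<open>2 ^ i\<close> reveals bit \<open>i\<close> once
  the higher bits are subtracted.\<close>

lemma set_encode_less:
  assumes "A \<subseteq> {..<n}"
  shows "set_encode A < 2 ^ n"
proof -
  have "set_encode A \<le> set_encode {..<n}"
    unfolding set_encode_def using assms by (intro sum_mono2) auto
  also have "\<dots> < 2 ^ n" by (simp add: set_encode_lessThan)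
  finally show ?thesis .
qed

definition state_inv :: "nat \<Rightarrow> (nat \<Rightarrow> real) \<Rightarrow> (nat \<Rightarrow> real) \<Rightarrow> nat \<Rightarrow> nat \<Rightarrow> amem \<Rightarrow> bool" where
  "state_inv n a b h i s \<longleftrightarrow> (case s of (N, R, NA, RA) \<Rightarrow> base n N R \<and> N 17 = 2 ^ n \<and> tab n a b NA RA \<and>
     ordtab n a b NA \<and> N 10 = h \<and>
     bfs a b n h i (N 11) (NA 5) (NA 6) (\<lambda>e. RA (4 + e)) (\<lambda>e. NA (8 + e)))"

lemma tab_upd [simp]:
  "f \<noteq> 1 \<Longrightarrow> f \<noteq> 2 \<Longrightarrow> tab n a b (NA(f := g)) RA \<longleftrightarrow> tab n a b NA RA"
  "4 \<le> f' \<Longrightarrow> tab n a b NA (RA(f' := g')) \<longleftrightarrow> tab n a b NA RA"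
  by (simp_all add: tab_def)

lemma ordtab_upd [simp]: "f \<noteq> 3 \<Longrightarrow> f \<noteq> 4 \<Longrightarrow> ordtab n a b (NA(f := g)) \<longleftrightarrow> ordtab n a b NA"
  by (simp add: ordtab_def)

definition start_code :: "(hop, cond) com" where
  "start_code = Atom (NPut 6 5 4) ;; Atom (RPut 4 5 0) ;; Atom (RPut 5 5 0) ;;
     Atom (Op (NConst 10 0)) ;; Atom (Op (NConst 11 1))"

lemma start_inv:
  assumes "post2 n a b s"
  shows "state_inv n a b 0 0 (sem ex_hop ev_hop start_code s)"
proof -
  obtain N R NA RA where s: "s = (N, R, NA, RA)" by (metis prod.exhaust)
  show ?thesis
    using assms by (auto simp: s post2_def state_inv_def start_code_def ex_instr_def base_def
        less_2_cases_iff intro!: bfs_init[unfolded One_nat_def] split: if_splits)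
qed

definition pop_init :: "(hop, cond) com" where
  "pop_init = Atom (NGet 8 5 10) ;; Atom (Op (NAdd 9 8 5)) ;; Atom (Op (NConst 12 0)) ;; Atom (Op (NAdd 6 3 5))"

definition decode_body :: "(hop, cond) com" where
  "decode_body = Atom (Op (NSub 6 6 4)) ;; Atom (NGet 13 1 6) ;;
     If (NLess 9 13) (Atom (NPut 7 6 5))
       (Atom (Op (NSub 9 9 13)) ;; Atom (NPut 7 6 4) ;; Atom (NGet 14 2 6) ;;
        If (NLess 14 4) (Atom (Op (NConst 12 1))) skip)"

text \<open>Bits are read from \<open>n - 1\<close> downwards, and \<open>i\<close> is the last one
  read. Register 12 records whether a nondecreasing function was met, which separates the case of
  \<open>ok\<close> in which no arc exists yet.\<close>

definition decoded :: "nat \<Rightarrow> (nat \<Rightarrow> real) \<Rightarrow> nat \<Rightarrow> nat \<Rightarrow> amem \<Rightarrow> bool" where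
  "decoded n a h i s \<longleftrightarrow> (case s of (N, R, NA, RA) \<Rightarrow> h < N 11 \<and> N 8 = NA 5 h \<and>
     (\<forall>j<n. i \<le> j \<longrightarrow> NA 7 j = (if j \<in> set_decode (N 8) then 1 else 0)) \<and>
     N 12 = (if \<exists>j \<in> set_decode (N 8) \<inter> inc a n. i \<le> j then 1 else 0))"

lemma runs_decode:
  assumes s: "state_inv n a b h 0 s" "h < fst s 11"
  shows "runs ex_hop ev_hop (pop_init ;; While (NLess 5 6) decode_body) s (16 * n + 6)
    (\<lambda>s. state_inv n a b h 0 s \<and> decoded n a h 0 s)"
proof -
  define Inv where "Inv d s \<longleftrightarrow> state_inv n a b h 0 s \<and> decoded n a h (n - d) s \<and> d \<le> n \<and>
    (case s of (N, R, NA, RA) \<Rightarrow> N 6 = n - d \<and> N 9 = set_encode (set_decode (N 8) \<inter> {..<n - d}))" for d s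
  have "runs ex_hop ev_hop (pop_init ;; While (NLess 5 6) decode_body) s (16 * n + 6) (Inv n)"
  proof (rule runs_pre)
    show "runs ex_hop ev_hop (While (NLess 5 6) decode_body) (sem ex_hop ev_hop pop_init s) (16 * n + 2) (Inv n)"
    proof (rule runs_for)
      obtain N R NA RA where eq: "s = (N, R, NA, RA)" by (metis prod.exhaust)
      have "reach (inc a n) (posn a b n) n (set_decode (NA 5 h))"
        using s by (auto simp: eq state_inv_def intro: bfs.reach)
      then have sub: "set_decode (NA 5 h) \<subseteq> {..<n}" by (rule reach_subset)
      then have "set_decode (NA 5 h) \<inter> {..<n} = set_decode (NA 5 h)" by auto
      moreover have "\<not> (\<exists>j\<in>set_decode (NA 5 h) \<inter> inc a n. n \<le> j)" by (auto simp: inc_def)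
      ultimately show "Inv 0 (sem ex_hop ev_hop pop_init s)"
        using s by (auto simp: eq Inv_def pop_init_def state_inv_def decoded_def base_def ex_instr_def)
    next
      fix d s assume inv: "Inv d s" and d: "d < n"
      obtain N R NA RA where s: "s = (N, R, NA, RA)" by (metis prod.exhaust)
      define i where "i = n - Suc d"
      have i: "n - d = Suc i" "i < n" using d by (auto simp: i_def)
      let ?S = "set_decode (N 8)"
      have less: "set_encode (?S \<inter> {..<i}) < 2 ^ i" by (rule set_encode_less) simp
      have enc: "set_encode (?S \<inter> {..<Suc i}) = (if i \<in> ?S then 2 ^ i + set_encode (?S \<inter> {..<i}) else set_encode (?S \<inter> {..<i}))"
        by (simp add: lessThan_Suc Int_insert_right set_encode_insert)
      have t: "NA 1 i = 2 ^ i" "NA 2 i = (if a i < 0 then 1 else 0)"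
        using inv i by (auto simp: Inv_def s state_inv_def tab_def)
      have ge: "i \<le> j \<longleftrightarrow> j = i \<or> Suc i \<le> j" for j by auto
      have ex: "(\<exists>j\<in>?S \<inter> inc a n. i \<le> j) \<longleftrightarrow> (\<exists>j\<in>?S \<inter> inc a n. Suc i \<le> j) \<or> i \<in> ?S \<and> \<not> a i < 0"
        using i by (auto simp only: ge) (auto simp: inc_def)
      have "state_inv n a b h 0 (sem ex_hop ev_hop decode_body s)"
        using inv t by (simp add: Inv_def s state_inv_def decode_body_def base_def ex_instr_def)
      moreover have "decoded n a h i (sem ex_hop ev_hop decode_body s)"
      proof -
        have "h < N 11" "N 8 = NA 5 h" "N 4 = 1" "N 5 = 0" "N 6 = Suc i"
          and 7: "\<forall>j<n. Suc i \<le> j \<longrightarrow> NA 7 j = (if j \<in> ?S then 1 else 0)"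
          and 12: "N 12 = (if \<exists>j\<in>?S \<inter> inc a n. Suc i \<le> j then 1 else 0)"
          and 9: "N 9 = set_encode (?S \<inter> {..<Suc i})"
          using inv unfolding Inv_def i(1) s state_inv_def decoded_def base_def by auto
        then show ?thesis
          unfolding decoded_def ge using t less enc ex[unfolded ge] i 7
          by (cases "i \<in> ?S"; cases "a i < 0") (simp_all add: s decode_body_def ex_instr_def 9 12)
      qed
      moreover have "(case sem ex_hop ev_hop decode_body s of (N, R, NA, RA) \<Rightarrow> N 6 = i \<and>
          N 9 = set_encode (set_decode (N 8) \<inter> {..<i}))"
        using inv t less enc unfolding Inv_def i(1) s state_inv_def
        by (simp add: decode_body_def base_def ex_instr_def)
      ultimately have "Inv (Suc d) (sem ex_hop ev_hop decode_body s)"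
        using d unfolding Inv_def i_def by simp
      then show "runs ex_hop ev_hop decode_body s 14 (Inv (Suc d))"
        by (rule runs_loop_free[rotated]) (simp_all add: decode_body_def)
    qed (auto simp: Inv_def state_inv_def base_def)
  qed (simp_all add: pop_init_def)
  then show ?thesis by (rule runs_mono) (auto simp: Inv_def)
qed

text \<open>The test takes constant time: if there is an arc to extend, register 13 receives the sum
  of the membership flags of the two cyclic neighbours, positive exactly if one of them is
  present.\<close>

definition ok_code :: "(hop, cond) com" where
  "ok_code = Atom (Op (NConst 13 0)) ;; Atom (NGet 14 2 6) ;;
     If (NLess 5 14) (Atom (Op (NConst 13 1)))
       (If (NLess 12 4) (Atom (Op (NConst 13 1)))
         (Atom (NGet 15 3 6) ;; Atom (Op (NSub 7 15 4)) ;; Atom (NGet 7 4 7) ;; Atom (NGet 13 7 7) ;;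
          Atom (Op (NAdd 7 15 4)) ;; Atom (NGet 7 4 7) ;; Atom (NGet 7 7 7) ;; Atom (Op (NAdd 13 13 7))))"

lemma ok_code:
  assumes "state_inv n a b h i0 (N, R, NA, RA)" "decoded n a h 0 (N, R, NA, RA)" "N 6 = i" "i < n"
  shows "\<exists>N'. sem ex_hop ev_hop ok_code (N, R, NA, RA) = (N', R, NA, RA) \<and>
    (0 < N' 13 \<longleftrightarrow> ok (inc a n) (posn a b n) (set_decode (N 8)) i) \<and> N' 14 = (if a i < 0 then 1 else 0) \<and>
    (\<forall>v. v \<notin> {7, 13, 14, 15} \<longrightarrow> N' v = N v)"
proof -
  let ?S = "set_decode (N 8)" and ?p = "posn a b n i"
  have c: "N 4 = 1" "N 5 = 0" "NA 2 i = (if a i < 0 then 1 else 0)"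
    using assms by (auto simp: state_inv_def base_def tab_def)
  have S: "NA 7 j = (if j \<in> ?S then 1 else 0)" if "j \<in> inc a n" for j
    using assms that by (auto simp: decoded_def inc_def)
  have e: "N 12 = (if ?S \<inter> inc a n = {} then 0 else 1)" using assms by (auto simp: decoded_def)
  consider "a i < 0" | "\<not> a i < 0" "?S \<inter> inc a n = {}" | "\<not> a i < 0" "?S \<inter> inc a n \<noteq> {}" by blast
  then show ?thesis
  proof cases
    case 3
    then have i: "i \<in> inc a n" using assms by (simp add: inc_def)
    have o: "NA 3 i = ?p" "NA 4 (?p - 1) \<in> inc a n" "NA 4 (?p + 1) \<in> inc a n"
      "\<And>j. j \<in> inc a n \<Longrightarrow> cadj (card (inc a n)) (posn a b n j) ?p \<longleftrightarrow> j = NA 4 (?p - 1)"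
      "\<And>j. j \<in> inc a n \<Longrightarrow> cadj (card (inc a n)) ?p (posn a b n j) \<longleftrightarrow> j = NA 4 (?p + 1)"
      using assms i by (auto simp: state_inv_def ordtab_def)
    have "ok (inc a n) (posn a b n) ?S i \<longleftrightarrow> NA 4 (?p - 1) \<in> ?S \<or> NA 4 (?p + 1) \<in> ?S"
      using i 3 o by (auto simp: ok_def)
    then show ?thesis
      using 3 c e S[OF o(2)] S[OF o(3)] o(1) assms(3)
      by (auto simp: ok_code_def ex_instr_def)
  qed (use assms c e in \<open>auto simp: ok_code_def ex_instr_def ok_def inc_def\<close>)
qed

text \<open>Both modes are computed together; exchanging registers 2 and 3 realizes
  \<open>flip\<close> for a decreasing function.\<close>

definition cand_code :: "(hop, cond) com" where
  "cand_code = Atom (NGet 13 1 6) ;; Atom (Op (NAdd 9 8 13)) ;; Atom (RGet 2 4 8) ;; Atom (RGet 3 5 8) ;;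
     If (NLess 5 14) (Atom (Op (RAdd 4 2 0)) ;; Atom (Op (RAdd 2 3 0)) ;; Atom (Op (RAdd 3 4 0))) skip ;;
     Atom (RGet 4 2 6) ;; Atom (Op (RMul 2 4 2)) ;; Atom (Op (RMul 3 4 3)) ;; Atom (RGet 4 1 6) ;;
     Atom (Op (RAdd 2 2 4)) ;; Atom (Op (RSub 3 3 4)) ;; Atom (NGet 13 6 9)"

text \<open>At a first visit the table holds no candidate yet, so it is written without comparison.
  Later the two modes are compared separately, as their best last functions may differ.\<close>

definition update_code :: "(hop, cond) com" where
  "update_code = If (NLess 13 4)
       (Atom (NPut 6 9 4) ;; Atom (NPut 5 11 9) ;; Atom (Op (NAdd 11 11 4)) ;; Atom (RPut 4 9 2) ;;
        Atom (NPut 8 9 6) ;; Atom (RPut 5 9 3) ;; Atom (NPut 9 9 6))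
       (Atom (RGet 4 4 9) ;; If (RLess 2 4) (Atom (RPut 4 9 2) ;; Atom (NPut 8 9 6)) skip ;;
        Atom (RGet 4 5 9) ;; If (RLess 3 4) (Atom (RPut 5 9 3) ;; Atom (NPut 9 9 6)) skip)"

definition relax_code :: "(hop, cond) com" where
  "relax_code = cand_code ;; update_code"

lemma cand_code:
  assumes inv: "state_inv n a b h j (N, R, NA, RA)"
    and i: "N 6 = i" "i < n" "N 14 = (if a i < 0 then 1 else 0)"
  shows "\<exists>N' R'. sem ex_hop ev_hop cand_code (N, R, NA, RA) = (N', R', NA, RA) \<and> R' 0 = 0 \<and>
    R' 2 = cand a b (\<lambda>e. RA (4 + e) (N 8)) i 0 \<and> R' 3 = cand a b (\<lambda>e. RA (4 + e) (N 8)) i 1 \<and>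
    N' 9 = N 8 + 2 ^ i \<and> N' 13 = NA 6 (N 8 + 2 ^ i) \<and> (\<forall>v. v \<notin> {9, 13} \<longrightarrow> N' v = N v)"
proof -
  have c: "N 4 = 1" "N 5 = 0" "R 0 = 0" "NA 1 i = 2 ^ i" "RA 1 i = b i" "RA 2 i = \<bar>a i\<bar>"
    using inv i(2) by (auto simp: state_inv_def base_def tab_def)
  show ?thesis using c i
    by (cases "a i < 0") (simp_all add: cand_code_def ex_instr_def cand_def sg_def flip_def)
qed

lemma relax_code:
  assumes inv: "state_inv n a b h i (N, R, NA, RA)" "decoded n a h 0 (N, R, NA, RA)"
    and i: "N 6 = i" "i < n" "N 14 = (if a i < 0 then 1 else 0)"
    and new: "i \<notin> set_decode (N 8)" "ok (inc a n) (posn a b n) (set_decode (N 8)) i"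
  shows "\<exists>s'. sem ex_hop ev_hop relax_code (N, R, NA, RA) = s' \<and>
    state_inv n a b h (Suc i) s' \<and> decoded n a h 0 s' \<and> fst s' 6 = i"
proof -
  let ?x = "N 8" and ?c = "cand a b (\<lambda>e. RA (4 + e) (N 8)) i" and ?val = "\<lambda>e. RA (4 + e)" and ?ch = "\<lambda>e. NA (8 + e)"
  define y where "y = ?x + 2 ^ i"
  obtain N1 R1 where 1: "sem ex_hop ev_hop cand_code (N, R, NA, RA) = (N1, R1, NA, RA)" "R1 0 = 0"
    "R1 2 = ?c 0" "R1 3 = ?c 1" "N1 9 = y" "N1 13 = NA 6 y" "\<forall>v. v \<notin> {9, 13} \<longrightarrow> N1 v = N v"
    using cand_code[OF inv(1) i] unfolding y_def by blast
  have b: "base n N R" "N 17 = 2 ^ n" "tab n a b NA RA" "ordtab n a b NA" "N 10 = h"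
    and B: "bfs a b n h i (N 11) (NA 5) (NA 6) ?val ?ch"
    using inv(1) by (simp_all add: state_inv_def)
  have x: "?x = NA 5 h" "h < N 11" using inv by (auto simp: decoded_def)
  have new': "i \<notin> set_decode (NA 5 h)" "ok (inc a n) (posn a b n) (set_decode (NA 5 h)) i" "y = NA 5 h + 2 ^ i"
    using new x by (simp_all add: y_def)
  have N1: "N1 3 = n" "N1 4 = 1" "N1 5 = 0" "N1 6 = i" "N1 8 = N 8" "N1 10 = h" "N1 11 = N 11" "N1 12 = N 12" "N1 17 = 2 ^ n"
    using 1(7) b i by (simp_all add: base_def)
  show ?thesis
  proof (cases "NA 6 y = 0")
    case True
    define NA' where "NA' = NA(6 := (NA 6)(y := 1), 5 := (NA 5)(N 11 := y), 8 := (NA 8)(y := i), 9 := (NA 9)(y := i))"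
    define RA' where "RA' = RA(4 := (RA 4)(y := ?c 0), 5 := (RA 5)(y := ?c 1))"
    have "sem ex_hop ev_hop relax_code (N, R, NA, RA) = (N1(11 := Suc (N 11)), R1, NA', RA')"
      using True by (simp add: relax_code_def 1 update_code_def N1 ex_instr_def NA'_def RA'_def)
    moreover have "bfs a b n h (Suc i) (Suc (N 11)) (NA' 5) (NA' 6) (\<lambda>e. RA' (4 + e)) (\<lambda>e. NA' (8 + e))"
    proof (rule bfs_step[OF B x(2) i(2) new'])
      show "NA' 5 = (if NA 6 y = 0 then (NA 5)(N 11 := y) else NA 5)"
        "NA' 6 = (if NA 6 y = 0 then (NA 6)(y := 1) else NA 6)" "Suc (N 11) = (if NA 6 y = 0 then Suc (N 11) else N 11)"
        using True by (simp_all add: NA'_def)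
      fix e :: nat assume e: "e < 2"
      show "RA' (4 + e) z = RA (4 + e) z" "NA' (8 + e) z = NA (8 + e) z" if "z \<noteq> y" for z
        using that e by (auto simp: RA'_def NA'_def less_2_cases_iff)
      show "RA' (4 + e) y \<le> cand a b (\<lambda>e. RA (4 + e) (NA 5 h)) i e"
        "RA' (4 + e) y = cand a b (\<lambda>e. RA (4 + e) (NA 5 h)) i e \<and> NA' (8 + e) y = i \<or>
         NA 6 y \<noteq> 0 \<and> RA' (4 + e) y = RA (4 + e) y \<and> NA' (8 + e) y = NA (8 + e) y"
        using e unfolding x(1)[symmetric] by (auto simp: RA'_def NA'_def less_2_cases_iff)
    qed (use True in simp)
    ultimately show ?thesis
      using inv(2) b x 1(2) N1 by (auto simp: state_inv_def decoded_def base_def NA'_def RA'_def)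
  next
    case False
    define RA' where "RA' = RA(4 := if ?c 0 < RA 4 y then (RA 4)(y := ?c 0) else RA 4,
      5 := if ?c 1 < RA 5 y then (RA 5)(y := ?c 1) else RA 5)"
    define NA' where "NA' = NA(8 := if ?c 0 < RA 4 y then (NA 8)(y := i) else NA 8,
      9 := if ?c 1 < RA 5 y then (NA 9)(y := i) else NA 9)"
    have "sem ex_hop ev_hop relax_code (N, R, NA, RA) = (N1, R1(4 := RA 5 y), NA', RA')"
      using False N1 1(2) fun_upd_idem[of N1 6, OF N1(4)]
      by (cases "?c 0 < RA 4 y"; cases "?c 1 < RA 5 y";
        simp add: relax_code_def 1(1,3-6) update_code_def ex_instr_def NA'_def RA'_def; simp add: fun_eq_iff)
    moreover have "bfs a b n h (Suc i) (N 11) (NA' 5) (NA' 6) (\<lambda>e. RA' (4 + e)) (\<lambda>e. NA' (8 + e))"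
    proof (rule bfs_step[OF B x(2) i(2) new'])
      show "NA' 5 = (if NA 6 y = 0 then (NA 5)(N 11 := y) else NA 5)"
        "NA' 6 = (if NA 6 y = 0 then (NA 6)(y := 1) else NA 6)" "N 11 = (if NA 6 y = 0 then Suc (N 11) else N 11)"
        using False by (simp_all add: NA'_def)
      fix e :: nat assume e: "e < 2"
      show "RA' (4 + e) z = RA (4 + e) z" "NA' (8 + e) z = NA (8 + e) z" if "z \<noteq> y" for z
        using that e by (auto simp: RA'_def NA'_def less_2_cases_iff)
      show "RA' (4 + e) y \<le> cand a b (\<lambda>e. RA (4 + e) (NA 5 h)) i e" "RA' (4 + e) y \<le> RA (4 + e) y"
        "RA' (4 + e) y = cand a b (\<lambda>e. RA (4 + e) (NA 5 h)) i e \<and> NA' (8 + e) y = i \<or>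
         NA 6 y \<noteq> 0 \<and> RA' (4 + e) y = RA (4 + e) y \<and> NA' (8 + e) y = NA (8 + e) y"
        using e False unfolding x(1)[symmetric] by (auto simp: RA'_def NA'_def less_2_cases_iff)
    qed
    ultimately show ?thesis
      using inv(2) b x 1(2) N1 by (auto simp: state_inv_def decoded_def base_def NA'_def RA'_def)
  qed
qed

definition visit_body :: "(hop, cond) com" where
  "visit_body = Atom (NGet 14 7 6) ;; If (NLess 14 4) (ok_code ;; If (NLess 5 13) relax_code skip) skip ;;
     Atom (Op (NAdd 6 6 4))"

lemma state_inv_upd:
  assumes "state_inv n a b h i (N, R, NA, RA)" "\<forall>v. v \<notin> {6, 7, 13, 14, 15} \<longrightarrow> N' v = N v"
  shows "state_inv n a b h i (N', R, NA, RA)"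
  using assms by (simp add: state_inv_def base_def)

lemma decoded_upd:
  assumes "decoded n a h i (N, R, NA, RA)" "\<forall>v. v \<notin> {6, 7, 13, 14, 15} \<longrightarrow> N' v = N v"
  shows "decoded n a h i (N', R, NA, RA)"
  using assms by (simp add: decoded_def)

lemma visit_step:
  assumes inv: "state_inv n a b h i s" "decoded n a h 0 s" "fst s 6 = i" "i < n"
    and s': "s' = sem ex_hop ev_hop visit_body s"
  shows "state_inv n a b h (Suc i) s' \<and> decoded n a h 0 s' \<and> fst s' 6 = Suc i"
proof -
  obtain N R NA RA where s: "s = (N, R, NA, RA)" by (metis prod.exhaust)
  let ?S = "set_decode (N 8)"
  let ?end = "\<lambda>s. sem ex_hop ev_hop (Atom (Op (NAdd 6 6 4))) s"
  have c: "N 4 = 1" "N 5 = 0" using inv by (auto simp: s state_inv_def base_def)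
  have in_S: "NA 7 i = (if i \<in> ?S then 1 else 0)" using inv by (auto simp: s decoded_def)
  have x: "N 8 = NA 5 h" "h < N 11" using inv by (auto simp: s decoded_def)
  have fin: "state_inv n a b h (Suc i) (?end s1) \<and> decoded n a h 0 (?end s1) \<and> fst (?end s1) 6 = Suc i"
    if s1: "state_inv n a b h (Suc i) s1" "decoded n a h 0 s1" "fst s1 6 = i" for s1
  proof -
    obtain N1 R1 NA1 RA1 where eq: "s1 = (N1, R1, NA1, RA1)" by (metis prod.exhaust)
    have "N1 4 = 1" using s1 by (simp add: eq state_inv_def base_def)
    then show ?thesis
      using s1 state_inv_upd[of n a b h "Suc i" N1 R1 NA1 RA1 "N1(6 := Suc i)"]
        decoded_upd[of n a h 0 N1 R1 NA1 RA1 "N1(6 := Suc i)"]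
      by (simp add: eq ex_instr_def)
  qed
  have skip: "state_inv n a b h (Suc i) (N, R, NA, RA)"
    if "i \<in> ?S \<or> \<not> ok (inc a n) (posn a b n) ?S i"
    using inv that x by (auto simp: s state_inv_def intro: bfs_skip)
  let ?N = "N(14 := NA 7 i)"
  have inv': "state_inv n a b h i (?N, R, NA, RA)" "decoded n a h 0 (?N, R, NA, RA)"
    using inv state_inv_upd[of n a b h i N R NA RA ?N] decoded_upd[of n a h 0 N R NA RA ?N] by (simp_all add: s)
  show ?thesis
  proof (cases "i \<in> ?S")
    case True
    have "s' = ?end (?N, R, NA, RA)"
      using s' inv(3) c in_S True by (simp add: s visit_body_def ex_instr_def fun_upd_idem)
    then show ?thesis
      using fin[of "(?N, R, NA, RA)"] skip True inv inv' state_inv_upd[of n a b h "Suc i" N R NA RA ?N] by (simp add: s)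
  next
    case False
    obtain N' where N': "sem ex_hop ev_hop ok_code (?N, R, NA, RA) = (N', R, NA, RA)"
      "0 < N' 13 \<longleftrightarrow> ok (inc a n) (posn a b n) ?S i" "N' 14 = (if a i < 0 then 1 else 0)"
      "\<forall>v. v \<notin> {7, 13, 14, 15} \<longrightarrow> N' v = ?N v"
      using ok_code[OF inv', of i] inv(3,4) by (auto simp: s)
    have up: "\<forall>v. v \<notin> {6, 7, 13, 14, 15} \<longrightarrow> N' v = N v" using N'(4) by simp
    have N6: "N' 6 = i" "N' 5 = 0" "N' 8 = N 8" using N'(4) inv(3) c by (simp_all add: s)
    have inv'': "state_inv n a b h i (N', R, NA, RA)" "decoded n a h 0 (N', R, NA, RA)"
      using inv state_inv_upd[OF _ up] decoded_upd[OF _ up] by (simp_all add: s)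
    show ?thesis
    proof (cases "ok (inc a n) (posn a b n) ?S i")
      case True
      have "s' = ?end (sem ex_hop ev_hop relax_code (N', R, NA, RA))"
        using s' inv(3) c in_S False True N' N6 by (simp add: s visit_body_def ex_instr_def)
      then show ?thesis
        using fin relax_code[OF inv'' N6(1) inv(4) N'(3)] False True N6(3) by auto
    next
      case no: False
      have "s' = ?end (N', R, NA, RA)"
        using s' inv(3) c in_S False no N' N6 by (simp add: s visit_body_def ex_instr_def fun_upd_idem)
      then show ?thesis
        using fin[of "(N', R, NA, RA)"] state_inv_upd[OF skip up] no inv'' N6 by simp
    qed
  qed
qed

lemma visit_body_loop_free: "loop_free visit_body" "cost visit_body \<le> 78"
  by (simp_all add: visit_body_def ok_code_def relax_code_def cand_code_def update_code_def)

definition search_body :: "(hop, cond) com" where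
  "search_body = (pop_init ;; While (NLess 5 6) decode_body) ;; Atom (Op (NConst 6 0)) ;;
     While (NLess 6 3) visit_body ;; Atom (Op (NAdd 10 10 4))"

lemma runs_search_body:
  assumes "state_inv n a b h 0 s" "h < fst s 11"
  shows "runs ex_hop ev_hop search_body s (96 * n + 10) (state_inv n a b (Suc h) 0)"
  unfolding search_body_def
proof (rule runs_seq[OF runs_decode[OF assms]])
  fix s assume inv: "state_inv n a b h 0 s \<and> decoded n a h 0 s"
  define Inv where "Inv i s \<longleftrightarrow> state_inv n a b h i s \<and> decoded n a h 0 s \<and> fst s 6 = i \<and> i \<le> n" for i s
  obtain N R NA RA where s: "s = (N, R, NA, RA)" by (metis prod.exhaust)
  show "runs ex_hop ev_hop (Atom (Op (NConst 6 0)) ;; While (NLess 6 3) visit_body ;; Atom (Op (NAdd 10 10 4))) s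
    (80 * n + 4) (state_inv n a b (Suc h) 0)"
  proof (rule runs_pre)
    show "runs ex_hop ev_hop (While (NLess 6 3) visit_body ;; Atom (Op (NAdd 10 10 4)))
      (sem ex_hop ev_hop (Atom (Op (NConst 6 0))) s) (80 * n + 3) (state_inv n a b (Suc h) 0)"
    proof (rule runs_seq)
      show "runs ex_hop ev_hop (While (NLess 6 3) visit_body)
        (sem ex_hop ev_hop (Atom (Op (NConst 6 0))) s) (80 * n + 2) (Inv n)"
      proof (rule runs_for)
        show "Inv 0 (sem ex_hop ev_hop (Atom (Op (NConst 6 0))) s)"
          using inv state_inv_upd[of n a b h 0 N R NA RA "N(6 := 0)"] decoded_upd[of n a h 0 N R NA RA "N(6 := 0)"]
          by (simp add: s Inv_def ex_instr_def)
      next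
        fix i s assume "Inv i s" "i < n"
        then show "runs ex_hop ev_hop visit_body s 78 (Inv (Suc i))"
          using visit_step[of n a b h i s] visit_body_loop_free
          by (intro runs_loop_free) (auto simp: Inv_def)
      qed (auto simp: Inv_def state_inv_def base_def)
    next
      fix s assume inv: "Inv n s"
      obtain N R NA RA where s: "s = (N, R, NA, RA)" by (metis prod.exhaust)
      have "bfs a b n (Suc h) 0 (N 11) (NA 5) (NA 6) (\<lambda>e. RA (4 + e)) (\<lambda>e. NA (8 + e))"
        using inv by (intro bfs_next) (auto simp: Inv_def s state_inv_def decoded_def)
      then show "runs ex_hop ev_hop (Atom (Op (NAdd 10 10 4))) s 1 (state_inv n a b (Suc h) 0)"
        using inv by (intro runs_loop_free) (auto simp: Inv_def s state_inv_def base_def ex_instr_def)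
    qed simp
  qed simp_all
qed simp

definition search_code :: "(hop, cond) com" where
  "search_code = start_code ;; While (NLess 10 11) search_body"

definition sets_bound :: "nat \<Rightarrow> nat \<Rightarrow> nat" where
  "sets_bound n k = 2 ^ k * (n * (n + 1) + 1)"

text \<open>The invariant is indexed by the queue head. It stays below the tail, and the tail counts
  distinct reachable sets, so their number bounds the rounds although the queue grows during the
  loop.\<close>

lemma runs_search:
  assumes s: "post2 n a b s" and k: "card {i. i < n \<and> a i < 0} = k"
  shows "runs ex_hop ev_hop search_code s (sets_bound n k * (96 * n + 12) + 7)
    (\<lambda>s. state_inv n a b (fst s 11) 0 s)"
  unfolding search_code_def
proof (rule runs_pre)
  have "runs ex_hop ev_hop (While (NLess 10 11) search_body) (sem ex_hop ev_hop start_code s)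
      ((sets_bound n k - 0) * (96 * n + 10 + 2) + 2)
      (\<lambda>s. \<exists>h. state_inv n a b h 0 s \<and> \<not> ev_hop (NLess 10 11) s)"
  proof (rule runs_while)
    fix h s assume inv: "state_inv n a b h 0 s" and ev: "ev_hop (NLess 10 11) s"
    obtain N R NA RA where s: "s = (N, R, NA, RA)" by (metis prod.exhaust)
    have h: "h < N 11" using inv ev by (simp add: s state_inv_def)
    also have "N 11 \<le> sets_bound n k"
    proof -
      have "bfs a b n h 0 (N 11) (NA 5) (NA 6) (\<lambda>e. RA (4 + e)) (\<lambda>e. NA (8 + e))"
        using inv by (simp add: s state_inv_def)
      from bfs_length[OF this k] show ?thesis by (simp only: sets_bound_def)
    qed
    finally show "h < sets_bound n k \<and> runs ex_hop ev_hop search_body s (96 * n + 10) (state_inv n a b (Suc h) 0)"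
      using runs_search_body[OF inv] h by (simp add: s)
  qed (use start_inv[OF s] in auto)
  then show "runs ex_hop ev_hop (While (NLess 10 11) search_body) (sem ex_hop ev_hop start_code s)
      (sets_bound n k * (96 * n + 12) + 2) (\<lambda>s. state_inv n a b (fst s 11) 0 s)"
  proof (rule runs_mono)
    fix s assume "\<exists>h. state_inv n a b h 0 s \<and> \<not> ev_hop (NLess 10 11) s"
    then obtain h where h: "state_inv n a b h 0 s" "\<not> ev_hop (NLess 10 11) s" by blast
    obtain N R NA RA where s: "s = (N, R, NA, RA)" by (metis prod.exhaust)
    have "h = N 11" using h bfs.h_le[of a b n h 0 "N 11"] by (force simp: s state_inv_def)
    then show "state_inv n a b (fst s 11) 0 s" using h by (simp add: s)
  qed simp
qed (simp_all add: start_code_def)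

section \<open>Reading off an optimal order\<close>

definition trace_body :: "(hop, cond) com" where
  "trace_body = Atom (Op (NSub 7 7 4)) ;; If (NLess 5 18) (Atom (NGet 6 9 8)) (Atom (NGet 6 8 8)) ;;
     Atom (NPut 0 7 6) ;; Atom (NGet 13 1 6) ;; Atom (Op (NSub 8 8 13)) ;; Atom (NGet 14 2 6) ;;
     If (NLess 5 14) (Atom (Op (NSub 18 4 18))) skip"

definition trace_code :: "nat \<Rightarrow> (hop, cond) com" where
  "trace_code m = (Atom (Op (NSub 8 17 4)) ;; Atom (Op (NConst 18 m)) ;; Atom (Op (NAdd 7 3 5))) ;;
     While (NLess 5 7) trace_body"

lemma runs_trace:
  assumes s: "state_inv n a b (fst s 11) 0 s" and m: "m < 2"
  shows "runs ex_hop ev_hop (trace_code m) s (16 * n + 5)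
    (\<lambda>(N, R, NA, RA). N 3 = n \<and> optl (sg m) a b n (map (NA 0) [0..<n]))"
proof -
  define t where "t = fst s 11"
  define Inv where "Inv d s \<longleftrightarrow> (case s of (N, R, NA, RA) \<Rightarrow> d \<le> n \<and> base n N R \<and> tab n a b NA RA \<and> N 7 = n - d \<and>
     bfs a b n t 0 t (NA 5) (NA 6) (\<lambda>e. RA (4 + e)) (\<lambda>e. NA (8 + e)) \<and>
     trace a b n (NA 6) (\<lambda>e. RA (4 + e)) m (N 18) (N 8) (map (NA 0) [n - d..<n]))" for d s
  have "runs ex_hop ev_hop (trace_code m) s (16 * n + 5) (Inv n)"
    unfolding trace_code_def
  proof (rule runs_pre)
    let ?init = "Atom (Op (NSub 8 17 4)) ;; Atom (Op (NConst 18 m)) ;; Atom (Op (NAdd 7 3 5))"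
    show "runs ex_hop ev_hop (While (NLess 5 7) trace_body) (sem ex_hop ev_hop ?init s) (16 * n + 2) (Inv n)"
    proof (rule runs_for)
      obtain N R NA RA where eq: "s = (N, R, NA, RA)" by (metis prod.exhaust)
      have B: "bfs a b n t 0 t (NA 5) (NA 6) (\<lambda>e. RA (4 + e)) (\<lambda>e. NA (8 + e))"
        using s by (simp add: eq t_def state_inv_def)
      \<comment> \<open>A good order leads the search to the full set; this guarantees that the
        trace starts at a visited code.\<close>
      have "sg m \<noteq> 0" by (simp add: sg_def)
      then obtain xs where "good (inc a n) (posn a b n) xs" "optl (sg m) a b n xs"
        using ex_good_optl_posn by blast
      then have "NA 6 (set_encode {..<n}) \<noteq> 0"
        using bfs_optimal[OF B _ _ m] by (auto simp: optl_def)
      then show "Inv 0 (sem ex_hop ev_hop ?init s)"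
        using s B trace_init[OF m] by (auto simp: eq Inv_def state_inv_def base_def ex_instr_def set_encode_lessThan)
    next
      fix d s assume inv: "Inv d s" and d: "d < n"
      obtain N R NA RA where s: "s = (N, R, NA, RA)" by (metis prod.exhaust)
      define j where "j = n - Suc d"
      have j: "n - d = Suc j" "j < n" using d by (auto simp: j_def)
      let ?x = "N 8" and ?e = "N 18" and ?ys = "map (NA 0) [Suc j..<n]"
      have B: "bfs a b n t 0 t (NA 5) (NA 6) (\<lambda>e. RA (4 + e)) (\<lambda>e. NA (8 + e))"
        and T: "trace a b n (NA 6) (\<lambda>e. RA (4 + e)) m ?e ?x ?ys"
        and b: "base n N R" "tab n a b NA RA" "N 7 = Suc j"
        using inv unfolding Inv_def s j(1) by auto
      have e: "?e < 2" using T by (simp add: trace_def)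
      \<comment> \<open>With fewer than \<open>n\<close> elements output, the remaining set cannot
        be empty.\<close>
      have "?x \<noteq> 0"
      proof
        assume "?x = 0"
        then have "set ?ys = {..<n}" using T by (simp add: trace_def)
        moreover have "card (set ?ys) = n - Suc j" using T distinct_card[of ?ys] by (simp add: trace_def)
        ultimately show False using j by simp
      qed
      then have step: "NA (8 + ?e) ?x < n" "trace a b n (NA 6) (\<lambda>e. RA (4 + e)) m (flip a (NA (8 + ?e) ?x) ?e)
          (?x - 2 ^ NA (8 + ?e) ?x) (NA (8 + ?e) ?x # ?ys)"
        using trace_step[OF B T] by auto
      define i where "i = NA (8 + ?e) ?x"
      have t: "NA 1 i = 2 ^ i" "NA 2 i = (if a i < 0 then 1 else 0)"
        using b(2) step(1) by (auto simp: i_def tab_def)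
      have e01: "?e = 0 \<and> i = NA 8 ?x \<or> ?e = 1 \<and> i = NA 9 ?x" using e by (auto simp: i_def less_2_cases_iff)
      let ?NA = "NA(0 := (NA 0)(j := i))"
      obtain N' where N': "sem ex_hop ev_hop trace_body s = (N', R, ?NA, RA)"
        "N' 8 = ?x - 2 ^ i" "N' 18 = flip a i ?e" "N' 7 = j" "N' 3 = n" "N' 4 = 1" "N' 5 = 0"
        using e01 b t by (cases "a i < 0") (auto simp: s trace_body_def ex_instr_def base_def flip_def)
      have "map (?NA 0) [j..<n] = i # ?ys" using j by (simp add: upt_conv_Cons)
      then have "Inv (Suc d) (sem ex_hop ev_hop trace_body s)"
        using N' b B step(2) d by (simp add: Inv_def j_def[symmetric] i_def[symmetric] base_def)
      then show "runs ex_hop ev_hop trace_body s 14 (Inv (Suc d))"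
        by (rule runs_loop_free[rotated]) (simp_all add: trace_body_def)
    qed (auto simp: Inv_def base_def)
  qed simp_all
  then show ?thesis
  proof (rule runs_mono)
    fix s assume inv: "Inv n s"
    obtain N R NA RA where s: "s = (N, R, NA, RA)" by (metis prod.exhaust)
    let ?ys = "map (NA 0) [0..<n]"
    have B: "bfs a b n t 0 t (NA 5) (NA 6) (\<lambda>e. RA (4 + e)) (\<lambda>e. NA (8 + e))"
      and T: "trace a b n (NA 6) (\<lambda>e. RA (4 + e)) m (N 18) (N 8) ?ys"
      using inv by (auto simp: s Inv_def)
    have "card (set ?ys) = card {..<n}" using T distinct_card[of ?ys] by (simp add: trace_def)
    moreover have "set ?ys \<subseteq> {..<n}" using T by (auto simp: trace_def)
    ultimately have "set ?ys = {..<n}" by (intro card_subset_eq) auto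
    then have "set_decode (N 8) = {}" using T by (auto simp: trace_def)
    then have "N 8 = 0" using set_decode_eq_iff[of "N 8" 0] by simp
    then have "optl (sg m) a b n ?ys" using trace_final[OF _ B m] T by simp
    then show "(\<lambda>(N, R, NA, RA). N 3 = n \<and> optl (sg m) a b n (map (NA 0) [0..<n])) s"
      using inv by (simp add: s Inv_def base_def)
  qed simp
qed

section \<open>The complete program and its running time\<close>

definition main_code :: "nat \<Rightarrow> (hop, cond) com" where
  "main_code m = key_code ;; pos_code ;; search_code ;; trace_code m"

lemma wf_main: "wf_com (main_code m)"
  by (simp add: main_code_def key_code_def init_code_def key_body_def pos_code_def pos_init_def pos_body_def
      pos_store_def pos_wrap_def search_code_def start_code_def search_body_def pop_init_def decode_body_def
      visit_body_def ok_code_def relax_code_def cand_code_def update_code_def trace_code_def trace_body_def)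

definition main_time :: "nat \<Rightarrow> nat \<Rightarrow> nat" where
  "main_time n k = (42 * n + 11) + ((n * (20 * n + 20) + 10) + ((sets_bound n k * (96 * n + 12) + 7) + (16 * n + 5)))"

lemma runs_main:
  assumes "init_amem n a b s" "card {i. i < n \<and> a i < 0} = k" "m < 2"
  shows "runs ex_hop ev_hop (main_code m) s (main_time n k)
    (\<lambda>(N, R, NA, RA). N 3 = n \<and> optl (sg m) a b n (map (NA 0) [0..<n]))"
  unfolding main_code_def main_time_def
  by (rule runs_seq[OF runs_key[OF assms(1)] runs_seq[OF runs_pos runs_seq[OF runs_search[OF _ assms(2)]
    runs_trace[OF _ assms(3)] order_refl] order_refl] order_refl])

text \<open>All terms are bounded by multiples of \<open>2 ^ k * n ^ 3\<close>, after which
  \<open>n ^ 3 \<le> n ^ 6\<close> and \<open>1 \<le> k\<close> give the stated form. The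
  coefficient 324 is 96 + 108 + 108 + 12.\<close>

lemma main_time_le:
  assumes "0 < k" "k \<le> n"
  shows "real (8 * main_time n k + 17 * n + 110) \<le> 10000 * real k * 2 ^ k * real n ^ 6"
proof -
  have n: "1 \<le> n" using assms by simp
  have n2: "n \<le> n ^ 3" "n ^ 2 \<le> n ^ 3" "1 \<le> n ^ 3" using n by (auto intro: power_increasing self_le_power)
  have p: "1 \<le> (2::nat) ^ k" by simp
  have "(n * (n + 1) + 1) * (96 * n + 12) = 96 * n ^ 3 + 108 * n ^ 2 + 108 * n + 12"
    by (simp add: algebra_simps power2_eq_square power3_eq_cube)
  also have "\<dots> \<le> 324 * n ^ 3" using n2 by linarith
  finally have "2 ^ k * ((n * (n + 1) + 1) * (96 * n + 12)) \<le> 2 ^ k * (324 * n ^ 3)"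
    by (rule mult_le_mono2)
  then have "sets_bound n k * (96 * n + 12) \<le> 324 * (2 ^ k * n ^ 3)"
    by (simp only: sets_bound_def mult_ac)
  moreover have "n ^ 3 \<le> 2 ^ k * n ^ 3" using p by simp
  moreover have "n * (20 * n + 20) = 20 * n ^ 2 + 20 * n" by (simp add: algebra_simps power2_eq_square)
  moreover have "8 * (42 * n + 11 + (Y + 10 + (X + 7 + (16 * n + 5)))) + 17 * n + 110 \<le> 10000 * A"
    if "X \<le> 324 * A" "C \<le> A" "Y = 20 * Q + 20 * n" "n \<le> C" "Q \<le> C" "1 \<le> C" for A C Q X Y :: nat
  proof -
    have "8 * (42 * n + 11 + (Y + 10 + (X + 7 + (16 * n + 5)))) + 17 * n + 110 = 481 * n + 8 * Y + 8 * X + 374"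
      by simp
    also have "\<dots> \<le> 481 * A + 8 * (40 * A) + 8 * (324 * A) + 374 * A"
      using that by (intro add_mono mult_le_mono2) auto
    also have "\<dots> \<le> 10000 * A" by simp
    finally show ?thesis .
  qed
  ultimately have "8 * main_time n k + 17 * n + 110 \<le> 10000 * (2 ^ k * n ^ 3)"
    using n2 unfolding main_time_def by blast
  also have "\<dots> \<le> 10000 * (2 ^ k * (k * n ^ 6))"
  proof -
    have "n ^ 3 \<le> n ^ 6" using n by (intro power_increasing) auto
    also have "\<dots> \<le> k * n ^ 6" using assms by simp
    finally show ?thesis by simp
  qed
  finally have "real (8 * main_time n k + 17 * n + 110) \<le> real (10000 * (2 ^ k * (k * n ^ 6)))"
    by (rule of_nat_mono)
  then show ?thesis by (simp add: mult_ac)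
qed

lemma lin_comp_eq: "lin_comp a b n \<sigma> x = slp a (map \<sigma> [0..<n]) * x + cst a b (map \<sigma> [0..<n])"
  unfolding lin_comp_def fold_affine[symmetric] by (simp add: fold_map comp_def)

lemma permutes_ords: "\<sigma> permutes {..<n} \<Longrightarrow> map \<sigma> [0..<n] \<in> ords n"
  using permutes_image[of \<sigma> "{..<n}"] permutes_inj_on[of \<sigma> "{..<n}"]
  by (simp add: ords_def distinct_map atLeast0LessThan)

lemma ords_permutes:
  assumes "map \<sigma> [0..<n] \<in> ords n" "\<forall>j\<ge>n. \<sigma> j = j"
  shows "\<sigma> permutes {..<n}"
  using assms by (intro bij_imp_permutes) (auto simp: ords_def distinct_map bij_betw_def atLeast0LessThan)

lemma optl_lin_comp:
  assumes o: "optl \<epsilon> a b n (map \<sigma> [0..<n])" and \<rho>: "\<rho> permutes {..<n}"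
  shows "\<epsilon> * lin_comp a b n \<sigma> x \<le> \<epsilon> * lin_comp a b n \<rho> x"
proof -
  have "slp a (map \<sigma> [0..<n]) = slp a (map \<rho> [0..<n])"
    using o permutes_ords[OF \<rho>] by (simp add: slp_perm optl_def ords_def)
  then show ?thesis
    using o permutes_ords[OF \<rho>] by (simp add: lin_comp_eq optl_def distrib_left)
qed

theorem theorem1p2:
  shows "(\<exists>p c. computes_within p is_min_perm
            (\<lambda>n k. c * real k * 2 ^ k * real n ^ 6)) \<and>
         (\<exists>p c. computes_within p is_max_perm
            (\<lambda>n k. c * real k * 2 ^ k * real n ^ 6))"
proof -
  have *: "\<exists>p. computes_within p P (\<lambda>n k. 10000 * real k * 2 ^ k * real n ^ 6)"
    if m: "m < 2"
      and P: "\<And>a b n \<sigma>. \<sigma> permutes {..<n} \<Longrightarrow> optl (sg m) a b n (map \<sigma> [0..<n]) \<Longrightarrow> P a b n \<sigma>"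
    for m P
  proof (rule ex_program[OF wf_main])
    fix n k a b s
    assume "card {i. i < n \<and> a i < 0} = k" "init_amem n a b s"
    from runs_main[OF this(2,1) m]
    show "runs ex_hop ev_hop (main_code m) s (main_time n k)
      (\<lambda>(N, R, NA, RA). N 3 = n \<and> (\<forall>\<sigma>. (\<forall>j<n. \<sigma> j = NA 0 j) \<longrightarrow> (\<forall>j\<ge>n. \<sigma> j = j) \<longrightarrow> P a b n \<sigma>))"
    proof (rule runs_mono)
      fix s :: amem
      obtain N R NA RA where s: "s = (N, R, NA, RA)" by (metis prod.exhaust)
      assume "(\<lambda>(N, R, NA, RA). N 3 = n \<and> optl (sg m) a b n (map (NA 0) [0..<n])) s"
      then have N: "N 3 = n" and o: "optl (sg m) a b n (map (NA 0) [0..<n])" by (simp_all add: s)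
      have "P a b n \<sigma>" if \<sigma>: "\<forall>j<n. \<sigma> j = NA 0 j" "\<forall>j\<ge>n. \<sigma> j = j" for \<sigma>
      proof -
        have "map \<sigma> [0..<n] = map (NA 0) [0..<n]" using \<sigma>(1) by simp
        then have "optl (sg m) a b n (map \<sigma> [0..<n])" using o by (simp only:)
        then show ?thesis using P ords_permutes[OF _ \<sigma>(2)] by (simp add: optl_def)
      qed
      then show "(\<lambda>(N, R, NA, RA). N 3 = n \<and> (\<forall>\<sigma>. (\<forall>j<n. \<sigma> j = NA 0 j) \<longrightarrow> (\<forall>j\<ge>n. \<sigma> j = j) \<longrightarrow> P a b n \<sigma>)) s"
        using N by (simp add: s)
    qed simp
  qed (rule main_time_le)
  have "\<exists>p. computes_within p is_min_perm (\<lambda>n k. 10000 * real k * 2 ^ k * real n ^ 6)"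
    by (rule *[of 0]) (use optl_lin_comp in \<open>force simp: is_min_perm_def sg_def\<close>)+
  moreover have "\<exists>p. computes_within p is_max_perm (\<lambda>n k. 10000 * real k * 2 ^ k * real n ^ 6)"
    by (rule *[of 1]) (use optl_lin_comp in \<open>force simp: is_max_perm_def sg_def\<close>)+
  ultimately show ?thesis by blast
qed

end
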